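(* Let $\Sigma$ be a finite monoid and $l\ge1$. (i) All generic $l$-parameter steady state bifurcations that can occur in the fundamental network of $\Sigma$ (for internal phase spaces of any finite dimension) can be investigated in the case of an internal phase space of dimension $d=l$. That is, every $\Sigma$-representation that occurs, up to isomorphism, as the generalized kernel of a generic $l$-parameter steady state bifurcation on $\bigoplus_{\sigma\in\Sigma}\mathbb R^{d'}$ for some $d'\ge1$ also occurs, up to isomorphism, as the generalized kernel of a generic $l$-parameter steady state bifurcation on $\bigoplus_{\sigma\in\Sigma}\mathbb R^{l}$, with equivalent reduced bifurcation problems. (ii) All generic $l$-parameter Hopf bifurcations that can occur in the fundamental network of $\Sigma$ (for internal phase spaces of any finite dimension) can be investigated in the case of an internal phase space of dimension $d=2l$. That is, every $\Sigma$-representation that occurs, up to isomorphism, as the center subspace of a generic $l$-parameter Hopf bifurcation on $\bigoplus_{\sigma\in\Sigma}\mathbb R^{d'}$ for some $d'\ge1$ also occurs, up to isomorphism, as the center subspace of a generic $l$-parameter Hopf bifurcation on $\bigoplus_{\sigma\in\Sigma}\mathbb R^{2l}$, with equivalent reduced bifurcation problems.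
   Context: Fundamental network: let $\Sigma=\{\sigma_1=\mathrm{Id},\dots,\sigma_n\}$ be a finite monoid and $V$ a finite-dimensional real vector space (internal phase space). $\Sigma$ acts on $\bigoplus_{\sigma\in\Sigma}V$ by $(A_\sigma v)_\tau=v_{\tau\sigma}$. Admissible $l$-parameter families are $\Gamma_f(v,\lambda)$, $\lambda\in\mathbb R^l$, with $(\Gamma_f(v,\lambda))_\sigma=f(v_{\sigma_1\sigma},\dots,v_{\sigma_n\sigma},\lambda)$, $f$ smooth; equivalently (known), the smooth families equivariant under all $A_\sigma$. One assumes $\Gamma_f(0,0)=0$. The generalized kernel (steady state bifurcations) is the generalized eigenspace of $D_v\Gamma_f(0,0)$ for eigenvalue $0$; the center subspace is the sum of the generalized eigenspaces for eigenvalues on the imaginary axis. Both are complementable subrepresentations. A Hopf bifurcation requires nonzero purely imaginary eigenvalues of $D_v\Gamma_f(0,0)$. Types: an indecomposable representation $U$ is of real, complex or quaternionic type according to whether $\mathrm{End}_\Sigma(U)$ modulo its radical is $\mathbb R$, $\mathbb C$ or $\mathbb H$. Write, uniquely up to isomorphism, $\bigoplus_\sigma V\cong\bigoplus_i (W_i^{R})^{s_i^R}\oplus\bigoplus_i (W_i^{C})^{s_i^C}\oplus\bigoplus_i (W_i^{H})^{s_i^H}$ with pairwise non-isomorphic indecomposables $W_i^R,W_i^C,W_i^H$ of real, complex, quaternionic type. Genericity (known classification, used as the meaning of "generic"): let $U\cong\bigoplus_i (W_i^{R})^{\rho_i}\oplus\bigoplus_i (W_i^{C})^{\gamma_i}\oplus\bigoplus_i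 (W_i^{H})^{\iota_i}$ with $0\le\rho_i\le s_i^R$, $0\le\gamma_i\le s_i^C$, $0\le\iota_i\le s_i^H$. In generic $l$-parameter bifurcations, $U$ occurs as a generalized kernel subject to the condition $K_U=\sum\rho_i+2\sum\gamma_i+4\sum\iota_i\le l$, and as a center subspace subject to the condition $C_U=\sum\lceil\rho_i/2\rceil+\sum\gamma_i+\sum\iota_i\le l$. Reduced problem: equivariant Lyapunov–Schmidt or center manifold reduction yields a generic $\Sigma$-equivariant family $r:U\times\mathbb R^l\to U$ on the generalized kernel or center subspace $U$, with $r(0,0)=0$ and linearization in $U$ at $(0,0)$ having only the eigenvalue $0$ (respectively only eigenvalues on the imaginary axis). Two reduced bifurcation problems are equivalent if posed on equivariantly isomorphic representations, so that conjugation by the isomorphism identifies the two classes of equivariant bifurcation problems. *)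

theory Defs
  imports "HOL-Analysis.Analysis"
begin

section \<open>Representations of a monoid on subspaces\<close>

text \<open>
  The finite monoid is a type of class \<open>{finite, monoid_mult}\<close>.  A representation is a pair of an
  action \<open>\<rho>\<close> and a carrier subspace \<open>U\<close>; only the values of \<open>\<rho>\<close> on \<open>U\<close> matter.
\<close>

definition linear_between ::
    "'a::real_vector set \<Rightarrow> 'b::real_vector set \<Rightarrow> ('a \<Rightarrow> 'b) \<Rightarrow> bool" where
  "linear_between U U' a \<longleftrightarrow> a \<in> U \<rightarrow> U' \<and> (\<forall>x\<in>U. \<forall>y\<in>U. a (x + y) = a x + a y) \<and>
     (\<forall>c. \<forall>x\<in>U. a (c *\<^sub>R x) = c *\<^sub>R a x)"

definition monoid_rep :: "('s::monoid_mult \<Rightarrow> 'a::real_vector \<Rightarrow> 'a) \<Rightarrow> 'a set \<Rightarrow> bool" where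
  "monoid_rep \<rho> U \<longleftrightarrow> subspace U \<and> (\<forall>\<sigma>. linear_between U U (\<rho> \<sigma>)) \<and>
     (\<forall>x\<in>U. \<rho> 1 x = x) \<and> (\<forall>\<sigma> \<tau>. \<forall>x\<in>U. \<rho> (\<sigma> * \<tau>) x = \<rho> \<sigma> (\<rho> \<tau> x))"

definition rep_hom ::
    "('s::monoid_mult \<Rightarrow> 'a::real_vector \<Rightarrow> 'a) \<Rightarrow> 'a set \<Rightarrow>
     ('s \<Rightarrow> 'b::real_vector \<Rightarrow> 'b) \<Rightarrow> 'b set \<Rightarrow> ('a \<Rightarrow> 'b) \<Rightarrow> bool" where
  "rep_hom \<rho> U \<rho>' U' a \<longleftrightarrow> linear_between U U' a \<and> (\<forall>\<sigma>. \<forall>x\<in>U. a (\<rho> \<sigma> x) = \<rho>' \<sigma> (a x))"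

definition rep_iso ::
    "('s::monoid_mult \<Rightarrow> 'a::real_vector \<Rightarrow> 'a) \<Rightarrow> 'a set \<Rightarrow>
     ('s \<Rightarrow> 'b::real_vector \<Rightarrow> 'b) \<Rightarrow> 'b set \<Rightarrow> ('a \<Rightarrow> 'b) \<Rightarrow> bool" where
  "rep_iso \<rho> U \<rho>' U' \<Phi> \<longleftrightarrow> rep_hom \<rho> U \<rho>' U' \<Phi> \<and> bij_betw \<Phi> U U'"

definition isomorphic_reps ::
    "('s::monoid_mult \<Rightarrow> 'a::real_vector \<Rightarrow> 'a) \<Rightarrow> 'a set \<Rightarrow>
     ('s \<Rightarrow> 'b::real_vector \<Rightarrow> 'b) \<Rightarrow> 'b set \<Rightarrow> bool" where
  "isomorphic_reps \<rho> U \<rho>' U' \<longleftrightarrow> (\<exists>\<Phi>. rep_iso \<rho> U \<rho>' U' \<Phi>)"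

definition indecomposable ::
    "('s::monoid_mult \<Rightarrow> 'a::real_vector \<Rightarrow> 'a) \<Rightarrow> 'a set \<Rightarrow> bool" where
  "indecomposable \<rho> W \<longleftrightarrow> monoid_rep \<rho> W \<and> W \<noteq> {0} \<and>
     (\<forall>X Y. monoid_rep \<rho> X \<and> monoid_rep \<rho> Y \<and> X \<inter> Y = {0} \<and>
        {x + y |x y. x \<in> X \<and> y \<in> Y} = W \<longrightarrow> X = {0} \<or> Y = {0})"


section \<open>Endomorphism algebras and types of indecomposables\<close>

text \<open>Endomorphisms are extensional functions, so that they are determined by their values on \<open>W\<close>.\<close>

definition endos :: "('s::monoid_mult \<Rightarrow> 'a::real_vector \<Rightarrow> 'a) \<Rightarrow> 'a set \<Rightarrow> ('a \<Rightarrow> 'a) set" where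
  "endos \<rho> W = {a \<in> extensional W. rep_hom \<rho> W \<rho> W a}"

definition left_ideal ::
    "('s::monoid_mult \<Rightarrow> 'a::real_vector \<Rightarrow> 'a) \<Rightarrow> 'a set \<Rightarrow> ('a \<Rightarrow> 'a) set \<Rightarrow> bool" where
  "left_ideal \<rho> W M \<longleftrightarrow> M \<subseteq> endos \<rho> W \<and> (\<lambda>x\<in>W. 0) \<in> M \<and>
     (\<forall>a\<in>M. \<forall>b\<in>M. (\<lambda>x\<in>W. a x + b x) \<in> M) \<and>
     (\<forall>e\<in>endos \<rho> W. \<forall>a\<in>M. compose W e a \<in> M)"

definition maximal_left_ideal ::
    "('s::monoid_mult \<Rightarrow> 'a::real_vector \<Rightarrow> 'a) \<Rightarrow> 'a set \<Rightarrow> ('a \<Rightarrow> 'a) set \<Rightarrow> bool" where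
  "maximal_left_ideal \<rho> W M \<longleftrightarrow> left_ideal \<rho> W M \<and> M \<noteq> endos \<rho> W \<and>
     (\<forall>N. left_ideal \<rho> W N \<and> M \<subseteq> N \<longrightarrow> N = M \<or> N = endos \<rho> W)"

text \<open>The Jacobson radical.\<close>

definition radical :: "('s::monoid_mult \<Rightarrow> 'a::real_vector \<Rightarrow> 'a) \<Rightarrow> 'a set \<Rightarrow> ('a \<Rightarrow> 'a) set" where
  "radical \<rho> W = {a \<in> endos \<rho> W. \<forall>M. maximal_left_ideal \<rho> W M \<longrightarrow> a \<in> M}"

text \<open>
  An isomorphism of real algebras from the quotient of the endomorphism algebra by its radical to
  the algebra with multiplication \<open>mul\<close> and unit \<open>e\<close> is given as a surjective unital algebra
  homomorphism \<open>h\<close> whose kernel is the radical.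
\<close>

definition endos_mod_radical_iso ::
    "('s::monoid_mult \<Rightarrow> 'a::real_vector \<Rightarrow> 'a) \<Rightarrow> 'a set \<Rightarrow>
     ('k::real_vector \<Rightarrow> 'k \<Rightarrow> 'k) \<Rightarrow> 'k \<Rightarrow> bool" where
  "endos_mod_radical_iso \<rho> W mul e \<longleftrightarrow> (\<exists>h.
     (\<forall>a\<in>endos \<rho> W. \<forall>b\<in>endos \<rho> W. h (\<lambda>x\<in>W. a x + b x) = h a + h b) \<and>
     (\<forall>c. \<forall>a\<in>endos \<rho> W. h (\<lambda>x\<in>W. c *\<^sub>R a x) = c *\<^sub>R h a) \<and>
     (\<forall>a\<in>endos \<rho> W. \<forall>b\<in>endos \<rho> W. h (compose W a b) = mul (h a) (h b)) \<and>
     h (\<lambda>x\<in>W. x) = e \<and> h ` endos \<rho> W = UNIV \<and> {a \<in> endos \<rho> W. h a = 0} = radical \<rho> W)"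

text \<open>The quaternion \<open>a + b j\<close> with complex \<open>a\<close>, \<open>b\<close> is the pair \<open>(a, b)\<close>; \<open>j z = cnj z j\<close>, \<open>j j = - 1\<close>.\<close>

definition quaternion_mult :: "complex \<times> complex \<Rightarrow> complex \<times> complex \<Rightarrow> complex \<times> complex" where
  "quaternion_mult p q =
     (fst p * fst q - snd p * cnj (snd q), fst p * snd q + snd p * cnj (fst q))"

definition real_type :: "('s::monoid_mult \<Rightarrow> 'a::real_vector \<Rightarrow> 'a) \<Rightarrow> 'a set \<Rightarrow> bool" where
  "real_type \<rho> W \<longleftrightarrow> indecomposable \<rho> W \<and> endos_mod_radical_iso \<rho> W (*) (1::real)"

definition complex_type :: "('s::monoid_mult \<Rightarrow> 'a::real_vector \<Rightarrow> 'a) \<Rightarrow> 'a set \<Rightarrow> bool" where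
  "complex_type \<rho> W \<longleftrightarrow> indecomposable \<rho> W \<and> endos_mod_radical_iso \<rho> W (*) (1::complex)"

definition quaternionic_type :: "('s::monoid_mult \<Rightarrow> 'a::real_vector \<Rightarrow> 'a) \<Rightarrow> 'a set \<Rightarrow> bool" where
  "quaternionic_type \<rho> W \<longleftrightarrow> indecomposable \<rho> W \<and> endos_mod_radical_iso \<rho> W quaternion_mult (1, 0)"


section \<open>Decompositions and the genericity conditions\<close>

text \<open>
  \<open>U\<close> is isomorphic to the direct sum over \<open>i \<in> I\<close> of \<open>m i\<close> copies of \<open>W i\<close>.  The isomorphism is
  given by its components \<open>e i k\<close>; families in the direct sum are indexed by the pairs \<open>(i, k)\<close>
  with \<open>k < m i\<close>.
\<close>

definition iso_direct_sum ::
    "('s::monoid_mult \<Rightarrow> 'a::real_vector \<Rightarrow> 'a) \<Rightarrow> 'a set \<Rightarrow> nat set \<Rightarrow> (nat \<Rightarrow> 'a set) \<Rightarrow>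
     (nat \<Rightarrow> nat) \<Rightarrow> bool" where
  "iso_direct_sum \<rho> U I W m \<longleftrightarrow> (\<exists>e :: nat \<Rightarrow> nat \<Rightarrow> 'a \<Rightarrow> 'a.
     (\<forall>i\<in>I. \<forall>k<m i. rep_hom \<rho> (W i) \<rho> U (e i k)) \<and>
     bij_betw (\<lambda>c. \<Sum>(i, k)\<in>(SIGMA i:I. {..<m i}). e i k (c (i, k)))
       (\<Pi>\<^sub>E (i, k)\<in>(SIGMA i:I. {..<m i}). W i) U)"

text \<open>
  \<open>V\<close> is the direct sum of \<open>s i\<close> copies of the pairwise non-isomorphic indecomposables \<open>W i\<close>, which
  are of real type for \<open>i \<in> R\<close>, complex type for \<open>i \<in> C\<close> and quaternionic type for \<open>i \<in> H\<close>.
\<close>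

definition typed_decomposition ::
    "('s::monoid_mult \<Rightarrow> 'a::real_vector \<Rightarrow> 'a) \<Rightarrow> 'a set \<Rightarrow> nat set \<Rightarrow> nat set \<Rightarrow> nat set \<Rightarrow>
     (nat \<Rightarrow> 'a set) \<Rightarrow> (nat \<Rightarrow> nat) \<Rightarrow> bool" where
  "typed_decomposition \<rho> V R C H W s \<longleftrightarrow>
     finite R \<and> finite C \<and> finite H \<and> R \<inter> C = {} \<and> R \<inter> H = {} \<and> C \<inter> H = {} \<and>
     (\<forall>i\<in>R. real_type \<rho> (W i)) \<and> (\<forall>i\<in>C. complex_type \<rho> (W i)) \<and>
     (\<forall>i\<in>H. quaternionic_type \<rho> (W i)) \<and>
     (\<forall>i\<in>R \<union> C \<union> H. \<forall>j\<in>R \<union> C \<union> H. i \<noteq> j \<longrightarrow> \<not> isomorphic_reps \<rho> (W i) \<rho> (W j)) \<and>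
     (\<forall>i\<in>R \<union> C \<union> H. 0 < s i) \<and>
     iso_direct_sum \<rho> V (R \<union> C \<union> H) W s"

text \<open>
  The number \<open>K\<^sub>U\<close> (below \<open>C\<^sub>U\<close>) attached to the multiplicities \<open>m\<close> of \<open>U\<close> in the decomposition of
  \<open>V\<close> is at most \<open>l\<close>.  As decompositions are unique up to isomorphism, the choice of the
  decomposition is irrelevant.
\<close>

definition generic_kernel_condition ::
    "('s::monoid_mult \<Rightarrow> 'a::real_vector \<Rightarrow> 'a) \<Rightarrow> 'a set \<Rightarrow> 'a set \<Rightarrow> nat \<Rightarrow> bool" where
  "generic_kernel_condition \<rho> V U l \<longleftrightarrow> (\<exists>R C H W s m.
     typed_decomposition \<rho> V R C H W s \<and> (\<forall>i\<in>R \<union> C \<union> H. m i \<le> s i) \<and>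
     iso_direct_sum \<rho> U (R \<union> C \<union> H) W m \<and>
     (\<Sum>i\<in>R. m i) + 2 * (\<Sum>i\<in>C. m i) + 4 * (\<Sum>i\<in>H. m i) \<le> l)"

definition generic_center_condition ::
    "('s::monoid_mult \<Rightarrow> 'a::real_vector \<Rightarrow> 'a) \<Rightarrow> 'a set \<Rightarrow> 'a set \<Rightarrow> nat \<Rightarrow> bool" where
  "generic_center_condition \<rho> V U l \<longleftrightarrow> (\<exists>R C H W s m.
     typed_decomposition \<rho> V R C H W s \<and> (\<forall>i\<in>R \<union> C \<union> H. m i \<le> s i) \<and>
     iso_direct_sum \<rho> U (R \<union> C \<union> H) W m \<and>
     (\<Sum>i\<in>R. nat \<lceil>real (m i) / 2\<rceil>) + (\<Sum>i\<in>C. m i) + (\<Sum>i\<in>H. m i) \<le> l)"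


section \<open>Spectral subspaces of real operators\<close>

text \<open>
  Vectors \<open>x + i y\<close> of the complexification are pairs \<open>(x, y)\<close>; \<open>complex_shift L z\<close> is the
  complexification of \<open>L\<close> minus \<open>z\<close> times the identity.
\<close>

definition complex_shift :: "('a::real_vector \<Rightarrow> 'a) \<Rightarrow> complex \<Rightarrow> 'a \<times> 'a \<Rightarrow> 'a \<times> 'a" where
  "complex_shift L z = (\<lambda>(x, y). (L x - (Re z *\<^sub>R x - Im z *\<^sub>R y), L y - (Im z *\<^sub>R x + Re z *\<^sub>R y)))"

definition eigenvalues_on :: "'a::real_vector set \<Rightarrow> ('a \<Rightarrow> 'a) \<Rightarrow> complex set" where
  "eigenvalues_on U L = {z. \<exists>p\<in>U \<times> U. p \<noteq> 0 \<and> complex_shift L z p = 0}"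

definition generalized_eigenspace :: "('a::real_vector \<Rightarrow> 'a) \<Rightarrow> complex \<Rightarrow> ('a \<times> 'a) set" where
  "generalized_eigenspace L z = {p. \<exists>k. (complex_shift L z ^^ k) p = 0}"

definition generalized_kernel :: "('a::real_vector \<Rightarrow> 'a) \<Rightarrow> 'a set" where
  "generalized_kernel L = {v. \<exists>k. (L ^^ k) v = 0}"

definition imaginary_axis :: "complex set" where
  "imaginary_axis = {z. Re z = 0}"

text \<open>
  The sum of the complex generalized eigenspaces is invariant under complex conjugation; its real
  points form the center subspace.
\<close>

definition center_subspace :: "('a::real_vector \<Rightarrow> 'a) \<Rightarrow> 'a set" where
  "center_subspace L = {v. (v, 0) \<in> span (\<Union>z\<in>imaginary_axis. generalized_eigenspace L z)}"


section \<open>Fundamental networks and their bifurcations\<close>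

text \<open>In finite dimensions, the condition for all \<open>k\<close> is the usual \<open>C\<^sup>\<infinity>\<close> smoothness.\<close>

primrec times_differentiable ::
    "nat \<Rightarrow> ('a::euclidean_space \<Rightarrow> 'b::euclidean_space) \<Rightarrow> bool" where
  "times_differentiable 0 f \<longleftrightarrow> continuous_on UNIV f"
| "times_differentiable (Suc k) f \<longleftrightarrow> (\<forall>x. f differentiable (at x)) \<and>
     (\<forall>v. times_differentiable k (\<lambda>x. frechet_derivative f (at x) v))"

definition smooth :: "('a::euclidean_space \<Rightarrow> 'b::euclidean_space) \<Rightarrow> bool" where
  "smooth f \<longleftrightarrow> (\<forall>k. times_differentiable k f)"

definition network_action ::
    "'s::{finite,monoid_mult} \<Rightarrow> 'v^'s::{finite,monoid_mult} \<Rightarrow> 'v^'s::{finite,monoid_mult}" where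
  "network_action \<sigma> v = (\<chi> \<tau>. v $ (\<tau> * \<sigma>))"

text \<open>
  The arguments of the response function \<open>f\<close> are indexed by the monoid itself rather than by an
  enumeration of it.
\<close>

definition network_field ::
    "(('v^'s::{finite,monoid_mult}) \<times> 'p \<Rightarrow> 'v) \<Rightarrow>
     ('v^'s::{finite,monoid_mult}) \<times> 'p \<Rightarrow> 'v^'s::{finite,monoid_mult}" where
  "network_field f = (\<lambda>(v, \<mu>). \<chi> \<sigma>. f (\<chi> \<tau>. v $ (\<tau> * \<sigma>), \<mu>))"

definition network_linearization ::
    "(((real^'d)^'s::{finite,monoid_mult}) \<times> (real^'l) \<Rightarrow> real^'d) \<Rightarrow>
     (real^'d)^'s::{finite,monoid_mult} \<Rightarrow> (real^'d)^'s::{finite,monoid_mult}" where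
  "network_linearization f = frechet_derivative (\<lambda>v. network_field f (v, 0)) (at 0)"

text \<open>
  Genericity of an \<open>l\<close>-parameter bifurcation means that its generalized kernel (or center subspace)
  is one of those admitted by the classification of generic bifurcations.
\<close>

definition generic_steady_state_bifurcation ::
    "(((real^'d)^'s::{finite,monoid_mult}) \<times> (real^'l) \<Rightarrow> real^'d) \<Rightarrow> bool" where
  "generic_steady_state_bifurcation f \<longleftrightarrow> smooth f \<and> network_field f (0, 0) = 0 \<and>
     0 \<in> eigenvalues_on UNIV (network_linearization f) \<and>
     generic_kernel_condition network_action UNIV
       (generalized_kernel (network_linearization f)) CARD('l)"

definition generic_Hopf_bifurcation ::
    "(((real^'d)^'s::{finite,monoid_mult}) \<times> (real^'l) \<Rightarrow> real^'d) \<Rightarrow> bool" where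
  "generic_Hopf_bifurcation f \<longleftrightarrow> smooth f \<and> network_field f (0, 0) = 0 \<and>
     (\<exists>\<omega>. \<omega> \<noteq> 0 \<and> Complex 0 \<omega> \<in> eigenvalues_on UNIV (network_linearization f)) \<and>
     generic_center_condition network_action UNIV
       (center_subspace (network_linearization f)) CARD('l)"


section \<open>Reduced problems\<close>

text \<open>
  \<open>S\<close> is the set of admitted eigenvalues of the linearization: \<open>{0}\<close> for reduction to the generalized
  kernel, the imaginary axis for reduction to the center subspace.  Families are extensional, that
  is, determined by their values on \<open>U \<times> UNIV\<close>; they are smooth if they extend to a smooth map on
  the ambient space.  On the subspace \<open>U\<close> the derivative \<open>L\<close> within \<open>U\<close> is unique.
\<close>

definition reduced_problems ::
    "complex set \<Rightarrow> ('s::monoid_mult \<Rightarrow> 'a::euclidean_space \<Rightarrow> 'a) \<Rightarrow> 'a set \<Rightarrow>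
     ('a \<times> 'p::euclidean_space \<Rightarrow> 'a) set" where
  "reduced_problems S \<rho> U = {r \<in> U \<times> UNIV \<rightarrow>\<^sub>E U.
     (\<exists>r'. smooth r' \<and> (\<forall>q\<in>U \<times> UNIV. r q = r' q)) \<and>
     (\<forall>\<sigma>. \<forall>u\<in>U. \<forall>\<mu>. r (\<rho> \<sigma> u, \<mu>) = \<rho> \<sigma> (r (u, \<mu>))) \<and>
     r (0, 0) = 0 \<and>
     (\<exists>L. ((\<lambda>u. r (u, 0)) has_derivative L) (at 0 within U) \<and> eigenvalues_on U L \<subseteq> S)}"

definition conjugate ::
    "('a \<Rightarrow> 'b) \<Rightarrow> 'a set \<Rightarrow> 'b set \<Rightarrow> ('a \<times> 'p \<Rightarrow> 'a) \<Rightarrow> 'b \<times> 'p \<Rightarrow> 'b" where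
  "conjugate \<Phi> U U' r = (\<lambda>(w, \<mu>)\<in>U' \<times> UNIV. \<Phi> (r (inv_into U \<Phi> w, \<mu>)))"

definition equivalent_reduced_problems ::
    "'p::euclidean_space itself \<Rightarrow> complex set \<Rightarrow>
     ('s::monoid_mult \<Rightarrow> 'a::euclidean_space \<Rightarrow> 'a) \<Rightarrow> 'a set \<Rightarrow>
     ('s \<Rightarrow> 'b::euclidean_space \<Rightarrow> 'b) \<Rightarrow> 'b set \<Rightarrow> bool" where
  "equivalent_reduced_problems (_ :: 'p itself) S \<rho> U \<rho>' U' \<longleftrightarrow> (\<exists>\<Phi>. rep_iso \<rho> U \<rho>' U' \<Phi> \<and>
     bij_betw (conjugate \<Phi> U U')
       (reduced_problems S \<rho> U :: ('a \<times> 'p \<Rightarrow> 'a) set) (reduced_problems S \<rho>' U'))"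

end

theory Submission
  imports Defs
begin

text \<open>
  The phase space with internal dimension \<open>k\<close> is the direct sum of \<open>k\<close> copies of the regular
  representation \<open>real^'s\<close>.  By the Krull-Schmidt argument (Fitting's lemma makes the endomorphism
  ring of an indecomposable local) it therefore contains, for every \<open>k\<close>, the same indecomposable
  summands up to isomorphism, each at least \<open>k\<close> times.  The numerical conditions bound the
  multiplicities in a generalized kernel by \<open>l\<close> and those in a center subspace by \<open>2 l\<close>, so \<open>U\<close> has
  an isomorphic copy \<open>U'\<close> with an invariant complement in the phase space of internal dimension \<open>l\<close>
  or \<open>2 l\<close>.  The linear equivariant map that is the transported linearization on \<open>U'\<close> and the
  identity on the complement is admissible, and its generalized kernel or center subspace is \<open>U'\<close>.
  Conjugation by the isomorphism identifies the reduced problems, as it extends to a linear map of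
  the ambient spaces.
\<close>

section \<open>Representations and homomorphisms\<close>

text \<open>Phase spaces of different internal dimensions are different ambient spaces, so a summand
  of one is never a subspace of the other. The regular representation mediates between them: the
  index sets and types of the given decomposition are kept, and its subspaces are exchanged along
  isomorphisms. What is extracted from Krull-Schmidt is the agreement of isomorphism classes. That
  each class occurs at least \<open>k\<close> times is then read off from the \<open>k\<close>
  copies of the regular representation. The dimensions \<open>l\<close> and \<open>2 l\<close> are
  bounds for a single multiplicity, not for a sum over the classes: distinct classes are already
  present side by side in one regular representation. The identity is chosen on the complement
  because its only eigenvalue 1 is off the imaginary axis. One and the same operator therefore
  serves the steady state and the Hopf case.\<close>

lemma linear_betweenD:
  assumes "linear_between U U' a"
  shows "x \<in> U \<Longrightarrow> a x \<in> U'"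
    and "x \<in> U \<Longrightarrow> y \<in> U \<Longrightarrow> a (x + y) = a x + a y"
    and "x \<in> U \<Longrightarrow> a (c *\<^sub>R x) = c *\<^sub>R a x"
  using assms by (auto simp: linear_between_def)

lemma linear_between_0: "linear_between U U' a \<Longrightarrow> 0 \<in> U \<Longrightarrow> a 0 = 0"
  using linear_betweenD(3)[of U U' a 0 0] by simp

lemma linear_between_diff:
  assumes "linear_between U U' a" "subspace U" "x \<in> U" "y \<in> U"
  shows "a (x - y) = a x - a y"
proof -
  have "a x = a ((x - y) + y)" by simp
  also have "\<dots> = a (x - y) + a y"
    using assms by (intro linear_betweenD(2)) (auto intro: subspace_diff)
  finally show ?thesis by simp
qed

lemma linear_between_sum:
  assumes "linear_between U U' a" "subspace U" "\<And>i. i \<in> I \<Longrightarrow> f i \<in> U"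
  shows "a (\<Sum>i\<in>I. f i) = (\<Sum>i\<in>I. a (f i))"
  using assms(3)
proof (induction I rule: infinite_finite_induct)
  case (insert i I)
  then have "(\<Sum>i\<in>I. f i) \<in> U"
    using assms(2) by (auto intro: subspace_sum)
  with insert show ?case
    using linear_betweenD(2)[OF assms(1), of "f i" "\<Sum>i\<in>I. f i"] by simp
qed (auto intro: linear_between_0[OF assms(1)] subspace_0[OF assms(2)])

lemma linear_between_inj_on:
  assumes "linear_between U U' a" "subspace U" "\<And>x. x \<in> U \<Longrightarrow> a x = 0 \<Longrightarrow> x = 0"
  shows "inj_on a U"
proof (rule inj_onI)
  fix x y assume "x \<in> U" "y \<in> U" "a x = a y"
  then show "x = y"
    using assms(3)[of "x - y"] linear_between_diff[OF assms(1,2)] subspace_diff[OF assms(2)] by auto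
qed

text \<open>Homomorphisms are controlled on their carrier only, whereas dimension, smoothness and
  span arguments concern maps of the whole space. Extending from a basis of \<open>U\<close> bridges
  the two.\<close>

lemma linear_between_extend:
  fixes a :: "'a::real_vector \<Rightarrow> 'b::real_vector"
  assumes "linear_between U U' a" "subspace U"
  obtains g where "linear g" "\<And>x. x \<in> U \<Longrightarrow> g x = a x"
proof -
  obtain B where B: "B \<subseteq> U" "independent B" "span B = U"
    using basis_exists[of U] assms(2) by (metis span_eq_iff span_subspace)
  obtain g where g: "linear g" "\<forall>x\<in>B. g x = a x"
    using linear_independent_extend[OF B(2)] by blast
  \<comment> \<open>Membership in \<open>U\<close> is carried through the induction because
    \<open>a\<close> is additive on \<open>U\<close> only.\<close>
  have "x \<in> U \<and> g x = a x" if "x \<in> span B" for x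
    using that
  proof (induction rule: span_induct_alt)
    case base
    then show ?case
      using linear_between_0[OF assms(1)] subspace_0[OF assms(2)] linear_0[OF g(1)] by auto
  next
    case (step c x y)
    then have "c *\<^sub>R x \<in> U" using B(1) assms(2) by (auto intro: subspace_scale)
    with step show ?case
      using g B(1) linear_betweenD(2,3)[OF assms(1)] assms(2)
      by (auto simp: linear_add linear_scale subspace_add subset_iff)
  qed
  with g(1) B(3) that show ?thesis by blast
qed

text \<open>An injective endomorphism preserves the dimension of \<open>U\<close>, so its image is a
  subspace of \<open>U\<close> of full dimension.\<close>

lemma linear_between_endo_surj:
  fixes a :: "'a::euclidean_space \<Rightarrow> 'a"
  assumes "linear_between U U a" "subspace U" "inj_on a U"
  shows "a ` U = U"
proof -
  obtain g where g: "linear g" "\<And>x. x \<in> U \<Longrightarrow> g x = a x"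
    using linear_between_extend[OF assms(1,2)] by blast
  have im: "g ` U = a ` U" using g(2) by auto
  have "inj_on g (span U)"
    using assms(2,3) g(2) by (simp add: span_eq_iff[THEN iffD2] inj_on_def)
  then have "dim (g ` U) = dim U" using g(1) by (intro dim_image_eq) auto
  moreover have "subspace (g ` U)" by (rule linear_subspace_image[OF g(1) assms(2)])
  moreover have "g ` U \<subseteq> U" using im linear_betweenD(1)[OF assms(1)] by auto
  ultimately show ?thesis using subspace_dim_equal[of "g ` U" U] assms(2) im by auto
qed

section \<open>Equivariant maps, subrepresentations and isomorphisms\<close>

lemma monoid_repD:
  assumes "monoid_rep \<rho> U"
  shows "subspace U" "linear_between U U (\<rho> \<sigma>)" "x \<in> U \<Longrightarrow> \<rho> 1 x = x"
    "x \<in> U \<Longrightarrow> \<rho> (\<sigma> * \<tau>) x = \<rho> \<sigma> (\<rho> \<tau> x)" "x \<in> U \<Longrightarrow> \<rho> \<sigma> x \<in> U" "0 \<in> U"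
  using assms by (auto simp: monoid_rep_def linear_between_def subspace_0)

lemma rep_homD:
  assumes "rep_hom \<rho> U \<rho>' U' a"
  shows "linear_between U U' a" "x \<in> U \<Longrightarrow> a (\<rho> \<sigma> x) = \<rho>' \<sigma> (a x)" "x \<in> U \<Longrightarrow> a x \<in> U'"
    "x \<in> U \<Longrightarrow> y \<in> U \<Longrightarrow> a (x + y) = a x + a y"
    "x \<in> U \<Longrightarrow> a (c *\<^sub>R x) = c *\<^sub>R a x"
    "0 \<in> U \<Longrightarrow> a 0 = 0"
  using assms linear_between_0[of U U' a] by (auto simp: rep_hom_def linear_between_def)

lemma rep_homI:
  assumes "\<And>x. x \<in> U \<Longrightarrow> a x \<in> U'"
    "\<And>x y. x \<in> U \<Longrightarrow> y \<in> U \<Longrightarrow> a (x + y) = a x + a y"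
    "\<And>c x. x \<in> U \<Longrightarrow> a (c *\<^sub>R x) = c *\<^sub>R a x"
    "\<And>\<sigma> x. x \<in> U \<Longrightarrow> a (\<rho> \<sigma> x) = \<rho>' \<sigma> (a x)"
  shows "rep_hom \<rho> U \<rho>' U' a"
  using assms by (auto simp: rep_hom_def linear_between_def)

lemma rep_hom_id: "rep_hom \<rho> U \<rho> U (\<lambda>x. x)"
  by (auto intro: rep_homI)

lemma rep_hom_comp:
  assumes "rep_hom \<rho> U \<rho>' U' a" "rep_hom \<rho>' U' \<rho>'' U'' b"
  shows "rep_hom \<rho> U \<rho>'' U'' (\<lambda>x. b (a x))"
  using assms by (intro rep_homI) (auto simp: rep_homD)

lemma rep_hom_zero:
  assumes "monoid_rep \<rho>' U'"
  shows "rep_hom \<rho> U \<rho>' U' (\<lambda>x. 0)"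
  by (intro rep_homI) (auto simp: monoid_repD[OF assms] linear_between_0[OF monoid_repD(2)[OF assms]])

lemma rep_hom_add:
  assumes "monoid_rep \<rho>' U'" "rep_hom \<rho> U \<rho>' U' a" "rep_hom \<rho> U \<rho>' U' b"
  shows "rep_hom \<rho> U \<rho>' U' (\<lambda>x. a x + b x)"
  using assms(2,3) monoid_repD(1)[OF assms(1)] linear_betweenD(2)[OF monoid_repD(2)[OF assms(1)]]
  by (intro rep_homI) (auto simp: rep_homD subspace_add scaleR_right_distrib)

lemma rep_hom_diff:
  assumes "monoid_rep \<rho>' U'" "rep_hom \<rho> U \<rho>' U' a" "rep_hom \<rho> U \<rho>' U' b"
  shows "rep_hom \<rho> U \<rho>' U' (\<lambda>x. a x - b x)"
  using assms(2,3) monoid_repD(1)[OF assms(1)]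
    linear_between_diff[OF monoid_repD(2)[OF assms(1)] monoid_repD(1)[OF assms(1)]]
  by (intro rep_homI) (auto simp: rep_homD subspace_diff scaleR_right_diff_distrib)

lemma rep_hom_sum:
  assumes "monoid_rep \<rho>' U'" "\<And>j. j \<in> J \<Longrightarrow> rep_hom \<rho> U \<rho>' U' (a j)"
  shows "rep_hom \<rho> U \<rho>' U' (\<lambda>x. \<Sum>j\<in>J. a j x)"
  using assms(2)
  by (induction J rule: infinite_finite_induct)
     (auto intro: rep_hom_zero[OF assms(1)] rep_hom_add[OF assms(1)])

lemma rep_hom_restrict:
  "rep_hom \<rho> U \<rho>' U' a \<Longrightarrow> monoid_rep \<rho> X \<Longrightarrow> X \<subseteq> U \<Longrightarrow> rep_hom \<rho> X \<rho>' U' a"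
  by (intro rep_homI) (auto simp: rep_homD subset_iff)

lemma rep_hom_corestrict:
  "rep_hom \<rho> U \<rho>' U' a \<Longrightarrow> a ` U \<subseteq> X \<Longrightarrow> rep_hom \<rho> U \<rho>' X a"
  by (intro rep_homI) (auto simp: rep_homD subset_iff)

lemma rep_hom_funpow:
  "rep_hom \<rho> U \<rho> U a \<Longrightarrow> rep_hom \<rho> U \<rho> U (a ^^ n)"
  by (induction n) (auto intro: rep_hom_id[unfolded id_def[symmetric]] rep_hom_comp simp: comp_def)

lemma rep_hom_cong:
  assumes "rep_hom \<rho> U \<rho>' U' a" "monoid_rep \<rho> U" "\<And>x. x \<in> U \<Longrightarrow> b x = a x"
  shows "rep_hom \<rho> U \<rho>' U' b"
  using monoid_repD(1,5)[OF assms(2)] rep_homD[OF assms(1)]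
  by (intro rep_homI) (auto simp: assms(3) subspace_add subspace_scale)

lemma subrep:
  assumes "monoid_rep \<rho> U" "subspace X" "X \<subseteq> U" "\<And>\<sigma> x. x \<in> X \<Longrightarrow> \<rho> \<sigma> x \<in> X"
  shows "monoid_rep \<rho> X"
  using assms by (auto simp: monoid_rep_def linear_between_def subset_iff Pi_iff)

lemma subrep_kernel:
  assumes "monoid_rep \<rho> U" "monoid_rep \<rho>' U'" "rep_hom \<rho> U \<rho>' U' a"
  shows "monoid_rep \<rho> {x \<in> U. a x = 0}"
proof (rule subrep[OF assms(1)])
  show "subspace {x \<in> U. a x = 0}"
    using monoid_repD(1,6)[OF assms(1)] by (auto simp: subspace_def rep_homD[OF assms(3)])
qed (auto simp: rep_homD[OF assms(3)] monoid_repD[OF assms(1)]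
       linear_between_0[OF monoid_repD(2)[OF assms(2)]] monoid_repD(6)[OF assms(2)])

lemma subrep_image:
  assumes "monoid_rep \<rho> U" "monoid_rep \<rho>' U'" "rep_hom \<rho> U \<rho>' U' a"
  shows "monoid_rep \<rho>' (a ` U)"
proof (rule subrep[OF assms(2)])
  have "0 \<in> a ` U"
    using rep_homD(6)[OF assms(3)] monoid_repD(6)[OF assms(1)] by force
  moreover have "a x + a y \<in> a ` U" "c *\<^sub>R a x \<in> a ` U" if "x \<in> U" "y \<in> U" for x y c
    using that rep_homD(4,5)[OF assms(3), symmetric] monoid_repD(1)[OF assms(1)]
    by (auto simp: subspace_add subspace_scale)
  ultimately show "subspace (a ` U)" by (auto simp: subspace_def)
qed (auto simp: rep_homD(3)[OF assms(3)] monoid_repD(5)[OF assms(1)] rep_homD(2)[OF assms(3), symmetric])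

lemma rep_isoD:
  assumes "rep_iso \<rho> U \<rho>' U' \<Phi>"
  shows "rep_hom \<rho> U \<rho>' U' \<Phi>" "bij_betw \<Phi> U U'" "inj_on \<Phi> U" "\<Phi> ` U = U'"
    "x \<in> U \<Longrightarrow> inv_into U \<Phi> (\<Phi> x) = x" "y \<in> U' \<Longrightarrow> \<Phi> (inv_into U \<Phi> y) = y"
    "y \<in> U' \<Longrightarrow> inv_into U \<Phi> y \<in> U"
  using assms by (auto simp: rep_iso_def bij_betw_def inv_into_into f_inv_into_f)

lemma rep_isoI:
  assumes "rep_hom \<rho> U \<rho>' U' a" "rep_hom \<rho>' U' \<rho> U b"
    "\<And>x. x \<in> U \<Longrightarrow> b (a x) = x" "\<And>y. y \<in> U' \<Longrightarrow> a (b y) = y"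
  shows "rep_iso \<rho> U \<rho>' U' a"
  unfolding rep_iso_def
  using assms by (auto intro!: bij_betw_byWitness[where f' = b] simp: rep_homD)

lemma rep_iso_inv:
  assumes "rep_iso \<rho> U \<rho>' U' \<Phi>" "monoid_rep \<rho> U"
  shows "rep_iso \<rho>' U' \<rho> U (inv_into U \<Phi>)"
proof -
  note D = rep_isoD[OF assms(1)] and H = rep_homD[OF rep_isoD(1)[OF assms(1)]]
  note M = monoid_repD[OF assms(2)]
  have "rep_hom \<rho>' U' \<rho> U (inv_into U \<Phi>)"
  proof (rule rep_homI)
    fix x y assume xy: "x \<in> U'" "y \<in> U'"
    show "inv_into U \<Phi> (x + y) = inv_into U \<Phi> x + inv_into U \<Phi> y"
      by (rule inv_into_f_eq[OF D(3)]) (auto simp: H D xy subspace_add[OF M(1)])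
  next
    fix c x assume x: "x \<in> U'"
    show "inv_into U \<Phi> (c *\<^sub>R x) = c *\<^sub>R inv_into U \<Phi> x"
      by (rule inv_into_f_eq[OF D(3)]) (auto simp: H D x subspace_scale[OF M(1)])
  next
    fix \<sigma> x assume x: "x \<in> U'"
    show "inv_into U \<Phi> (\<rho>' \<sigma> x) = \<rho> \<sigma> (inv_into U \<Phi> x)"
      by (rule inv_into_f_eq[OF D(3)]) (auto simp: H D x M)
  qed (auto simp: D)
  then show ?thesis
    by (auto simp: rep_iso_def bij_betw_inv_into D)
qed

lemma isomorphic_reps_sym:
  "isomorphic_reps \<rho> U \<rho>' U' \<Longrightarrow> monoid_rep \<rho> U \<Longrightarrow> isomorphic_reps \<rho>' U' \<rho> U"
  unfolding isomorphic_reps_def using rep_iso_inv by blast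

lemma isomorphic_reps_trans:
  "isomorphic_reps \<rho> U \<rho>' U' \<Longrightarrow> isomorphic_reps \<rho>' U' \<rho>'' U'' \<Longrightarrow> isomorphic_reps \<rho> U \<rho>'' U''"
  unfolding isomorphic_reps_def rep_iso_def
  by (metis (no_types, lifting) bij_betw_trans comp_def rep_hom_comp ext)

section \<open>Indecomposable representations and their local endomorphism rings\<close>

lemma indecomposableD:
  assumes "indecomposable \<rho> W"
  shows "monoid_rep \<rho> W" "W \<noteq> {0}"
    "monoid_rep \<rho> X \<Longrightarrow> monoid_rep \<rho> Y \<Longrightarrow> X \<inter> Y = {0} \<Longrightarrow> {x + y |x y. x \<in> X \<and> y \<in> Y} = W \<Longrightarrow>
      X = {0} \<or> Y = {0}"
  using assms by (auto simp: indecomposable_def)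

lemma indecomposableE:
  assumes "indecomposable \<rho> W"
    "monoid_rep \<rho> X" "monoid_rep \<rho> Y" "X \<subseteq> W" "Y \<subseteq> W"
    "\<And>x. x \<in> X \<Longrightarrow> x \<in> Y \<Longrightarrow> x = 0" "\<And>w. w \<in> W \<Longrightarrow> \<exists>x\<in>X. \<exists>y\<in>Y. w = x + y"
  shows "X = {0} \<or> Y = {0}"
proof (rule indecomposableD(3)[OF assms(1-3)])
  show "X \<inter> Y = {0}"
    using assms(6) monoid_repD(6)[OF assms(2)] monoid_repD(6)[OF assms(3)] by auto
  show "{x + y |x y. x \<in> X \<and> y \<in> Y} = W"
    using assms(4,5,7) subspace_add[OF monoid_repD(1)[OF indecomposableD(1)[OF assms(1)]]] by blast
qed

text \<open>Fitting's lemma: once the kernels of the powers of \<open>a\<close> have become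
  stationary, \<open>Q\<close> is the direct sum of the kernel and the image of that power, and
  indecomposability makes one of them zero.\<close>

lemma indecomposable_endo_inj_or_nilpotent:
  fixes a :: "'a::euclidean_space \<Rightarrow> 'a"
  assumes "indecomposable \<rho> Q" "rep_hom \<rho> Q \<rho> Q a" "\<not> inj_on a Q"
  obtains n where "\<And>x. x \<in> Q \<Longrightarrow> (a ^^ n) x = 0"
proof -
  note Q = indecomposableD(1)[OF assms(1)]
  note h = rep_hom_funpow[OF assms(2)]
  define K where "K n = {x \<in> Q. (a ^^ n) x = 0}" for n
  have K: "monoid_rep \<rho> (K n)" for n
    unfolding K_def by (rule subrep_kernel[OF Q Q h])
  \<comment> \<open>The exponent is one whose kernel has the largest dimension; the ambient
    dimension bounds all of them.\<close>
  have "\<exists>n. \<forall>m. dim (K m) \<le> dim (K n)"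
    using ex_has_greatest_nat[of "\<lambda>n. True" 0 "\<lambda>n. dim (K n)" "Suc DIM('a)"]
    by (auto simp: less_Suc_eq_le dim_subset_UNIV)
  then obtain n where n: "\<And>m. dim (K m) \<le> dim (K n)" by blast
  \<comment> \<open>Passing to the double exponent makes kernel and image of the \<open>n\<close>-th
    power meet in 0 only: if the power kills a vector of its own image, a preimage lies in
    \<open>K (n + n)\<close>, hence in \<open>K n\<close>.\<close>
  have "K n \<subseteq> K (n + n)"
    by (auto simp: K_def funpow_add rep_homD(6)[OF h] monoid_repD(6)[OF Q])
  then have eq: "K n = K (n + n)"
    using subspace_dim_equal[OF monoid_repD(1)[OF K] monoid_repD(1)[OF K]] n by blast
  define I where "I = (a ^^ n) ` Q"
  have I: "monoid_rep \<rho> I" "I \<subseteq> Q"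
    unfolding I_def using subrep_image[OF Q Q h] rep_homD(3)[OF h] by auto
  have disj: "y = 0" if "y \<in> K n" "y \<in> I" for y
  proof -
    from that(2) obtain x where "x \<in> Q" "y = (a ^^ n) x" by (auto simp: I_def)
    with that have "x \<in> K (n + n)" by (auto simp: K_def funpow_add)
    with eq \<open>y = _\<close> show ?thesis by (auto simp: K_def)
  qed
  have hI: "rep_hom \<rho> I \<rho> I (a ^^ n)"
    using I by (intro rep_hom_corestrict[OF rep_hom_restrict[OF h]]) (auto simp: I_def)
  \<comment> \<open>The power is injective on its image and so maps it onto itself; every
    \<open>x\<close> then differs from an element of the image by an element of the kernel.\<close>
  have "inj_on (a ^^ n) I"
    using I disj by (intro linear_between_inj_on[OF rep_homD(1)[OF hI] monoid_repD(1)]) (auto simp: K_def)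
  then have surj: "(a ^^ n) ` I = I"
    using linear_between_endo_surj[OF rep_homD(1)[OF hI] monoid_repD(1)[OF I(1)]] by simp
  have "K n = {0} \<or> I = {0}"
  proof (rule indecomposableE[OF assms(1) K I(1) _ I(2)])
    fix x assume x: "x \<in> Q"
    then obtain y where y: "y \<in> I" "(a ^^ n) x = (a ^^ n) y"
      using surj by (metis I_def imageE imageI)
    with x I have "x - y \<in> K n"
      using linear_between_diff[OF rep_homD(1)[OF h] monoid_repD(1)[OF Q]]
      by (auto simp: K_def subspace_diff[OF monoid_repD(1)[OF Q]] subset_iff)
    with y(1) show "\<exists>x'\<in>K n. \<exists>y\<in>I. x = x' + y" by (metis diff_add_cancel)
  next
    show "K n \<subseteq> Q" by (auto simp: K_def)
  qed (rule disj)
  then show ?thesis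
  proof
    assume "I = {0}"
    with that show ?thesis by (auto simp: I_def)
  next
    assume K0: "K n = {0}"
    \<comment> \<open>A vector killed by \<open>a\<close> is placed in \<open>K (Suc n)\<close>
      rather than in \<open>K n\<close>, because \<open>n\<close> may be 0; maximality identifies
      the two kernels.\<close>
    have "inj_on a Q"
    proof (rule linear_between_inj_on[OF rep_homD(1)[OF assms(2)] monoid_repD(1)[OF Q]])
      fix x assume x: "x \<in> Q" "a x = 0"
      then have "(a ^^ m) (a x) = 0" for m
        using rep_homD(6)[OF h monoid_repD(6)[OF Q]] by simp
      then have "(a ^^ Suc n) x = 0" by (simp add: funpow_swap1)
      have "x \<in> K (Suc n)" using x \<open>(a ^^ Suc n) x = 0\<close> by (simp add: K_def)
      moreover have "K (Suc n) = K n"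
      proof -
        have "K n \<subseteq> K (Suc n)"
          using rep_homD(6)[OF assms(2) monoid_repD(6)[OF Q]] by (auto simp: K_def)
        then show ?thesis
          using subspace_dim_equal[OF monoid_repD(1)[OF K] monoid_repD(1)[OF K]] n by blast
      qed
      ultimately show "x = 0" using K0 by auto
    qed
    with assms(3) show ?thesis by simp
  qed
qed

lemma rep_hom_endo_iso:
  fixes a :: "'a::euclidean_space \<Rightarrow> 'a"
  assumes "monoid_rep \<rho> Q" "rep_hom \<rho> Q \<rho> Q a" "inj_on a Q"
  shows "rep_iso \<rho> Q \<rho> Q a"
  using assms linear_between_endo_surj[OF rep_homD(1)[OF assms(2)] monoid_repD(1)[OF assms(1)]]
  by (auto simp: rep_iso_def bij_betw_def)

text \<open>This is locality of the endomorphism ring: non-invertible endomorphisms are closed under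
  addition. Composing with the inverse of the sum turns a non-injective summand into a nilpotent
  endomorphism.\<close>

lemma indecomposable_inj_add:
  fixes a b :: "'a::euclidean_space \<Rightarrow> 'a"
  assumes Q: "indecomposable \<rho> Q" and a: "rep_hom \<rho> Q \<rho> Q a" and b: "rep_hom \<rho> Q \<rho> Q b"
    and inj: "inj_on (\<lambda>x. a x + b x) Q"
  shows "inj_on a Q \<or> inj_on b Q"
proof (rule ccontr)
  assume neg: "\<not> ?thesis"
  note M = indecomposableD(1)[OF Q]
  define u where "u = (\<lambda>x. a x + b x)"
  have "rep_iso \<rho> Q \<rho> Q u"
    unfolding u_def by (intro rep_hom_endo_iso rep_hom_add M a b inj)
  note u = rep_isoD[OF this] and v = rep_isoD[OF rep_iso_inv[OF this M]]
  define v where "v = inv_into Q u"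
  have av: "rep_hom \<rho> Q \<rho> Q (\<lambda>x. v (a x))"
    unfolding v_def by (rule rep_hom_comp[OF a v(1)])
  have "\<not> inj_on (\<lambda>x. v (a x)) Q"
    using neg u(6) rep_homD(3)[OF a] by (auto simp: v_def inj_on_def) metis
  then obtain n where n: "\<And>x. x \<in> Q \<Longrightarrow> ((\<lambda>x. v (a x)) ^^ n) x = 0"
    using indecomposable_endo_inj_or_nilpotent[OF Q av] by blast
  \<comment> \<open>On the kernel of \<open>b\<close> the sum coincides with \<open>a\<close>, so
    \<open>v\<close> after \<open>a\<close> fixes this kernel pointwise; a nilpotent map can do so
    only if the kernel is zero.\<close>
  have "inj_on b Q"
  proof (rule linear_between_inj_on[OF rep_homD(1)[OF b] monoid_repD(1)[OF M]])
    fix x assume x: "x \<in> Q" "b x = 0"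
    then have "v (a x) = x" using u(5)[OF x(1)] by (simp add: u_def v_def)
    then have "((\<lambda>x. v (a x)) ^^ n) x = x" by (induction n) auto
    with n x show "x = 0" by simp
  qed
  with neg show False by simp
qed

lemma indecomposable_inj_sum:
  fixes c :: "'j \<Rightarrow> 'a::euclidean_space \<Rightarrow> 'a"
  assumes Q: "indecomposable \<rho> Q" and c: "\<And>j. j \<in> J \<Longrightarrow> rep_hom \<rho> Q \<rho> Q (c j)"
    and inj: "inj_on (\<lambda>x. \<Sum>j\<in>J. c j x) Q"
  shows "\<exists>j\<in>J. inj_on (c j) Q"
  using c inj
proof (induction J rule: infinite_finite_induct)
  case (insert j J)
  have "inj_on (c j) Q \<or> inj_on (\<lambda>x. \<Sum>j\<in>J. c j x) Q"
    using insert
    by (intro indecomposable_inj_add[OF Q] rep_hom_sum indecomposableD(1)[OF Q]) auto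
  with insert show ?case by auto
\<comment> \<open>The sum over an empty or infinite index set is the zero map, which is not
  injective since \<open>Q\<close> is nonzero.\<close>
qed (use indecomposableD(2)[OF Q] monoid_repD(6)[OF indecomposableD(1)[OF Q]] in \<open>auto simp: inj_on_def\<close>)

text \<open>The composite is an automorphism of \<open>Q\<close>, so \<open>W\<close> is the direct
  sum of the image of \<open>a\<close> and the kernel of \<open>b\<close>. The image is nonzero
  because \<open>Q\<close> is, hence the kernel vanishes and \<open>a\<close> is onto.\<close>

lemma indecomposable_retract_iso:
  fixes Q :: "'a::euclidean_space set"
  assumes Q: "indecomposable \<rho> Q" and W: "indecomposable \<rho>' W"
    and a: "rep_hom \<rho> Q \<rho>' W a" and b: "rep_hom \<rho>' W \<rho> Q b" and inj: "inj_on (\<lambda>x. b (a x)) Q"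
  shows "rep_iso \<rho> Q \<rho>' W a"
proof -
  note MQ = indecomposableD(1)[OF Q] and MW = indecomposableD(1)[OF W]
  note c = rep_isoD[OF rep_hom_endo_iso[OF MQ rep_hom_comp[OF a b] inj]]
  have inja: "inj_on a Q" using inj by (auto simp: inj_on_def)
  have z: "x = 0" if "x \<in> Q" "b (a x) = 0" for x
    using that inj monoid_repD(6)[OF MQ] rep_homD(6)[OF rep_hom_comp[OF a b]]
    by (metis inj_on_contraD)
  \<comment> \<open>Surjectivity of \<open>b\<close> after \<open>a\<close> provides an
    \<open>x\<close> for which \<open>a x\<close> and \<open>w\<close> have the same image under
    \<open>b\<close>.\<close>
  have dec: "\<exists>x\<in>Q. w - a x \<in> {w \<in> W. b w = 0}" if w: "w \<in> W" for w
  proof -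
    obtain x where x: "x \<in> Q" "b w = b (a x)"
      using c(4) rep_homD(3)[OF b w] by (metis imageE)
    then have "w - a x \<in> {w \<in> W. b w = 0}"
      using w rep_homD(3)[OF a] linear_between_diff[OF rep_homD(1)[OF b] monoid_repD(1)[OF MW]]
      by (auto simp: subspace_diff[OF monoid_repD(1)[OF MW]])
    with x(1) show ?thesis by blast
  qed
  have "a ` Q = {0} \<or> {w \<in> W. b w = 0} = {0}"
  proof (rule indecomposableE[OF W subrep_image[OF MQ MW a] subrep_kernel[OF MW MQ b]])
    fix w assume "w \<in> W"
    then obtain x where "x \<in> Q" "w - a x \<in> {w \<in> W. b w = 0}" using dec by blast
    then show "\<exists>x\<in>a ` Q. \<exists>y\<in>{w \<in> W. b w = 0}. w = x + y"
      by (intro bexI[of _ "a x"] bexI[of _ "w - a x"]) auto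
  next
    fix w assume "w \<in> a ` Q" "w \<in> {w \<in> W. b w = 0}"
    then show "w = 0" using z rep_homD(6)[OF a monoid_repD(6)[OF MQ]] by auto
  qed (use rep_homD(3)[OF a] in auto)
  moreover have "a ` Q \<noteq> {0}"
  proof
    assume "a ` Q = {0}"
    then have "a x = 0" if "x \<in> Q" for x using that by blast
    then have "x = 0" if "x \<in> Q" for x
      using that z rep_homD(6)[OF b monoid_repD(6)[OF MW]] by simp
    with indecomposableD(2)[OF Q] monoid_repD(6)[OF MQ] show False by auto
  qed
  ultimately have K: "{w \<in> W. b w = 0} = {0}" by blast
  have "a ` Q = W"
    using dec rep_homD(3)[OF a] unfolding K by force
  with inja a show ?thesis by (auto simp: rep_iso_def bij_betw_def)
qed

section \<open>Direct sum decompositions\<close>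

text \<open>
  Direct sum decompositions are handled through injections \<open>\<iota>\<close> and projections \<open>\<pi>\<close>, so that the
  summands may live in another ambient space than the sum.
\<close>

definition biproduct_maps ::
    "('s::monoid_mult \<Rightarrow> 'a::real_vector \<Rightarrow> 'a) \<Rightarrow> 'a set \<Rightarrow> ('s \<Rightarrow> 'b::real_vector \<Rightarrow> 'b) \<Rightarrow>
     'j set \<Rightarrow> ('j \<Rightarrow> 'b set) \<Rightarrow> ('j \<Rightarrow> 'b \<Rightarrow> 'a) \<Rightarrow> ('j \<Rightarrow> 'a \<Rightarrow> 'b) \<Rightarrow> bool" where
  "biproduct_maps \<rho> U \<rho>' J W \<iota> \<pi> \<longleftrightarrow> finite J \<and> monoid_rep \<rho> U \<and> (\<forall>j\<in>J. monoid_rep \<rho>' (W j)) \<and>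
     (\<forall>j\<in>J. rep_hom \<rho>' (W j) \<rho> U (\<iota> j)) \<and> (\<forall>j\<in>J. rep_hom \<rho> U \<rho>' (W j) (\<pi> j)) \<and>
     (\<forall>j\<in>J. \<forall>k\<in>J. \<forall>x\<in>W k. \<pi> j (\<iota> k x) = (if j = k then x else 0)) \<and>
     (\<forall>x\<in>U. (\<Sum>j\<in>J. \<iota> j (\<pi> j x)) = x)"

definition biproduct ::
    "('s::monoid_mult \<Rightarrow> 'a::real_vector \<Rightarrow> 'a) \<Rightarrow> 'a set \<Rightarrow> ('s \<Rightarrow> 'b::real_vector \<Rightarrow> 'b) \<Rightarrow>
     'j set \<Rightarrow> ('j \<Rightarrow> 'b set) \<Rightarrow> bool" where
  "biproduct \<rho> U \<rho>' J W \<longleftrightarrow> (\<exists>\<iota> \<pi>. biproduct_maps \<rho> U \<rho>' J W \<iota> \<pi>)"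

lemma biproduct_mapsD:
  assumes "biproduct_maps \<rho> U \<rho>' J W \<iota> \<pi>"
  shows "finite J" "monoid_rep \<rho> U" "j \<in> J \<Longrightarrow> monoid_rep \<rho>' (W j)"
    "j \<in> J \<Longrightarrow> rep_hom \<rho>' (W j) \<rho> U (\<iota> j)" "j \<in> J \<Longrightarrow> rep_hom \<rho> U \<rho>' (W j) (\<pi> j)"
    "j \<in> J \<Longrightarrow> k \<in> J \<Longrightarrow> y \<in> W k \<Longrightarrow> \<pi> j (\<iota> k y) = (if j = k then y else 0)"
    "x \<in> U \<Longrightarrow> (\<Sum>j\<in>J. \<iota> j (\<pi> j x)) = x"
  using assms by (auto simp: biproduct_maps_def)

lemma biproduct_mapsI:
  assumes "finite J" "monoid_rep \<rho> U" "\<And>j. j \<in> J \<Longrightarrow> monoid_rep \<rho>' (W j)"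
    "\<And>j. j \<in> J \<Longrightarrow> rep_hom \<rho>' (W j) \<rho> U (\<iota> j)" "\<And>j. j \<in> J \<Longrightarrow> rep_hom \<rho> U \<rho>' (W j) (\<pi> j)"
    "\<And>j k x. j \<in> J \<Longrightarrow> k \<in> J \<Longrightarrow> x \<in> W k \<Longrightarrow> \<pi> j (\<iota> k x) = (if j = k then x else 0)"
    "\<And>x. x \<in> U \<Longrightarrow> (\<Sum>j\<in>J. \<iota> j (\<pi> j x)) = x"
  shows "biproduct_maps \<rho> U \<rho>' J W \<iota> \<pi>"
  using assms by (simp add: biproduct_maps_def)

text \<open>Besides renumbering, this replaces summands by isomorphic ones in another ambient space;
  it is the device that moves decompositions between phase spaces.\<close>

lemma biproduct_reindex:
  assumes "biproduct \<rho> U \<rho>' J W" "bij_betw h J' J"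
    "\<And>j. j \<in> J' \<Longrightarrow> monoid_rep \<rho>'' (W' j)"
    "\<And>j. j \<in> J' \<Longrightarrow> isomorphic_reps \<rho>'' (W' j) \<rho>' (W (h j))"
  shows "biproduct \<rho> U \<rho>'' J' W'"
proof -
  obtain \<iota> \<pi> where "biproduct_maps \<rho> U \<rho>' J W \<iota> \<pi>" using assms(1) by (auto simp: biproduct_def)
  note B = biproduct_mapsD[OF this]
  obtain \<phi> where \<phi>: "\<And>j. j \<in> J' \<Longrightarrow> rep_iso \<rho>'' (W' j) \<rho>' (W (h j)) (\<phi> j)"
    using assms(4) unfolding isomorphic_reps_def by metis
  note F = rep_isoD[OF \<phi>] and G = rep_isoD[OF rep_iso_inv[OF \<phi> assms(3)]]
  have h: "h j \<in> J" if "j \<in> J'" for j using assms(2) that by (auto simp: bij_betw_def)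
  have hinj: "h j = h k \<longleftrightarrow> j = k" if "j \<in> J'" "k \<in> J'" for j k
    using assms(2) that by (auto simp: bij_betw_def inj_on_def)
  have "biproduct_maps \<rho> U \<rho>'' J' W' (\<lambda>j x. \<iota> (h j) (\<phi> j x)) (\<lambda>j x. inv_into (W' j) (\<phi> j) (\<pi> (h j) x))"
  proof (rule biproduct_mapsI)
    show "finite J'" using assms(2) B(1) by (simp add: bij_betw_finite)
    fix j k x assume j: "j \<in> J'" "k \<in> J'" "x \<in> W' k"
    have "inv_into (W' j) (\<phi> j) 0 = 0"
      using rep_homD(6)[OF G(1)[OF j(1) j(1)]] monoid_repD(6)[OF B(3)[OF h[OF j(1)]]] by simp
    with j show "inv_into (W' j) (\<phi> j) (\<pi> (h j) (\<iota> (h k) (\<phi> k x))) = (if j = k then x else 0)"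
      using B(6)[OF h h, of j k "\<phi> k x"] F(5) rep_homD(3)[OF F(1)] by (auto simp: hinj)
  next
    fix x assume x: "x \<in> U"
    have "(\<Sum>j\<in>J'. \<iota> (h j) (\<phi> j (inv_into (W' j) (\<phi> j) (\<pi> (h j) x)))) = (\<Sum>j\<in>J'. \<iota> (h j) (\<pi> (h j) x))"
      using rep_homD(3)[OF B(5)[OF h] x] by (intro sum.cong) (auto simp: F(6))
    also have "\<dots> = (\<Sum>j\<in>J. \<iota> j (\<pi> j x))"
      by (rule sum.reindex_bij_betw[OF assms(2)])
    finally show "(\<Sum>j\<in>J'. \<iota> (h j) (\<phi> j (inv_into (W' j) (\<phi> j) (\<pi> (h j) x)))) = x"
      using B(7)[OF x] by simp
  next
    fix j assume j: "j \<in> J'"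
    show "rep_hom \<rho>'' (W' j) \<rho> U (\<lambda>x. \<iota> (h j) (\<phi> j x))"
      by (rule rep_hom_comp[OF F(1)[OF j] B(4)[OF h[OF j]]])
    show "rep_hom \<rho> U \<rho>'' (W' j) (\<lambda>x. inv_into (W' j) (\<phi> j) (\<pi> (h j) x))"
      by (rule rep_hom_comp[OF B(5)[OF h[OF j]] G(1)[OF j j]])
  qed (use B(2) assms(3) in auto)
  then show ?thesis by (auto simp: biproduct_def)
qed

lemma isomorphic_reps_refl: "isomorphic_reps \<rho> U \<rho> U"
proof -
  have "rep_iso \<rho> U \<rho> U (\<lambda>x. x)"
    by (intro rep_isoI[where b = "\<lambda>x. x"] rep_hom_id) auto
  then show ?thesis unfolding isomorphic_reps_def by blast
qed

text \<open>Injections and projections compose. This refines copies of the regular representation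
  into indecomposables, and glues the decompositions of the two halves in the existence
  proof.\<close>

lemma biproduct_Sigma:
  assumes "biproduct \<rho> U \<rho>' J W" "\<And>j. j \<in> J \<Longrightarrow> biproduct \<rho>' (W j) \<rho>'' (K j) (Z j)"
  shows "biproduct \<rho> U \<rho>'' (SIGMA j:J. K j) (\<lambda>(j, k). Z j k)"
proof -
  obtain \<iota> \<pi> where "biproduct_maps \<rho> U \<rho>' J W \<iota> \<pi>" using assms(1) by (auto simp: biproduct_def)
  note B = biproduct_mapsD[OF this]
  obtain \<alpha> \<beta> where "\<And>j. j \<in> J \<Longrightarrow> biproduct_maps \<rho>' (W j) \<rho>'' (K j) (Z j) (\<alpha> j) (\<beta> j)"
    using assms(2) unfolding biproduct_def by metis
  note C = biproduct_mapsD[OF this]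
  have "biproduct_maps \<rho> U \<rho>'' (SIGMA j:J. K j) (\<lambda>(j, k). Z j k)
      (\<lambda>(j, k) x. \<iota> j (\<alpha> j k x)) (\<lambda>(j, k) x. \<beta> j k (\<pi> j x))"
  proof (rule biproduct_mapsI)
    show "finite (SIGMA j:J. K j)" using B(1) C(1) by auto
  next
    fix p q x
    assume pq: "p \<in> (SIGMA j:J. K j)" "q \<in> (SIGMA j:J. K j)" "x \<in> (case q of (j, k) \<Rightarrow> Z j k)"
    then obtain j k j' k' where [simp]: "p = (j, k)" "q = (j', k')"
      and m: "j \<in> J" "k \<in> K j" "j' \<in> J" "k' \<in> K j'" "x \<in> Z j' k'" by auto
    have "\<alpha> j' k' x \<in> W j'" using rep_homD(3)[OF C(4)] m by blast
    then have "\<pi> j (\<iota> j' (\<alpha> j' k' x)) = (if j = j' then \<alpha> j' k' x else 0)"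
      using B(6) m by blast
    moreover have "\<beta> j k 0 = 0"
      using rep_homD(6)[OF C(5)] monoid_repD(6)[OF B(3)] m by blast
    ultimately show "(case p of (j, k) \<Rightarrow> \<lambda>x. \<beta> j k (\<pi> j x)) ((case q of (j, k) \<Rightarrow> \<lambda>x. \<iota> j (\<alpha> j k x)) x)
        = (if p = q then x else 0)"
      using C(6)[of j k k' x] m by auto
  next
    fix x assume x: "x \<in> U"
    have "(\<Sum>p\<in>(SIGMA j:J. K j). (case p of (j, k) \<Rightarrow> \<lambda>x. \<iota> j (\<alpha> j k x)) ((case p of (j, k) \<Rightarrow> \<lambda>x. \<beta> j k (\<pi> j x)) x))
      = (\<Sum>j\<in>J. \<Sum>k\<in>K j. \<iota> j (\<alpha> j k (\<beta> j k (\<pi> j x))))"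
      using B(1) C(1) by (subst sum.Sigma) (auto simp: split_def)
    also have "\<dots> = (\<Sum>j\<in>J. \<iota> j (\<pi> j x))"
    proof (rule sum.cong[OF refl])
      fix j assume j: "j \<in> J"
      have w: "\<pi> j x \<in> W j" using rep_homD(3)[OF B(5)[OF j] x] .
      have "(\<Sum>k\<in>K j. \<iota> j (\<alpha> j k (\<beta> j k (\<pi> j x)))) = \<iota> j (\<Sum>k\<in>K j. \<alpha> j k (\<beta> j k (\<pi> j x)))"
        using rep_homD(3)[OF C(4)[OF j]] rep_homD(3)[OF C(5)[OF j] w]
        by (intro linear_between_sum[OF rep_homD(1)[OF B(4)[OF j]] monoid_repD(1)[OF B(3)[OF j]], symmetric]) auto
      then show "(\<Sum>k\<in>K j. \<iota> j (\<alpha> j k (\<beta> j k (\<pi> j x)))) = \<iota> j (\<pi> j x)"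
        using C(7)[OF j w] by simp
    qed
    finally show "(\<Sum>p\<in>(SIGMA j:J. K j). (case p of (j, k) \<Rightarrow> \<lambda>x. \<iota> j (\<alpha> j k x)) ((case p of (j, k) \<Rightarrow> \<lambda>x. \<beta> j k (\<pi> j x)) x)) = x"
      using B(7)[OF x] by simp
  qed (auto intro: B(2) C(3) rep_hom_comp[OF C(4) B(4)] rep_hom_comp[OF B(5) C(5)])
  then show ?thesis by (auto simp: biproduct_def)
qed

lemma biproduct_iso:
  assumes "biproduct \<rho> U \<tau> J W" "biproduct \<rho>' U' \<tau> J W"
  shows "isomorphic_reps \<rho> U \<rho>' U'"
proof -
  obtain \<iota> \<pi> where "biproduct_maps \<rho> U \<tau> J W \<iota> \<pi>" using assms(1) by (auto simp: biproduct_def)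
  note B = biproduct_mapsD[OF this]
  obtain \<alpha> \<beta> where "biproduct_maps \<rho>' U' \<tau> J W \<alpha> \<beta>" using assms(2) by (auto simp: biproduct_def)
  note C = biproduct_mapsD[OF this]
  \<comment> \<open>Formulated for two arbitrary decompositions with the same summands, so that it
    gives both composites of the two mutually inverse maps.\<close>
  have round: "(\<Sum>j\<in>J. i j (b j (\<Sum>k\<in>J. a k (p k x)))) = x"
    if D: "biproduct_maps r V \<tau> J W i p" and E: "biproduct_maps r' V' \<tau> J W a b" and x: "x \<in> V"
    for i b a p V V' r r' x
  proof -
    note D = biproduct_mapsD[OF D] and E = biproduct_mapsD[OF E]
    have "b j (\<Sum>k\<in>J. a k (p k x)) = p j x" if j: "j \<in> J" for j
    proof -
      have "b j (\<Sum>k\<in>J. a k (p k x)) = (\<Sum>k\<in>J. b j (a k (p k x)))"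
        using rep_homD(3)[OF D(5) x] rep_homD(3)[OF E(4)]
        by (intro linear_between_sum[OF rep_homD(1)[OF E(5)[OF j]] monoid_repD(1)[OF E(2)]]) auto
      also have "\<dots> = (\<Sum>k\<in>J. if j = k then p k x else 0)"
        using rep_homD(3)[OF D(5) x] E(6) j by (intro sum.cong) auto
      finally show ?thesis using j D(1) by simp
    qed
    then show ?thesis using D(7)[OF x] by simp
  qed
  have "rep_iso \<rho> U \<rho>' U' (\<lambda>x. \<Sum>j\<in>J. \<alpha> j (\<pi> j x))"
  proof (rule rep_isoI)
    show "rep_hom \<rho> U \<rho>' U' (\<lambda>x. \<Sum>j\<in>J. \<alpha> j (\<pi> j x))"
      by (rule rep_hom_sum[OF C(2)], rule rep_hom_comp[OF B(5) C(4)])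
    show "rep_hom \<rho>' U' \<rho> U (\<lambda>x. \<Sum>j\<in>J. \<iota> j (\<beta> j x))"
      by (rule rep_hom_sum[OF B(2)], rule rep_hom_comp[OF C(5) B(4)])
  qed (use round \<open>biproduct_maps \<rho> U \<tau> J W \<iota> \<pi>\<close> \<open>biproduct_maps \<rho>' U' \<tau> J W \<alpha> \<beta>\<close> in blast)+
  then show ?thesis by (auto simp: isomorphic_reps_def)
qed

text \<open>The partial sum of the idempotents over \<open>K\<close> is again an equivariant
  idempotent: its image is the subsum, and its kernel supplies the invariant complement on which the
  model operator will be the identity.\<close>

lemma biproduct_subset:
  assumes "biproduct \<rho> U \<rho>' J W" "K \<subseteq> J"
  obtains P where "rep_hom \<rho> U \<rho> U P" "\<And>x. x \<in> U \<Longrightarrow> P (P x) = P x" "biproduct \<rho> (P ` U) \<rho>' K W"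
proof -
  obtain \<iota> \<pi> where "biproduct_maps \<rho> U \<rho>' J W \<iota> \<pi>" using assms(1) by (auto simp: biproduct_def)
  note B = biproduct_mapsD[OF this]
  have K: "k \<in> K \<Longrightarrow> k \<in> J" for k using assms(2) by auto
  define P where "P x = (\<Sum>k\<in>K. \<iota> k (\<pi> k x))" for x
  have P: "rep_hom \<rho> U \<rho> U P"
    unfolding P_def by (rule rep_hom_sum[OF B(2)], rule rep_hom_comp[OF B(5)[OF K] B(4)[OF K]])
  have fix1: "P (\<iota> k x) = \<iota> k x" if k: "k \<in> K" "x \<in> W k" for k x
  proof -
    have "P (\<iota> k x) = (\<Sum>j\<in>K. if j = k then \<iota> k x else 0)"
      unfolding P_def using k K B(6) rep_homD(6)[OF B(4)[OF K] monoid_repD(6)[OF B(3)[OF K]]]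
      by (intro sum.cong) auto
    then show ?thesis using k B(1) assms(2) by (simp add: finite_subset)
  qed
  have idem: "P (P x) = P x" if x: "x \<in> U" for x
  proof -
    have m: "\<pi> k x \<in> W k" if "k \<in> K" for k using rep_homD(3)[OF B(5)[OF K] x] that .
    have "P (P x) = P (\<Sum>k\<in>K. \<iota> k (\<pi> k x))" by (simp add: P_def)
    also have "\<dots> = (\<Sum>k\<in>K. P (\<iota> k (\<pi> k x)))"
      using m by (intro linear_between_sum[OF rep_homD(1)[OF P] monoid_repD(1)[OF B(2)]])
        (auto intro: rep_homD(3)[OF B(4)[OF K]])
    also have "\<dots> = P x" using m fix1 by (simp add: P_def)
    finally show ?thesis .
  qed
  have PU: "monoid_rep \<rho> (P ` U)" by (rule subrep_image[OF B(2) B(2) P])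
  have sub: "P ` U \<subseteq> U" using rep_homD(3)[OF P] by auto
  have "biproduct_maps \<rho> (P ` U) \<rho>' K W \<iota> \<pi>"
  proof (rule biproduct_mapsI)
    fix k assume k: "k \<in> K"
    have "\<iota> k ` W k \<subseteq> P ` U"
    proof (rule image_subsetI)
      fix x assume "x \<in> W k"
      then show "\<iota> k x \<in> P ` U"
        using fix1[OF k] rep_homD(3)[OF B(4)[OF K[OF k]]] by (intro image_eqI[of _ _ "\<iota> k x"]) auto
    qed
    then show "rep_hom \<rho>' (W k) \<rho> (P ` U) (\<iota> k)"
      by (rule rep_hom_corestrict[OF B(4)[OF K[OF k]]])
    show "rep_hom \<rho> (P ` U) \<rho>' (W k) (\<pi> k)"
      by (rule rep_hom_restrict[OF B(5)[OF K[OF k]] PU sub])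
  next
    fix x assume "x \<in> P ` U"
    then show "(\<Sum>j\<in>K. \<iota> j (\<pi> j x)) = x" using idem by (auto simp: P_def[symmetric])
  qed (use B PU K assms(2) in \<open>auto intro: finite_subset\<close>)
  then show ?thesis using that P idem by (auto simp: biproduct_def)
qed

lemma biproduct_imp_iso_direct_sum:
  assumes "biproduct \<rho> U \<rho> (SIGMA i:I. {..<m i}) (\<lambda>(i, k). W i)"
  shows "iso_direct_sum \<rho> U I W m"
proof -
  define J where "J = (SIGMA i:I. {..<m i})"
  obtain \<iota> \<pi> where "biproduct_maps \<rho> U \<rho> J (\<lambda>(i, k). W i) \<iota> \<pi>"
    using assms by (auto simp: biproduct_def J_def)
  note B = biproduct_mapsD[OF this]
  have "bij_betw (\<lambda>c. \<Sum>p\<in>J. \<iota> p (c p)) (PiE J (\<lambda>(i, k). W i)) U"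
  proof (rule bij_betw_byWitness[where f' = "\<lambda>x. \<lambda>p\<in>J. \<pi> p x"])
    show "\<forall>c\<in>PiE J (\<lambda>(i, k). W i). (\<lambda>p\<in>J. \<pi> p (\<Sum>q\<in>J. \<iota> q (c q))) = c"
    proof
      fix c assume c: "c \<in> PiE J (\<lambda>(i, k). W i)"
      have "\<pi> p (\<Sum>q\<in>J. \<iota> q (c q)) = c p" if p: "p \<in> J" for p
      proof -
        have cq: "c q \<in> (case q of (i, k) \<Rightarrow> W i)" if "q \<in> J" for q using c that by (auto simp: PiE_iff)
        have "\<pi> p (\<Sum>q\<in>J. \<iota> q (c q)) = (\<Sum>q\<in>J. \<pi> p (\<iota> q (c q)))"
          using cq by (intro linear_between_sum[OF rep_homD(1)[OF B(5)[OF p]] monoid_repD(1)[OF B(2)]])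
            (auto intro: rep_homD(3)[OF B(4)])
        also have "\<dots> = (\<Sum>q\<in>J. if p = q then c q else 0)"
          using cq B(6)[OF p] by (intro sum.cong) auto
        finally show ?thesis using p B(1) by simp
      qed
      then show "(\<lambda>p\<in>J. \<pi> p (\<Sum>q\<in>J. \<iota> q (c q))) = c"
        using c by (auto simp: fun_eq_iff PiE_iff extensional_def)
    qed
    show "\<forall>x\<in>U. (\<Sum>p\<in>J. \<iota> p ((\<lambda>p\<in>J. \<pi> p x) p)) = x"
      using B(7) by simp
    show "(\<lambda>c. \<Sum>p\<in>J. \<iota> p (c p)) ` PiE J (\<lambda>(i, k). W i) \<subseteq> U"
    proof (rule image_subsetI)
      fix c assume c: "c \<in> PiE J (\<lambda>(i, k). W i)"
      have "\<iota> p (c p) \<in> U" if "p \<in> J" for p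
        using rep_homD(3)[OF B(4)[OF that] PiE_mem[OF c that]] .
      then show "(\<Sum>p\<in>J. \<iota> p (c p)) \<in> U"
        by (rule subspace_sum[OF monoid_repD(1)[OF B(2)]])
    qed
    show "(\<lambda>x. \<lambda>p\<in>J. \<pi> p x) ` U \<subseteq> PiE J (\<lambda>(i, k). W i)"
    proof (rule image_subsetI)
      fix x assume "x \<in> U"
      then show "(\<lambda>p\<in>J. \<pi> p x) \<in> PiE J (\<lambda>(i, k). W i)"
        using rep_homD(3)[OF B(5)] by (simp add: PiE_iff)
    qed
  qed
  moreover have "(\<lambda>c. \<Sum>p\<in>J. \<iota> p (c p)) = (\<lambda>c. \<Sum>(i, k)\<in>J. \<iota> (i, k) (c (i, k)))"
    by (simp add: split_beta)
  ultimately have "bij_betw (\<lambda>c. \<Sum>(i, k)\<in>J. \<iota> (i, k) (c (i, k))) (PiE J (\<lambda>(i, k). W i)) U"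
    by metis
  moreover have "rep_hom \<rho> (W i) \<rho> U (\<iota> (i, k))" if "i \<in> I" "k < m i" for i k
    using B(4)[of "(i, k)"] that by (simp add: J_def)
  ultimately show ?thesis
    unfolding iso_direct_sum_def J_def[symmetric] by (intro exI[of _ "\<lambda>i k. \<iota> (i, k)"]) blast
qed

text \<open>The projections are the coordinates of the inverse of the given bijection; their
  linearity and equivariance come from uniqueness of coordinates.\<close>

lemma iso_direct_sum_imp_biproduct:
  assumes "iso_direct_sum \<rho> U I W m" "finite I" "monoid_rep \<rho> U" "\<And>i. i \<in> I \<Longrightarrow> monoid_rep \<rho> (W i)"
  shows "biproduct \<rho> U \<rho> (SIGMA i:I. {..<m i}) (\<lambda>(i, k). W i)"
proof -
  define J where "J = (SIGMA i:I. {..<m i})"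
  define W' where "W' = (\<lambda>p :: nat \<times> nat. W (fst p))"
  obtain e where e: "\<And>i k. i \<in> I \<Longrightarrow> k < m i \<Longrightarrow> rep_hom \<rho> (W i) \<rho> U (e i k)"
    and bij: "bij_betw (\<lambda>c. \<Sum>(i, k)\<in>J. e i k (c (i, k))) (PiE J (\<lambda>(i, k). W i)) U"
    using assms(1) unfolding iso_direct_sum_def J_def by blast
  define \<iota> where "\<iota> = (\<lambda>p :: nat \<times> nat. e (fst p) (snd p))"
  define F where "F c = (\<Sum>p\<in>J. \<iota> p (c p))" for c
  define G where "G = inv_into (PiE J W') F"
  have \<iota>: "rep_hom \<rho> (W' p) \<rho> U (\<iota> p)" if "p \<in> J" for p
    using that e by (auto simp: J_def \<iota>_def W'_def)
  have W': "monoid_rep \<rho> (W' p)" if "p \<in> J" for p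
    using that assms(4) by (auto simp: J_def W'_def)
  have fin: "finite J" using assms(2) by (simp add: J_def)
  have F: "bij_betw F (PiE J W') U"
    using bij by (simp add: F_def[abs_def] \<iota>_def W'_def case_prod_beta')
  \<comment> \<open>The pattern used below: to identify the coordinates of a vector, exhibit a
    family in the direct sum that \<open>F\<close> maps to it.\<close>
  have GF: "c = G x" if "c \<in> PiE J W'" "F c = x" for c x
    using F that by (auto simp: G_def bij_betw_def)
  have G: "G x \<in> PiE J W'" "F (G x) = x" if "x \<in> U" for x
    using F that by (auto simp: G_def bij_betw_def inv_into_into f_inv_into_f)
  have Gp: "G x p \<in> W' p" if "x \<in> U" "p \<in> J" for x p using G(1)[OF that(1)] that(2) by (auto simp: PiE_iff)
  have "biproduct_maps \<rho> U \<rho> J W' \<iota> (\<lambda>p x. G x p)"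
  proof (rule biproduct_mapsI)
    fix p assume p: "p \<in> J"
    show "rep_hom \<rho> U \<rho> (W' p) (\<lambda>x. G x p)"
    proof (rule rep_homI)
      fix x y assume x: "x \<in> U" "y \<in> U"
      have "(\<lambda>p\<in>J. G x p + G y p) = G (x + y)"
      proof (rule GF)
        show "(\<lambda>p\<in>J. G x p + G y p) \<in> PiE J W'"
          using Gp[OF x(1)] Gp[OF x(2)] by (auto intro: subspace_add[OF monoid_repD(1)[OF W']])
        show "F (\<lambda>p\<in>J. G x p + G y p) = x + y"
          using G(2)[OF x(1)] G(2)[OF x(2)] Gp[OF x(1)] Gp[OF x(2)]
          by (simp add: F_def rep_homD(4)[OF \<iota>] sum.distrib)
      qed
      with p show "G (x + y) p = G x p + G y p" by (metis restrict_apply')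
    next
      fix c x assume x: "x \<in> U"
      have "(\<lambda>p\<in>J. c *\<^sub>R G x p) = G (c *\<^sub>R x)"
      proof (rule GF)
        show "(\<lambda>p\<in>J. c *\<^sub>R G x p) \<in> PiE J W'"
          using Gp[OF x] by (auto intro: subspace_scale[OF monoid_repD(1)[OF W']])
        show "F (\<lambda>p\<in>J. c *\<^sub>R G x p) = c *\<^sub>R x"
          using G(2)[OF x] Gp[OF x] by (simp add: F_def rep_homD(5)[OF \<iota>] scaleR_sum_right[symmetric])
      qed
      with p show "G (c *\<^sub>R x) p = c *\<^sub>R G x p" by (metis restrict_apply')
    next
      fix \<sigma> x assume x: "x \<in> U"
      have "(\<lambda>p\<in>J. \<rho> \<sigma> (G x p)) = G (\<rho> \<sigma> x)"
      proof (rule GF)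
        show "(\<lambda>p\<in>J. \<rho> \<sigma> (G x p)) \<in> PiE J W'"
          using Gp[OF x] by (auto intro: monoid_repD(5)[OF W'])
        have "F (\<lambda>p\<in>J. \<rho> \<sigma> (G x p)) = (\<Sum>p\<in>J. \<rho> \<sigma> (\<iota> p (G x p)))"
          using Gp[OF x] by (simp add: F_def rep_homD(2)[OF \<iota>])
        also have "\<dots> = \<rho> \<sigma> (F (G x))"
          unfolding F_def using Gp[OF x]
          by (intro linear_between_sum[OF monoid_repD(2,1)[OF assms(3)], symmetric]) (auto intro: rep_homD(3)[OF \<iota>])
        finally show "F (\<lambda>p\<in>J. \<rho> \<sigma> (G x p)) = \<rho> \<sigma> x" using G(2)[OF x] by simp
      qed
      with p show "G (\<rho> \<sigma> x) p = \<rho> \<sigma> (G x p)" by (metis restrict_apply')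
    qed (use Gp p in auto)
  next
    fix p q x assume pq: "p \<in> J" "q \<in> J" "x \<in> W' q"
    have "(\<lambda>p\<in>J. if p = q then x else 0) = G (\<iota> q x)"
    proof (rule GF)
      show "(\<lambda>p\<in>J. if p = q then x else 0) \<in> PiE J W'"
        using pq monoid_repD(6)[OF W'] by auto
      have "F (\<lambda>p\<in>J. if p = q then x else 0) = (\<Sum>p\<in>J. if p = q then \<iota> q x else 0)"
        unfolding F_def using rep_homD(6)[OF \<iota> monoid_repD(6)[OF W']] by (intro sum.cong) auto
      then show "F (\<lambda>p\<in>J. if p = q then x else 0) = \<iota> q x" using fin pq by simp
    qed
    then have "G (\<iota> q x) p = (\<lambda>p\<in>J. if p = q then x else 0) p" by simp
    with pq show "G (\<iota> q x) p = (if p = q then x else 0)" by simp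
  qed (use fin assms(3) W' \<iota> G in \<open>auto simp: F_def\<close>)
  then show ?thesis unfolding biproduct_def J_def W'_def split_beta by blast
qed

lemma biproduct_singleton:
  assumes "monoid_rep \<rho> W"
  shows "biproduct \<rho> W \<rho> {..<1::nat} (\<lambda>_. W)"
  unfolding biproduct_def
  by (intro exI[of _ "\<lambda>_ x. x"] biproduct_mapsI) (auto intro: assms rep_hom_id)

lemma biproduct_internal:
  assumes "monoid_rep \<rho> U" "monoid_rep \<rho> X" "monoid_rep \<rho> Y" "X \<inter> Y = {0}"
    "{x + y |x y. x \<in> X \<and> y \<in> Y} = U"
  shows "biproduct \<rho> U \<rho> UNIV (\<lambda>b. if b then X else Y)"
proof -
  note S = monoid_repD[OF assms(2)] monoid_repD[OF assms(3)]
  have ex: "\<exists>x. x \<in> X \<and> u - x \<in> Y" if "u \<in> U" for u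
    using that assms(5) by (force simp: algebra_simps)
  \<comment> \<open>Two candidates for the \<open>X\<close>-component of \<open>u\<close> differ by
    an element of both \<open>X\<close> and \<open>Y\<close>.\<close>
  have un: "x = x'" if "x \<in> X" "x' \<in> X" "u - x \<in> Y" "u - x' \<in> Y" for u x x'
  proof -
    have "x - x' \<in> X" using that S(1) by (simp add: subspace_diff)
    moreover have "x - x' = (u - x') - (u - x)" by simp
    then have "x - x' \<in> Y" using that subspace_diff[OF S(7)] by metis
    ultimately have "x - x' \<in> {0}" unfolding assms(4)[symmetric] by blast
    then show ?thesis by simp
  qed
  \<comment> \<open>The choice is harmless since the \<open>X\<close>-component is unique;
    \<open>pI\<close> turns uniqueness into linearity and equivariance of \<open>p\<close>.\<close>
  define p where "p u = (SOME x. x \<in> X \<and> u - x \<in> Y)" for u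
  have p: "p u \<in> X" "u - p u \<in> Y" if "u \<in> U" for u
    using someI_ex[OF ex[OF that]] by (auto simp: p_def)
  have pI: "p u = x" if "u \<in> U" "x \<in> X" "u - x \<in> Y" for u x using un p that by blast
  have sub: "X \<subseteq> U" "Y \<subseteq> U"
    using assms(5) S(6,12) by force+
  note SU = monoid_repD[OF assms(1)]
  have hp: "rep_hom \<rho> U \<rho> X p"
  proof (rule rep_homI)
    fix x y assume x: "x \<in> U" "y \<in> U"
    have "x + y - (p x + p y) = (x - p x) + (y - p y)" by simp
    also have "\<dots> \<in> Y" using p x S(7) by (intro subspace_add) auto
    finally show "p (x + y) = p x + p y"
      using x p S(1) SU(1) by (intro pI) (auto simp: subspace_add)
  next
    fix c x assume x: "x \<in> U"
    have "c *\<^sub>R x - c *\<^sub>R p x = c *\<^sub>R (x - p x)" by (simp add: scaleR_right_diff_distrib)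
    also have "\<dots> \<in> Y" using p x S(7) by (intro subspace_scale) auto
    finally show "p (c *\<^sub>R x) = c *\<^sub>R p x"
      using x p S(1) SU(1) by (intro pI) (auto simp: subspace_scale)
  next
    fix \<sigma> x assume x: "x \<in> U"
    have "\<rho> \<sigma> x - \<rho> \<sigma> (p x) = \<rho> \<sigma> (x - p x)"
      using linear_between_diff[OF SU(2,1) x subsetD[OF sub(1) p(1)[OF x]]] by simp
    also have "\<dots> \<in> Y" using p x S(11) by auto
    finally show "p (\<rho> \<sigma> x) = \<rho> \<sigma> (p x)"
      using x p S(5) SU(5) by (intro pI) auto
  qed (use p in auto)
  have "rep_hom \<rho> U \<rho> U p"
    using sub by (intro rep_homI) (auto simp: rep_homD[OF hp])
  then have hq: "rep_hom \<rho> U \<rho> Y (\<lambda>x. x - p x)"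
    using p by (intro rep_hom_corestrict[OF rep_hom_diff[OF assms(1) rep_hom_id]]) auto
  have pX: "p x = x" if "x \<in> X" for x using that sub S(12) by (intro pI) auto
  have pY: "p y = 0" if "y \<in> Y" for y using that sub S(6) by (intro pI) auto
  have "biproduct_maps \<rho> U \<rho> UNIV (\<lambda>b. if b then X else Y) (\<lambda>_ x. x) (\<lambda>b x. if b then p x else x - p x)"
    by (rule biproduct_mapsI)
      (use assms(1-3) hp hq pX pY sub in \<open>auto simp: UNIV_bool intro: rep_hom_restrict[OF rep_hom_id]\<close>)
  then show ?thesis by (auto simp: biproduct_def)
qed

section \<open>The Krull-Schmidt argument: existence of decompositions and matching of their
  classes\<close>

lemma exists_indecomposable_biproduct:
  fixes U :: "'a::euclidean_space set"
  assumes "monoid_rep \<rho> U"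
  shows "\<exists>(n::nat) W. biproduct \<rho> U \<rho> {..<n} W \<and> (\<forall>j<n. indecomposable \<rho> (W j))"
  using assms
proof (induction "dim U" arbitrary: U rule: less_induct)
  case less
  note M = monoid_repD[OF less.prems]
  consider "U = {0}" | "indecomposable \<rho> U" |
    X Y where "monoid_rep \<rho> X" "monoid_rep \<rho> Y" "X \<inter> Y = {0}" "{x + y |x y. x \<in> X \<and> y \<in> Y} = U"
      "X \<noteq> {0}" "Y \<noteq> {0}"
    using less.prems unfolding indecomposable_def by blast
  then show ?case
  proof cases
    \<comment> \<open>The zero representation is the empty direct sum, as
      \<open>indecomposable\<close> excludes it.\<close>
    case 1
    then have "biproduct \<rho> U \<rho> {..<0} W" for W :: "nat \<Rightarrow> 'a set"
      using less.prems by (auto simp: biproduct_def biproduct_maps_def)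
    then show ?thesis by blast
  next
    case 2
    then show ?thesis
      using biproduct_singleton[OF less.prems] by (intro exI[of _ "1::nat"] exI[of _ "\<lambda>_. U"]) auto
  next
    case 3
    have sub: "X \<subseteq> U" "Y \<subseteq> U"
      using 3(4) monoid_repD(6)[OF 3(1)] monoid_repD(6)[OF 3(2)] by force+
    have ne: "X \<noteq> U" "Y \<noteq> U" using sub 3 by auto
    have "dim X < dim U" "dim Y < dim U"
      using subspace_dim_equal[OF monoid_repD(1)[OF 3(1)] M(1) sub(1)]
        subspace_dim_equal[OF monoid_repD(1)[OF 3(2)] M(1) sub(2)] ne by fastforce+
    then have "\<exists>(n::nat) W. biproduct \<rho> (if b then X else Y) \<rho> {..<n} W \<and> (\<forall>j<n. indecomposable \<rho> (W j))" for b
      using less.hyps 3(1,2) by auto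
    then obtain n W where nW: "\<And>b. biproduct \<rho> (if b then X else Y) \<rho> {..<(n b::nat)} (W b)"
      "\<And>b j. j < n b \<Longrightarrow> indecomposable \<rho> (W b j)" by metis
    \<comment> \<open>The decompositions of the two halves are joined over pairs and then renumbered
      by an initial segment.\<close>
    define J where "J = (SIGMA b:UNIV. {..<n b})"
    have J: "biproduct \<rho> U \<rho> J (\<lambda>(b, k). W b k)"
      unfolding J_def by (rule biproduct_Sigma[OF biproduct_internal[OF less.prems 3(1-4)] nW(1)])
    have "finite J" by (simp add: J_def)
    then obtain h where h: "bij_betw h {..<card J} J"
      using ex_bij_betw_nat_finite[of J] by (auto simp: lessThan_atLeast0)
    have "indecomposable \<rho> ((\<lambda>(b, k). W b k) (h j))" if "j < card J" for j
    proof -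
      have "h j \<in> J" using h that by (auto simp: bij_betw_def)
      then show ?thesis using nW(2) by (auto simp: J_def)
    qed
    moreover from this have "biproduct \<rho> U \<rho> {..<card J} (\<lambda>j. (\<lambda>(b, k). W b k) (h j))"
      by (intro biproduct_reindex[OF J h] isomorphic_reps_refl) (auto intro: indecomposableD(1))
    ultimately show ?thesis by blast
  qed
qed

text \<open>The identity of \<open>Q\<close> is a sum of endomorphisms that factor through the
  \<open>W j\<close>. By locality one of them is injective, and the retract argument makes
  \<open>Q\<close> isomorphic to that \<open>W j\<close>. Three ambient spaces may be
  involved.\<close>

lemma indecomposable_summand_iso:
  fixes Q :: "'a::euclidean_space set" and U :: "'b::real_vector set" and W :: "'j \<Rightarrow> 'c::real_vector set"
  assumes "indecomposable \<rho> Q" "biproduct \<tau> U \<rho> K Z" "k \<in> K" "Z k = Q"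
    "biproduct \<tau> U \<rho>' J W" "\<And>j. j \<in> J \<Longrightarrow> indecomposable \<rho>' (W j)"
  shows "\<exists>j\<in>J. isomorphic_reps \<rho> Q \<rho>' (W j)"
proof -
  obtain \<iota> \<pi> where "biproduct_maps \<tau> U \<rho> K Z \<iota> \<pi>" using assms(2) by (auto simp: biproduct_def)
  note B = biproduct_mapsD[OF this]
  obtain \<alpha> \<beta> where "biproduct_maps \<tau> U \<rho>' J W \<alpha> \<beta>" using assms(5) by (auto simp: biproduct_def)
  note C = biproduct_mapsD[OF this]
  note i = B(4)[OF assms(3), unfolded assms(4)] and p = B(5)[OF assms(3), unfolded assms(4)]
  \<comment> \<open>The second decomposition of \<open>U\<close> is inserted between the injection
    and the projection of the summand \<open>Q\<close>.\<close>
  have "(\<Sum>j\<in>J. \<pi> k (\<alpha> j (\<beta> j (\<iota> k x)))) = x" if x: "x \<in> Q" for x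
  proof -
    have u: "\<iota> k x \<in> U" using rep_homD(3)[OF i x] .
    have "(\<Sum>j\<in>J. \<pi> k (\<alpha> j (\<beta> j (\<iota> k x)))) = \<pi> k (\<Sum>j\<in>J. \<alpha> j (\<beta> j (\<iota> k x)))"
      by (intro linear_between_sum[OF rep_homD(1)[OF p] monoid_repD(1)[OF B(2)], symmetric])
        (auto intro: rep_homD(3)[OF C(4)] rep_homD(3)[OF C(5)] u)
    also have "\<dots> = x"
      using C(7)[OF u] B(6)[OF assms(3,3), of x] assms(4) x by simp
    finally show ?thesis .
  qed
  then have "inj_on (\<lambda>x. \<Sum>j\<in>J. \<pi> k (\<alpha> j (\<beta> j (\<iota> k x)))) Q"
    by (simp add: inj_on_def)
  then obtain j where j: "j \<in> J" "inj_on (\<lambda>x. \<pi> k (\<alpha> j (\<beta> j (\<iota> k x)))) Q"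
    using indecomposable_inj_sum[OF assms(1), of J "\<lambda>j x. \<pi> k (\<alpha> j (\<beta> j (\<iota> k x)))"]
      rep_hom_comp[OF rep_hom_comp[OF i C(5)] rep_hom_comp[OF C(4) p]] by blast
  have "rep_iso \<rho> Q \<rho>' (W j) (\<lambda>x. \<beta> j (\<iota> k x))"
    by (rule indecomposable_retract_iso[OF assms(1) assms(6)[OF j(1)] rep_hom_comp[OF i C(5)[OF j(1)]]
          rep_hom_comp[OF C(4)[OF j(1)] p] j(2)])
  with j(1) show ?thesis by (auto simp: isomorphic_reps_def)
qed

section \<open>Invariance of types under isomorphism\<close>

text \<open>An isomorphism together with a chosen inverse, in a symmetric form: every transport
  statement then applies in the opposite direction as well.\<close>

definition inverse_isos ::
    "('s::monoid_mult \<Rightarrow> 'a::real_vector \<Rightarrow> 'a) \<Rightarrow> 'a set \<Rightarrow>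
     ('s \<Rightarrow> 'b::real_vector \<Rightarrow> 'b) \<Rightarrow> 'b set \<Rightarrow> ('a \<Rightarrow> 'b) \<Rightarrow> ('b \<Rightarrow> 'a) \<Rightarrow> bool" where
  "inverse_isos \<rho> W \<rho>' W' \<phi> \<psi> \<longleftrightarrow> monoid_rep \<rho> W \<and> monoid_rep \<rho>' W' \<and>
     rep_hom \<rho> W \<rho>' W' \<phi> \<and> rep_hom \<rho>' W' \<rho> W \<psi> \<and>
     (\<forall>x\<in>W. \<psi> (\<phi> x) = x) \<and> (\<forall>y\<in>W'. \<phi> (\<psi> y) = y)"

lemma inverse_isosD:
  assumes "inverse_isos \<rho> W \<rho>' W' \<phi> \<psi>"
  shows "monoid_rep \<rho> W" "monoid_rep \<rho>' W'" "rep_hom \<rho> W \<rho>' W' \<phi>" "rep_hom \<rho>' W' \<rho> W \<psi>"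
    "x \<in> W \<Longrightarrow> \<psi> (\<phi> x) = x" "y \<in> W' \<Longrightarrow> \<phi> (\<psi> y) = y"
    "x \<in> W \<Longrightarrow> \<phi> x \<in> W'" "y \<in> W' \<Longrightarrow> \<psi> y \<in> W" "\<phi> 0 = 0" "\<psi> 0 = 0"
    "inverse_isos \<rho>' W' \<rho> W \<psi> \<phi>"
  using assms by (auto simp: inverse_isos_def rep_homD monoid_repD)

lemma isomorphic_reps_inverse_isos:
  assumes "isomorphic_reps \<rho> W \<rho>' W'" "monoid_rep \<rho> W" "monoid_rep \<rho>' W'"
  obtains \<phi> \<psi> where "inverse_isos \<rho> W \<rho>' W' \<phi> \<psi>"
proof -
  obtain \<Phi> where \<Phi>: "rep_iso \<rho> W \<rho>' W' \<Phi>" using assms(1) by (auto simp: isomorphic_reps_def)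
  have "inverse_isos \<rho> W \<rho>' W' \<Phi> (inv_into W \<Phi>)"
    using assms(2,3) rep_isoD[OF \<Phi>] rep_isoD(1)[OF rep_iso_inv[OF \<Phi> assms(2)]]
    by (auto simp: inverse_isos_def)
  with that show ?thesis .
qed

lemma indecomposable_iso:
  assumes "inverse_isos \<rho> W \<rho>' W' \<phi> \<psi>" "indecomposable \<rho> W"
  shows "indecomposable \<rho>' W'"
  unfolding indecomposable_def
proof (intro conjI allI impI)
  note I = inverse_isosD[OF assms(1)]
  show "monoid_rep \<rho>' W'" by (rule I(2))
  show "W' \<noteq> {0}"
  proof
    assume "W' = {0}"
    then have "W \<subseteq> {0}" using I(5,7,10) by force
    with indecomposableD(2)[OF assms(2)] monoid_repD(6)[OF I(1)] show False by auto
  qed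
  fix X Y
  assume a: "monoid_rep \<rho>' X \<and> monoid_rep \<rho>' Y \<and> X \<inter> Y = {0} \<and> {x + y |x y. x \<in> X \<and> y \<in> Y} = W'"
  then have X: "monoid_rep \<rho>' X" and Y: "monoid_rep \<rho>' Y" and XY: "X \<inter> Y = {0}"
    and eq: "{x + y |x y. x \<in> X \<and> y \<in> Y} = W'" by auto
  have sub: "X \<subseteq> W'" "Y \<subseteq> W'"
    using eq monoid_repD(6)[OF X] monoid_repD(6)[OF Y] by force+
  have hX: "rep_hom \<rho>' X \<rho> W \<psi>" and hY: "rep_hom \<rho>' Y \<rho> W \<psi>"
    using rep_hom_restrict[OF I(4) X sub(1)] rep_hom_restrict[OF I(4) Y sub(2)] by auto
  have "\<psi> ` X = {0} \<or> \<psi> ` Y = {0}"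
  proof (rule indecomposableE[OF assms(2) subrep_image[OF X I(1) hX] subrep_image[OF Y I(1) hY]])
    fix x assume "x \<in> \<psi> ` X" "x \<in> \<psi> ` Y"
    then obtain a b where ab: "a \<in> X" "b \<in> Y" "x = \<psi> a" "x = \<psi> b" by auto
    then have "a = b" using I(6) sub by (metis subsetD)
    then have "a \<in> X \<inter> Y" using ab by simp
    then show "x = 0" using XY ab I(10) by simp
  next
    fix w assume w: "w \<in> W"
    then obtain a b where ab: "a \<in> X" "b \<in> Y" "\<phi> w = a + b" using I(7) eq by blast
    then have "w = \<psi> a + \<psi> b" using w I(5) sub rep_homD(4)[OF I(4)] by (metis subsetD)
    with ab show "\<exists>x\<in>\<psi> ` X. \<exists>y\<in>\<psi> ` Y. w = x + y" by blast
  qed (use I(8) sub in auto)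
  moreover have "Z = {0}" if "\<psi> ` Z = {0}" "Z \<subseteq> W'" "0 \<in> Z" for Z
  proof -
    have "z = 0" if "z \<in> Z" for z
    proof -
      have "\<psi> z = 0" using \<open>\<psi> ` Z = {0}\<close> that by blast
      then have "\<phi> (\<psi> z) = 0" using I(9) by simp
      then show ?thesis using I(6) that \<open>Z \<subseteq> W'\<close> by auto
    qed
    with \<open>0 \<in> Z\<close> show ?thesis by blast
  qed
  ultimately show "X = {0} \<or> Y = {0}"
    using sub monoid_repD(6)[OF X] monoid_repD(6)[OF Y] by blast
qed

text \<open>Conjugation of endomorphisms by the isomorphism, cut off outside \<open>W'\<close>
  because elements of \<open>endos\<close> are extensional.\<close>

definition transport :: "('a \<Rightarrow> 'b) \<Rightarrow> ('b \<Rightarrow> 'a) \<Rightarrow> 'b set \<Rightarrow> ('a \<Rightarrow> 'a) \<Rightarrow> 'b \<Rightarrow> 'b" where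
  "transport \<phi> \<psi> W' a = (\<lambda>y\<in>W'. \<phi> (a (\<psi> y)))"

lemma endosD:
  assumes "a \<in> endos \<rho> W"
  shows "rep_hom \<rho> W \<rho> W a" "a \<in> extensional W" "x \<in> W \<Longrightarrow> a x \<in> W"
  using assms rep_homD(3)[of \<rho> W \<rho> W a] by (auto simp: endos_def)

lemma transport_endos:
  assumes "inverse_isos \<rho> W \<rho>' W' \<phi> \<psi>" "a \<in> endos \<rho> W"
  shows "transport \<phi> \<psi> W' a \<in> endos \<rho>' W'"
proof -
  note I = inverse_isosD[OF assms(1)]
  have "rep_hom \<rho>' W' \<rho>' W' (\<lambda>y. \<phi> (a (\<psi> y)))"
    by (rule rep_hom_comp[OF rep_hom_comp[OF I(4) endosD(1)[OF assms(2)]] I(3)])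
  then have "rep_hom \<rho>' W' \<rho>' W' (transport \<phi> \<psi> W' a)"
    by (rule rep_hom_cong) (auto simp: I transport_def)
  then show ?thesis by (auto simp: endos_def transport_def)
qed

lemma transport_inverse:
  assumes "inverse_isos \<rho> W \<rho>' W' \<phi> \<psi>" "a \<in> endos \<rho> W"
  shows "transport \<psi> \<phi> W (transport \<phi> \<psi> W' a) = a"
proof (rule extensionalityI[of _ W])
  fix x assume "x \<in> W"
  then show "transport \<psi> \<phi> W (transport \<phi> \<psi> W' a) x = a x"
    using inverse_isosD(5,7)[OF assms(1)] endosD(3)[OF assms(2)] by (simp add: transport_def)
qed (use endosD(2)[OF assms(2)] in \<open>auto simp: transport_def\<close>)

lemma transport_add:
  assumes "inverse_isos \<rho> W \<rho>' W' \<phi> \<psi>" "a \<in> endos \<rho> W" "b \<in> endos \<rho> W"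
  shows "transport \<phi> \<psi> W' (\<lambda>x\<in>W. a x + b x) =
    (\<lambda>y\<in>W'. transport \<phi> \<psi> W' a y + transport \<phi> \<psi> W' b y)"
  using inverse_isosD(8)[OF assms(1)] endosD(3)[OF assms(2)] endosD(3)[OF assms(3)]
    rep_homD(4)[OF inverse_isosD(3)[OF assms(1)]]
  by (auto simp: transport_def fun_eq_iff)

lemma transport_scale:
  assumes "inverse_isos \<rho> W \<rho>' W' \<phi> \<psi>" "a \<in> endos \<rho> W"
  shows "transport \<phi> \<psi> W' (\<lambda>x\<in>W. c *\<^sub>R a x) = (\<lambda>y\<in>W'. c *\<^sub>R transport \<phi> \<psi> W' a y)"
  using inverse_isosD(8)[OF assms(1)] endosD(3)[OF assms(2)]
    rep_homD(5)[OF inverse_isosD(3)[OF assms(1)]]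
  by (auto simp: transport_def fun_eq_iff)

lemma transport_compose:
  assumes "inverse_isos \<rho> W \<rho>' W' \<phi> \<psi>" "a \<in> endos \<rho> W" "b \<in> endos \<rho> W"
  shows "transport \<phi> \<psi> W' (compose W a b) = compose W' (transport \<phi> \<psi> W' a) (transport \<phi> \<psi> W' b)"
  using inverse_isosD(5,7,8)[OF assms(1)] endosD(3)[OF assms(2)] endosD(3)[OF assms(3)]
  by (auto simp: transport_def fun_eq_iff compose_def)

lemma transport_id:
  assumes "inverse_isos \<rho> W \<rho>' W' \<phi> \<psi>"
  shows "transport \<phi> \<psi> W' (\<lambda>x\<in>W. x) = (\<lambda>y\<in>W'. y)"
  using inverse_isosD(6,8)[OF assms(1)] by (auto simp: transport_def fun_eq_iff)

lemma transport_zero: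
  assumes "inverse_isos \<rho> W \<rho>' W' \<phi> \<psi>"
  shows "transport \<phi> \<psi> W' (\<lambda>x\<in>W. 0) = (\<lambda>y\<in>W'. 0)"
  using inverse_isosD(8,9)[OF assms(1)] by (auto simp: transport_def fun_eq_iff)

lemma transport_image_inverse:
  assumes "inverse_isos \<rho> W \<rho>' W' \<phi> \<psi>" "M \<subseteq> endos \<rho> W"
  shows "transport \<psi> \<phi> W ` transport \<phi> \<psi> W' ` M = M"
  using transport_inverse[OF assms(1)] assms(2) by (force simp: image_image)

lemma transport_image_endos:
  assumes "inverse_isos \<rho> W \<rho>' W' \<phi> \<psi>"
  shows "transport \<phi> \<psi> W' ` endos \<rho> W = endos \<rho>' W'"
proof
  show "endos \<rho>' W' \<subseteq> transport \<phi> \<psi> W' ` endos \<rho> W"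
  proof
    fix b assume b: "b \<in> endos \<rho>' W'"
    show "b \<in> transport \<phi> \<psi> W' ` endos \<rho> W"
      using transport_endos[OF inverse_isosD(11)[OF assms] b]
        transport_inverse[OF inverse_isosD(11)[OF assms] b] by (metis imageI)
  qed
qed (use transport_endos[OF assms] in auto)

lemma left_ideal_transport:
  assumes I: "inverse_isos \<rho> W \<rho>' W' \<phi> \<psi>" and M: "left_ideal \<rho> W M"
  shows "left_ideal \<rho>' W' (transport \<phi> \<psi> W' ` M)"
  unfolding left_ideal_def
proof (intro conjI ballI)
  have sub: "a \<in> M \<Longrightarrow> a \<in> endos \<rho> W" for a using M by (auto simp: left_ideal_def)
  show "transport \<phi> \<psi> W' ` M \<subseteq> endos \<rho>' W'"
    using sub transport_endos[OF I] by auto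
  show "(\<lambda>x\<in>W'. 0) \<in> transport \<phi> \<psi> W' ` M"
    using M transport_zero[OF I] by (auto simp: left_ideal_def image_iff intro: bexI[of _ "\<lambda>x\<in>W. 0"])
  fix b assume "b \<in> transport \<phi> \<psi> W' ` M"
  then obtain a where a: "a \<in> M" "b = transport \<phi> \<psi> W' a" by auto
  {
    fix b' assume "b' \<in> transport \<phi> \<psi> W' ` M"
    then obtain a' where a': "a' \<in> M" "b' = transport \<phi> \<psi> W' a'" by auto
    have "(\<lambda>x\<in>W. a' x + a x) \<in> M" using M a(1) a'(1) by (simp add: left_ideal_def)
    with transport_add[OF I sub[OF a'(1)] sub[OF a(1)]] show "(\<lambda>x\<in>W'. b' x + b x) \<in> transport \<phi> \<psi> W' ` M"
      unfolding a(2) a'(2) by (metis imageI)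
  next
    fix e assume "e \<in> endos \<rho>' W'"
    then obtain e' where e': "e' \<in> endos \<rho> W" "e = transport \<phi> \<psi> W' e'"
      using transport_image_endos[OF I] by blast
    have "compose W e' a \<in> M" using M a(1) e'(1) by (simp add: left_ideal_def)
    with transport_compose[OF I e'(1) sub[OF a(1)]] show "compose W' e b \<in> transport \<phi> \<psi> W' ` M"
      unfolding a(2) e'(2) by (metis imageI)
  }
qed

text \<open>\<open>transport\<close> is a bijection of the endomorphism rings that respects their
  operations, so an ideal above the image of \<open>M\<close> is pulled back to an ideal above
  \<open>M\<close>, where maximality applies.\<close>

lemma maximal_left_ideal_transport:
  assumes I: "inverse_isos \<rho> W \<rho>' W' \<phi> \<psi>" and M: "maximal_left_ideal \<rho> W M"
  shows "maximal_left_ideal \<rho>' W' (transport \<phi> \<psi> W' ` M)"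
  unfolding maximal_left_ideal_def
proof (intro conjI allI impI)
  note I' = inverse_isosD(11)[OF I]
  let ?T = "transport \<phi> \<psi> W'" and ?S = "transport \<psi> \<phi> W"
  have L: "left_ideal \<rho> W M" and ne: "M \<noteq> endos \<rho> W"
    and mx: "\<And>N. left_ideal \<rho> W N \<Longrightarrow> M \<subseteq> N \<Longrightarrow> N = M \<or> N = endos \<rho> W"
    using M by (auto simp: maximal_left_ideal_def)
  have sub: "M \<subseteq> endos \<rho> W" using L by (auto simp: left_ideal_def)
  show "left_ideal \<rho>' W' (?T ` M)" by (rule left_ideal_transport[OF I L])
  show "?T ` M \<noteq> endos \<rho>' W'"
    using ne transport_image_inverse[OF I sub] transport_image_endos[OF I'] by metis
  fix N assume N: "left_ideal \<rho>' W' N \<and> ?T ` M \<subseteq> N"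
  then have Nsub: "N \<subseteq> endos \<rho>' W'" by (auto simp: left_ideal_def)
  have "M \<subseteq> ?S ` N" using N transport_image_inverse[OF I sub] by blast
  then have "?S ` N = M \<or> ?S ` N = endos \<rho> W"
    using mx left_ideal_transport[OF I'] N by blast
  then show "N = ?T ` M \<or> N = endos \<rho>' W'"
    using transport_image_inverse[OF I' Nsub] transport_image_endos[OF I] by metis
qed

lemma radical_transport:
  assumes I: "inverse_isos \<rho> W \<rho>' W' \<phi> \<psi>" and a: "a \<in> radical \<rho> W"
  shows "transport \<phi> \<psi> W' a \<in> radical \<rho>' W'"
  unfolding radical_def
proof (intro CollectI conjI allI impI)
  have ae: "a \<in> endos \<rho> W" using a by (simp add: radical_def)
  then show "transport \<phi> \<psi> W' a \<in> endos \<rho>' W'" by (rule transport_endos[OF I])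
  fix M assume M: "maximal_left_ideal \<rho>' W' M"
  then have sub: "M \<subseteq> endos \<rho>' W'" by (auto simp: maximal_left_ideal_def left_ideal_def)
  \<comment> \<open>The given maximal left ideal is pulled back to \<open>W\<close>, where
    \<open>a\<close> belongs to all of them.\<close>
  have "a \<in> transport \<psi> \<phi> W ` M"
    using a maximal_left_ideal_transport[OF inverse_isosD(11)[OF I] M] by (simp add: radical_def)
  then show "transport \<phi> \<psi> W' a \<in> M"
    using transport_inverse[OF inverse_isosD(11)[OF I]] sub by auto
qed

text \<open>The algebra homomorphism \<open>h\<close> is precomposed with transport back to
  \<open>W\<close>. Its kernel is the radical because transport matches the radicals in both
  directions.\<close>

lemma endos_mod_radical_iso_transport:
  assumes I: "inverse_isos \<rho> W \<rho>' W' \<phi> \<psi>" and "endos_mod_radical_iso \<rho> W mul e"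
  shows "endos_mod_radical_iso \<rho>' W' mul e"
proof -
  note I' = inverse_isosD(11)[OF I]
  let ?T = "transport \<phi> \<psi> W'" and ?S = "transport \<psi> \<phi> W"
  obtain h where h:
    "\<And>a b. a \<in> endos \<rho> W \<Longrightarrow> b \<in> endos \<rho> W \<Longrightarrow> h (\<lambda>x\<in>W. a x + b x) = h a + h b"
    "\<And>c a. a \<in> endos \<rho> W \<Longrightarrow> h (\<lambda>x\<in>W. c *\<^sub>R a x) = c *\<^sub>R h a"
    "\<And>a b. a \<in> endos \<rho> W \<Longrightarrow> b \<in> endos \<rho> W \<Longrightarrow> h (compose W a b) = mul (h a) (h b)"
    "h (\<lambda>x\<in>W. x) = e" "h ` endos \<rho> W = UNIV" "{a \<in> endos \<rho> W. h a = 0} = radical \<rho> W"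
    using assms(2) unfolding endos_mod_radical_iso_def by blast
  have S: "?S b \<in> endos \<rho> W" if "b \<in> endos \<rho>' W'" for b using transport_endos[OF I' that] .
  have rad: "{b \<in> endos \<rho>' W'. h (?S b) = 0} = radical \<rho>' W'"
  proof (intro equalityI subsetI)
    fix b assume "b \<in> {b \<in> endos \<rho>' W'. h (?S b) = 0}"
    then have b: "b \<in> endos \<rho>' W'" and "?S b \<in> radical \<rho> W" using S h(6) by blast+
    then show "b \<in> radical \<rho>' W'"
      using radical_transport[OF I] transport_inverse[OF I' b] by metis
  next
    fix b assume b: "b \<in> radical \<rho>' W'"
    then have "?S b \<in> {a \<in> endos \<rho> W. h a = 0}" unfolding h(6) by (rule radical_transport[OF I'])
    then show "b \<in> {b \<in> endos \<rho>' W'. h (?S b) = 0}" using b by (simp add: radical_def)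
  qed
  have "(\<lambda>b. h (?S b)) ` endos \<rho>' W' = UNIV"
    using h(5) transport_image_endos[OF I'] by (metis image_image)
  with rad h(1-4) show ?thesis
    unfolding endos_mod_radical_iso_def
    by (intro exI[of _ "\<lambda>b. h (?S b)"])
      (simp add: S transport_add[OF I'] transport_scale[OF I'] transport_compose[OF I'] transport_id[OF I'])
qed

lemma type_iso:
  assumes "isomorphic_reps \<rho> W \<rho>' W'" "monoid_rep \<rho>' W'"
  shows "real_type \<rho> W \<Longrightarrow> real_type \<rho>' W'" "complex_type \<rho> W \<Longrightarrow> complex_type \<rho>' W'"
    "quaternionic_type \<rho> W \<Longrightarrow> quaternionic_type \<rho>' W'"
  unfolding real_type_def complex_type_def quaternionic_type_def
  using isomorphic_reps_inverse_isos[OF assms(1) indecomposableD(1) assms(2)]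
    indecomposable_iso endos_mod_radical_iso_transport
  by metis+

section \<open>Decompositions of the phase spaces of a network\<close>

lemma monoid_rep_network_action:
  "monoid_rep network_action (UNIV :: ('v::real_vector^'s::{finite,monoid_mult}) set)"
  unfolding monoid_rep_def linear_between_def network_action_def
  by (auto simp: vec_eq_iff mult.assoc)

lemma rep_hom_networkI:
  assumes "\<And>v w. a (v + w) = a v + a w" "\<And>c v. a (c *\<^sub>R v) = c *\<^sub>R a v"
    "\<And>\<sigma> v. a (network_action \<sigma> v) = network_action \<sigma> (a v)"
  shows "rep_hom network_action UNIV network_action UNIV a"
  using assms by (intro rep_homI) auto

text \<open>The action only reindexes the cells, so it commutes with picking the \<open>j\<close>-th
  coordinate of the internal phase space.\<close>

lemma network_biproduct:
  "biproduct network_action (UNIV :: ((real^'k)^'s::{finite,monoid_mult}) set)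
     network_action (UNIV :: 'k set) (\<lambda>_. UNIV :: (real^'s::{finite,monoid_mult}) set)"
proof -
  define \<iota> :: "'k \<Rightarrow> real^'s::{finite,monoid_mult} \<Rightarrow> (real^'k)^'s::{finite,monoid_mult}" where "\<iota> j v = (\<chi> \<tau>. axis j (v $ \<tau>))" for j v
  define \<pi> :: "'k \<Rightarrow> (real^'k)^'s::{finite,monoid_mult} \<Rightarrow> real^'s::{finite,monoid_mult}" where "\<pi> j w = (\<chi> \<tau>. w $ \<tau> $ j)" for j w
  have "biproduct_maps network_action UNIV network_action UNIV (\<lambda>_. UNIV) \<iota> \<pi>"
  proof (rule biproduct_mapsI)
    show "rep_hom network_action UNIV network_action UNIV (\<iota> j)" for j
      by (rule rep_hom_networkI) (auto simp: \<iota>_def network_action_def vec_eq_iff axis_def)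
    show "rep_hom network_action UNIV network_action UNIV (\<pi> j)" for j
      by (rule rep_hom_networkI) (auto simp: \<pi>_def network_action_def vec_eq_iff)
    show "\<pi> j (\<iota> k x) = (if j = k then x else 0)" for j k x
      by (auto simp: \<pi>_def \<iota>_def vec_eq_iff axis_def)
    show "(\<Sum>j\<in>UNIV. \<iota> j (\<pi> j x)) = x" for x
      by (auto simp: \<pi>_def \<iota>_def vec_eq_iff axis_def)
  qed (auto intro: monoid_rep_network_action)
  then show ?thesis unfolding biproduct_def by blast
qed

text \<open>Realizes an abstract summand inside the ambient space of the sum, where
  \<open>typed_decomposition\<close> expects its subspaces \<open>W i\<close> to live.\<close>

lemma biproduct_summand_embedding:
  assumes "biproduct \<rho> U \<rho>' J W" "j \<in> J"
  shows "\<exists>X. monoid_rep \<rho> X \<and> isomorphic_reps \<rho> X \<rho>' (W j)"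
proof -
  obtain \<iota> \<pi> where "biproduct_maps \<rho> U \<rho>' J W \<iota> \<pi>" using assms(1) by (auto simp: biproduct_def)
  note B = biproduct_mapsD[OF this]
  have X: "monoid_rep \<rho> (\<iota> j ` W j)"
    by (rule subrep_image[OF B(3)[OF assms(2)] B(2) B(4)[OF assms(2)]])
  have sub: "\<iota> j ` W j \<subseteq> U" using rep_homD(3)[OF B(4)[OF assms(2)]] by auto
  have "rep_iso \<rho> (\<iota> j ` W j) \<rho>' (W j) (\<pi> j)"
  proof (rule rep_isoI)
    show "rep_hom \<rho> (\<iota> j ` W j) \<rho>' (W j) (\<pi> j)"
      by (rule rep_hom_restrict[OF B(5)[OF assms(2)] X sub])
    show "rep_hom \<rho>' (W j) \<rho> (\<iota> j ` W j) (\<iota> j)"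
      by (rule rep_hom_corestrict[OF B(4)[OF assms(2)]]) auto
  qed (auto simp: B(6)[OF assms(2) assms(2)])
  with X show ?thesis by (auto simp: isomorphic_reps_def)
qed

text \<open>Both phase spaces are refined into the same indecomposables \<open>Q j\<close> of the
  regular representation. Counting the \<open>Q j\<close> by class gives the new multiplicities, and
  the old classes keep their indices and hence their types.\<close>

lemma transfer_typed_decomposition:
  fixes U :: "((real^'d)^'s::{finite,monoid_mult}) set"
  assumes T: "typed_decomposition network_action (UNIV :: ((real^'d)^'s::{finite,monoid_mult}) set) R C H W s"
    and U: "iso_direct_sum network_action U (R \<union> C \<union> H) W m" and MU: "monoid_rep network_action U"
    and m: "\<And>i. i \<in> R \<union> C \<union> H \<Longrightarrow> m i \<le> CARD('k)"
  obtains W' :: "nat \<Rightarrow> ((real^'k)^'s::{finite,monoid_mult}) set" and s' P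
  where "typed_decomposition network_action (UNIV :: ((real^'k)^'s::{finite,monoid_mult}) set) R C H W' s'"
    "\<And>i. i \<in> R \<union> C \<union> H \<Longrightarrow> m i \<le> s' i"
    "rep_hom network_action UNIV network_action UNIV P" "\<And>v. P (P v) = P v"
    "iso_direct_sum network_action (range P) (R \<union> C \<union> H) W' m"
    "isomorphic_reps network_action U network_action (range P)"
proof -
  let ?\<rho> = "network_action :: 's \<Rightarrow> (real^'d)^'s::{finite,monoid_mult} \<Rightarrow> (real^'d)^'s::{finite,monoid_mult}"
  let ?\<rho>k = "network_action :: 's \<Rightarrow> (real^'k)^'s::{finite,monoid_mult} \<Rightarrow> (real^'k)^'s::{finite,monoid_mult}"
  let ?\<rho>1 = "network_action :: 's \<Rightarrow> real^'s::{finite,monoid_mult} \<Rightarrow> real^'s::{finite,monoid_mult}"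
  define I where "I = R \<union> C \<union> H"
  have finI: "finite I" using T by (simp add: typed_decomposition_def I_def)
  have types: "\<And>i. i \<in> R \<Longrightarrow> real_type ?\<rho> (W i)" "\<And>i. i \<in> C \<Longrightarrow> complex_type ?\<rho> (W i)"
    "\<And>i. i \<in> H \<Longrightarrow> quaternionic_type ?\<rho> (W i)"
    using T by (simp_all add: typed_decomposition_def)
  then have indec: "indecomposable ?\<rho> (W i)" if "i \<in> I" for i
    using that by (auto simp: I_def real_type_def complex_type_def quaternionic_type_def)
  have noniso: "i = j" if "i \<in> I" "j \<in> I" "isomorphic_reps ?\<rho> (W i) ?\<rho> (W j)" for i j
    using T that unfolding typed_decomposition_def I_def by blast
  have spos: "0 < s i" if "i \<in> I" for i using T that unfolding typed_decomposition_def I_def by blast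
  have "iso_direct_sum ?\<rho> UNIV I W s" using T by (simp add: typed_decomposition_def I_def)
  then have BV: "biproduct ?\<rho> UNIV ?\<rho> (SIGMA i:I. {..<s i}) (\<lambda>(i, k). W i)"
    using finI indecomposableD(1)[OF indec] by (intro iso_direct_sum_imp_biproduct monoid_rep_network_action) auto
  have BU: "biproduct ?\<rho> U ?\<rho> (SIGMA i:I. {..<m i}) (\<lambda>(i, k). W i)"
    using finI indecomposableD(1)[OF indec] U MU by (intro iso_direct_sum_imp_biproduct) (auto simp: I_def)
  \<comment> \<open>One copy of the regular representation is split; the \<open>Q j\<close> may well
    be isomorphic to each other.\<close>
  obtain n :: nat and Q where Q: "biproduct ?\<rho>1 UNIV ?\<rho>1 {..<n} Q" "\<And>j. j < n \<Longrightarrow> indecomposable ?\<rho>1 (Q j)"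
    using exists_indecomposable_biproduct[OF monoid_rep_network_action] by blast
  note MQ = indecomposableD(1)[OF Q(2)] and MW = indecomposableD(1)[OF indec]
  have BQd: "biproduct ?\<rho> UNIV ?\<rho>1 ((UNIV :: 'd set) \<times> {..<n}) (\<lambda>(j, k). Q k)"
    by (rule biproduct_Sigma[OF network_biproduct Q(1)])
  have BQk: "biproduct ?\<rho>k UNIV ?\<rho>1 ((UNIV :: 'k set) \<times> {..<n}) (\<lambda>(j, k). Q k)"
    by (rule biproduct_Sigma[OF network_biproduct Q(1)])
  \<comment> \<open>The class \<open>t j\<close> of \<open>Q j\<close>: any copy of
    \<open>Q j\<close> in the old phase space will do, here the one in an unspecified
    coordinate.\<close>
  have "\<exists>i\<in>I. isomorphic_reps ?\<rho>1 (Q j) ?\<rho> (W i)" if j: "j < n" for j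
    using indecomposable_summand_iso[OF Q(2)[OF j] BQd, of "(undefined, j)", OF _ _ BV] j indec
    by (auto simp: split_beta)
  then obtain t where t: "\<And>j. j < n \<Longrightarrow> t j \<in> I" "\<And>j. j < n \<Longrightarrow> isomorphic_reps ?\<rho>1 (Q j) ?\<rho> (W (t j))"
    by metis
  \<comment> \<open>Conversely \<open>q i\<close> is a representative of the class \<open>i\<close>;
    positivity of \<open>s i\<close> guarantees that the summand \<open>(i, 0)\<close>
    exists.\<close>
  have "\<exists>j<n. isomorphic_reps ?\<rho> (W i) ?\<rho>1 (Q j)" if i: "i \<in> I" for i
    using indecomposable_summand_iso[OF indec[OF i] BV, of "(i, 0)", OF _ _ BQd] i spos[OF i] Q(2)
    by (auto simp: split_beta)
  then obtain q where q: "\<And>i. i \<in> I \<Longrightarrow> q i < n" "\<And>i. i \<in> I \<Longrightarrow> isomorphic_reps ?\<rho> (W i) ?\<rho>1 (Q (q i))"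
    by metis
  \<comment> \<open>The \<open>W i\<close> are pairwise non-isomorphic, so the class of a
    representative is determined.\<close>
  have tq: "t (q i) = i" if i: "i \<in> I" for i
    using noniso[OF i t(1)[OF q(1)[OF i]] isomorphic_reps_trans[OF q(2)[OF i] t(2)[OF q(1)[OF i]]]] by simp
  have "\<exists>X. monoid_rep ?\<rho>k X \<and> isomorphic_reps ?\<rho>k X ?\<rho>1 (Q (q i))" if i: "i \<in> I" for i
    using biproduct_summand_embedding[OF BQk, of "(undefined, q i)"] q(1)[OF i] by auto
  then obtain W' where W': "\<And>i. i \<in> I \<Longrightarrow> monoid_rep ?\<rho>k (W' i)"
    "\<And>i. i \<in> I \<Longrightarrow> isomorphic_reps ?\<rho>k (W' i) ?\<rho>1 (Q (q i))"
    by metis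
  have W'W: "isomorphic_reps ?\<rho>k (W' i) ?\<rho> (W i)" if i: "i \<in> I" for i
    using isomorphic_reps_trans[OF W'(2)[OF i] isomorphic_reps_sym[OF q(2)[OF i] MW[OF i]]] .
  have WW': "isomorphic_reps ?\<rho> (W i) ?\<rho>k (W' i)" if i: "i \<in> I" for i
    by (rule isomorphic_reps_sym[OF W'W[OF i] W'(1)[OF i]])
  \<comment> \<open>\<open>N i\<close> numbers the summands of class \<open>i\<close> in one regular
    representation. It contains \<open>q i\<close>, so \<open>CARD('k)\<close> copies give at least
    \<open>CARD('k)\<close> summands of that class.\<close>
  define N where "N i = {j. j < n \<and> t j = i}" for i
  define s' where "s' i = card ((UNIV :: 'k set) \<times> N i)" for i
  have finN: "finite (N i)" for i by (simp add: N_def)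
  have Npos: "0 < card (N i)" if i: "i \<in> I" for i
    using tq[OF i] q(1)[OF i] finN by (auto simp: card_gt_0_iff N_def)
  have s': "CARD('k) \<le> s' i" if i: "i \<in> I" for i
    using Npos[OF i] by (simp add: s'_def card_cartesian_product)
  have "\<exists>b. bij_betw b {..<s' i} ((UNIV :: 'k set) \<times> N i)" for i
    using ex_bij_betw_nat_finite[of "(UNIV :: 'k set) \<times> N i"] finN
    by (simp add: s'_def lessThan_atLeast0)
  then obtain b where b: "\<And>i. bij_betw (b i) {..<s' i} ((UNIV :: 'k set) \<times> N i)" by metis
  have b_in: "b i k \<in> UNIV \<times> N i" if "k < s' i" for i k
    using b that by (auto simp: bij_betw_def)
  \<comment> \<open>All summands of the new phase space are sorted by class; the sets
    \<open>N i\<close> are disjoint and cover because every \<open>Q j\<close> has exactly one class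
    \<open>t j\<close>.\<close>
  have bij: "bij_betw (\<lambda>(i, k). b i k) (SIGMA i:I. {..<s' i}) ((UNIV :: 'k set) \<times> {..<n})"
    unfolding bij_betw_def
  proof
    show "inj_on (\<lambda>(i, k). b i k) (SIGMA i:I. {..<s' i})"
    proof (rule inj_onI, clarify)
      fix i k i' k' assume a: "i \<in> I" "i' \<in> I" "k < s' i" "k' < s' i'" "b i k = b i' k'"
      have "i = i'" using b_in[OF a(3)] b_in[OF a(4)] a(5) by (auto simp: N_def)
      with a b[of i] show "i = i' \<and> k = k'" by (auto simp: bij_betw_def inj_on_def)
    qed
    show "(\<lambda>(i, k). b i k) ` (SIGMA i:I. {..<s' i}) = UNIV \<times> {..<n}"
    proof (intro equalityI subsetI)
      fix p assume "p \<in> (UNIV :: 'k set) \<times> {..<n}"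
      then obtain a j where p: "p = (a, j)" "j < n" by auto
      then have "p \<in> UNIV \<times> N (t j)" by (simp add: N_def)
      then obtain k where "k < s' (t j)" "p = b (t j) k"
        using b[of "t j"] unfolding bij_betw_def by blast
      then show "p \<in> (\<lambda>(i, k). b i k) ` (SIGMA i:I. {..<s' i})"
        using t(1)[OF p(2)] by (intro image_eqI[of _ _ "(t j, k)"]) auto
    next
      fix p assume "p \<in> (\<lambda>(i, k). b i k) ` (SIGMA i:I. {..<s' i})"
      then obtain i k where "k < s' i" "p = b i k" by auto
      then show "p \<in> UNIV \<times> {..<n}" using b_in[of k i] by (auto simp: N_def)
    qed
  qed
  have BVk: "biproduct ?\<rho>k UNIV ?\<rho>k (SIGMA i:I. {..<s' i}) (\<lambda>(i, k). W' i)"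
  proof (rule biproduct_reindex[OF BQk bij])
    fix p assume "p \<in> (SIGMA i:I. {..<s' i})"
    then obtain i k where p: "p = (i, k)" "i \<in> I" "k < s' i" by auto
    show "monoid_rep ?\<rho>k (case p of (i, k) \<Rightarrow> W' i)" using p W' by simp
    obtain a j where j: "b i k = (a, j)" "j < n" "t j = i"
      using b_in[OF p(3)] by (auto simp: N_def)
    have "isomorphic_reps ?\<rho> (W i) ?\<rho>1 (Q j)"
      using isomorphic_reps_sym[OF t(2)[OF j(2)] MQ[OF j(2)]] j(3) by simp
    then show "isomorphic_reps ?\<rho>k (case p of (i, k) \<Rightarrow> W' i) ?\<rho>1
        (case case p of (i, k) \<Rightarrow> b i k of (j, k) \<Rightarrow> Q k)"
      using isomorphic_reps_trans[OF W'W[OF p(2)]] p(1) j(1) by simp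
  qed
  \<comment> \<open>The bound on the multiplicities enters here: the copies making up
    \<open>U\<close> fit into the new phase space, and \<open>P\<close> projects onto them.\<close>
  have ms: "m i \<le> s' i" if "i \<in> I" for i
    using m[of i] s'[OF that] that by (auto simp: I_def)
  then have sub: "(SIGMA i:I. {..<m i}) \<subseteq> (SIGMA i:I. {..<s' i})" by force
  obtain P where P: "rep_hom ?\<rho>k UNIV ?\<rho>k UNIV P" "\<And>v. P (P v) = P v"
    "biproduct ?\<rho>k (range P) ?\<rho>k (SIGMA i:I. {..<m i}) (\<lambda>(i, k). W' i)"
    using biproduct_subset[OF BVk sub] by auto
  have "biproduct ?\<rho> U ?\<rho>k (SIGMA i:I. {..<m i}) (\<lambda>(i, k). W' i)"
    by (rule biproduct_reindex[OF BU bij_betw_id]) (use W' W'W in auto)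
  then have iso: "isomorphic_reps ?\<rho> U ?\<rho>k (range P)" using P(3) by (rule biproduct_iso)
  have noniso': "\<not> isomorphic_reps ?\<rho>k (W' i) ?\<rho>k (W' j)" if "i \<in> I" "j \<in> I" "i \<noteq> j" for i j
    using noniso[OF that(1,2)] that(3)
      isomorphic_reps_trans[OF isomorphic_reps_trans[OF WW'[OF that(1)]] W'W[OF that(2)]] by blast
  have "typed_decomposition ?\<rho>k UNIV R C H W' s'"
    unfolding typed_decomposition_def I_def[symmetric]
  proof (intro conjI ballI impI)
    show "iso_direct_sum ?\<rho>k UNIV I W' s'" by (rule biproduct_imp_iso_direct_sum[OF BVk])
    show "0 < s' i" if "i \<in> I" for i using s'[OF that] by (meson less_le_trans zero_less_card_finite)
    show "real_type ?\<rho>k (W' i)" if "i \<in> R" for i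
      using type_iso(1)[OF WW' W'(1)] types(1) that by (auto simp: I_def)
    show "complex_type ?\<rho>k (W' i)" if "i \<in> C" for i
      using type_iso(2)[OF WW' W'(1)] types(2) that by (auto simp: I_def)
    show "quaternionic_type ?\<rho>k (W' i)" if "i \<in> H" for i
      using type_iso(3)[OF WW' W'(1)] types(3) that by (auto simp: I_def)
  qed (use T noniso' in \<open>auto simp: typed_decomposition_def\<close>)
  moreover have "iso_direct_sum ?\<rho>k (range P) I W' m"
    by (rule biproduct_imp_iso_direct_sum[OF P(3)])
  ultimately show ?thesis using that P(1,2) ms iso unfolding I_def by blast
qed

section \<open>Smooth maps and reduced problems\<close>

text \<open>The derivative of the composite in direction \<open>v\<close> has the same shape, with
  \<open>f\<close> replaced by its derivative in direction \<open>S v\<close>. Hence the induction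
  generalizes over \<open>f\<close>.\<close>

lemma times_differentiable_linear_comp:
  fixes f :: "'b::euclidean_space \<Rightarrow> 'c::euclidean_space"
    and S :: "'a::euclidean_space \<Rightarrow> 'b" and T :: "'c \<Rightarrow> 'd::euclidean_space"
  assumes S: "linear S" and T: "linear T"
  shows "times_differentiable k f \<Longrightarrow> times_differentiable k (\<lambda>x. T (f (S x)))"
proof (induction k arbitrary: f)
  case 0
  have "continuous_on UNIV S" "continuous_on UNIV T"
    using S T by (auto intro: linear_continuous_on linear_conv_bounded_linear[THEN iffD1])
  with 0 show ?case
    by (auto intro!: continuous_on_compose2[of UNIV T] continuous_on_compose2[of UNIV f])
next
  case (Suc k)
  have D: "((\<lambda>x. T (f (S x))) has_derivative (\<lambda>v. T (frechet_derivative f (at (S x)) (S v)))) (at x)" for x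
  proof -
    have "(f has_derivative frechet_derivative f (at (S x))) (at (S x))"
      using Suc.prems by (simp add: frechet_derivative_works)
    then show ?thesis
      using has_derivative_compose[OF linear_imp_has_derivative[OF S, of "at x"]]
      by (intro has_derivative_compose[OF _ linear_imp_has_derivative[OF T]]) auto
  qed
  have "frechet_derivative (\<lambda>x. T (f (S x))) (at x) v = T (frechet_derivative f (at (S x)) (S v))" for x v
    using frechet_derivative_at[OF D] by metis
  moreover have "times_differentiable k (\<lambda>x. T (frechet_derivative f (at (S x)) (S v)))" for v
    by (rule Suc.IH[of "\<lambda>y. frechet_derivative f (at y) (S v)"]) (use Suc.prems in simp)
  moreover have "(\<lambda>x. T (f (S x))) differentiable (at x)" for x
    unfolding differentiable_def by (rule exI, rule D)
  ultimately show ?case by simp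
qed

lemma smooth_linear_comp:
  fixes f :: "'b::euclidean_space \<Rightarrow> 'c::euclidean_space"
    and S :: "'a::euclidean_space \<Rightarrow> 'b" and T :: "'c \<Rightarrow> 'd::euclidean_space"
  shows "smooth f \<Longrightarrow> linear S \<Longrightarrow> linear T \<Longrightarrow> smooth (\<lambda>x. T (f (S x)))"
  by (simp add: smooth_def times_differentiable_linear_comp[of S T _ f])

lemma times_differentiable_const: "times_differentiable k (\<lambda>x. c)"
  by (induction k arbitrary: c) auto

text \<open>The derivative in a fixed direction is a constant map.\<close>

lemma smooth_linear:
  fixes f :: "'b::euclidean_space \<Rightarrow> 'c::euclidean_space"
  assumes f: "linear f"
  shows "smooth f"
  unfolding smooth_def
proof
  fix k
  have D: "(f has_derivative f) (at x)" for x by (rule linear_imp_has_derivative[OF f])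
  have "frechet_derivative f (at x) = f" for x using frechet_derivative_at[OF D] by simp
  then show "times_differentiable k f"
    using D f
    by (cases k) (auto simp: differentiable_def intro: times_differentiable_const linear_continuous_on
        linear_conv_bounded_linear[THEN iffD1])
qed

lemma smooth_differentiable: "smooth f \<Longrightarrow> f differentiable (at x)"
  using times_differentiable.simps(2)[of 0 f] by (auto simp: smooth_def)

text \<open>A vector is the sum of its \<open>axis\<close> components, each a bounded linear image
  of one coordinate.\<close>

lemma has_derivative_vec_lambda:
  fixes f :: "'i::finite \<Rightarrow> 'a::real_normed_vector \<Rightarrow> 'b::euclidean_space"
  assumes "\<And>i. (f i has_derivative f' i) F"
  shows "((\<lambda>x. \<chi> i. f i x) has_derivative (\<lambda>v. \<chi> i. f' i v)) F"
proof -
  have eq: "(\<chi> i. g i) = (\<Sum>i\<in>UNIV. axis i (g i))" for g :: "'i \<Rightarrow> 'b"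
    by (auto simp: vec_eq_iff axis_def)
  have "linear (axis i :: 'b \<Rightarrow> 'b^'i)" for i
    by (rule linearI) (auto simp: vec_eq_iff axis_def)
  then have "bounded_linear (axis i :: 'b \<Rightarrow> 'b^'i)" for i
    by (simp add: linear_conv_bounded_linear)
  then have "((\<lambda>x. \<Sum>i\<in>UNIV. axis i (f i x)) has_derivative (\<lambda>v. \<Sum>i\<in>UNIV. axis i (f' i v))) F"
    by (intro has_derivative_sum bounded_linear.has_derivative[OF _ assms])
  then show ?thesis by (simp only: eq)
qed

text \<open>A derivative within \<open>U\<close> is a linear map of the whole space, so its
  invariance of \<open>U\<close> has to be proved. Along the line through \<open>u\<close>, which
  stays in \<open>U\<close>, the inner product of \<open>r\<close> with a vector orthogonal to
  \<open>U\<close> is constantly zero.\<close>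

lemma derivative_within_subspace_mem:
  fixes U :: "'a::euclidean_space set"
  assumes L: "(r has_derivative L) (at 0 within U)" and U: "subspace U" and r: "\<And>u. u \<in> U \<Longrightarrow> r u \<in> U"
    and u: "u \<in> U"
  shows "L u \<in> U"
proof -
  have "y \<bullet> L u = 0" if y: "y \<in> U\<^sup>\<bottom>" for y
  proof -
    have orth: "y \<bullet> v = 0" if "v \<in> U" for v
      using y that by (auto simp: orthogonal_comp_def orthogonal_def inner_commute)
    have "((\<lambda>t. t *\<^sub>R u) has_derivative (\<lambda>t. t *\<^sub>R u)) (at (0::real))"
      by (auto intro!: derivative_eq_intros)
    moreover have "range (\<lambda>t::real. t *\<^sub>R u) \<subseteq> U" using u U by (auto simp: subspace_scale)
    then have "(r has_derivative L) (at (0 *\<^sub>R u) within (\<lambda>t. t *\<^sub>R u) ` UNIV)"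
      using has_derivative_subset[OF L] by simp
    ultimately have "((\<lambda>t. r (t *\<^sub>R u)) has_derivative (\<lambda>t. L (t *\<^sub>R u))) (at 0)"
      by (rule has_derivative_in_compose)
    then have "((\<lambda>t. y \<bullet> r (t *\<^sub>R u)) has_derivative (\<lambda>t. y \<bullet> L (t *\<^sub>R u))) (at 0)"
      by (rule has_derivative_inner_right)
    moreover have "y \<bullet> r (t *\<^sub>R u) = 0" for t
      using orth r u U by (auto simp: subspace_scale)
    ultimately have "((\<lambda>t::real. 0) has_derivative (\<lambda>t. y \<bullet> L (t *\<^sub>R u))) (at (0::real))" by simp
    then have "(\<lambda>t. y \<bullet> L (t *\<^sub>R u)) = (\<lambda>t. 0)"
      by (rule has_derivative_unique) (rule has_derivative_const)
    then show ?thesis by (metis scaleR_one)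
  qed
  then have "L u \<in> U\<^sup>\<bottom>\<^sup>\<bottom>" by (auto simp: orthogonal_comp_def orthogonal_def)
  then show ?thesis using orthogonal_comp_self[OF U] by simp
qed

text \<open>Smoothness and derivatives refer to the ambient spaces, so \<open>\<Phi>\<close> and its
  inverse are replaced by linear extensions \<open>F\<close> and \<open>G\<close>, which are inverse
  to each other on the subspaces.\<close>

lemma conjugate_reduced_problems:
  fixes \<rho> :: "'s::monoid_mult \<Rightarrow> 'a::euclidean_space \<Rightarrow> 'a"
    and \<rho>' :: "'s \<Rightarrow> 'b::euclidean_space \<Rightarrow> 'b" and r :: "'a \<times> 'p::euclidean_space \<Rightarrow> 'a"
  assumes \<Phi>: "rep_iso \<rho> U \<rho>' U' \<Phi>" and U: "monoid_rep \<rho> U" and U': "monoid_rep \<rho>' U'"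
    and r: "r \<in> reduced_problems S \<rho> U"
  shows "conjugate \<Phi> U U' r \<in> reduced_problems S \<rho>' U'"
proof -
  note P = rep_isoD[OF \<Phi>] and Q = rep_isoD[OF rep_iso_inv[OF \<Phi> U]]
  define \<Psi> where "\<Psi> = inv_into U \<Phi>"
  have \<Psi>: "rep_hom \<rho>' U' \<rho> U \<Psi>" using Q(1) by (simp add: \<Psi>_def)
  obtain F where F: "linear F" "\<And>x. x \<in> U \<Longrightarrow> F x = \<Phi> x"
    using linear_between_extend[OF rep_homD(1)[OF P(1)] monoid_repD(1)[OF U]] by blast
  obtain G where G: "linear G" "\<And>x. x \<in> U' \<Longrightarrow> G x = \<Psi> x"
    using linear_between_extend[OF rep_homD(1)[OF \<Psi>] monoid_repD(1)[OF U']] by blast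
  have FU: "F x \<in> U'" "G (F x) = x" if "x \<in> U" for x
    using that F(2) G(2) P(5) rep_homD(3)[OF P(1)] by (auto simp: \<Psi>_def)
  have GU: "G y \<in> U" "F (G y) = y" if "y \<in> U'" for y
    using that F(2) G(2) P(6,7) by (auto simp: \<Psi>_def)
  have c: "conjugate \<Phi> U U' r (w, \<mu>) = F (r (G w, \<mu>))" if "w \<in> U'" for w \<mu>
  proof -
    have "r (G w, \<mu>) \<in> U" using r GU(1)[OF that] by (auto simp: reduced_problems_def)
    then show ?thesis using that F(2) G(2) by (simp add: conjugate_def \<Psi>_def)
  qed
  have rU: "r (u, \<mu>) \<in> U" if "u \<in> U" for u \<mu> using r that by (auto simp: reduced_problems_def)
  obtain r' where r': "smooth r'" "\<And>u \<mu>. u \<in> U \<Longrightarrow> r (u, \<mu>) = r' (u, \<mu>)"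
    using r by (auto simp: reduced_problems_def)
  obtain L where L: "((\<lambda>u. r (u, 0)) has_derivative L) (at 0 within U)" "eigenvalues_on U L \<subseteq> S"
    using r by (auto simp: reduced_problems_def)
  have LU: "L u \<in> U" if "u \<in> U" for u
    by (rule derivative_within_subspace_mem[OF L(1) monoid_repD(1)[OF U] rU that])
  show ?thesis
    unfolding reduced_problems_def
  proof (intro CollectI conjI allI ballI)
    show "conjugate \<Phi> U U' r \<in> U' \<times> UNIV \<rightarrow>\<^sub>E U'"
      using c rU GU FU by (auto simp: PiE_iff extensional_def conjugate_def)
    have "smooth (\<lambda>q. F (r' (G (fst q), snd q)))"
    proof (rule smooth_linear_comp[OF r'(1)])
      show "linear (\<lambda>q. (G (fst q), snd q))"
        using G(1) by (intro linearI) (auto simp: linear_add linear_scale)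
    qed (rule F(1))
    then show "\<exists>r'. smooth r' \<and> (\<forall>q\<in>U' \<times> UNIV. conjugate \<Phi> U U' r q = r' q)"
      using c r'(2) GU(1) by (intro exI[of _ "\<lambda>q. F (r' (G (fst q), snd q))"]) auto
    fix \<sigma> w \<mu> assume w: "w \<in> U'"
    have "G (\<rho>' \<sigma> w) = \<rho> \<sigma> (G w)"
      using w G(2) rep_homD(2)[OF \<Psi>] monoid_repD(5)[OF U'] by simp
    moreover have "r (\<rho> \<sigma> (G w), \<mu>) = \<rho> \<sigma> (r (G w, \<mu>))"
      using r GU(1)[OF w] by (simp add: reduced_problems_def)
    moreover have "F (\<rho> \<sigma> (r (G w, \<mu>))) = \<rho>' \<sigma> (F (r (G w, \<mu>)))"
      using F(2) rU[OF GU(1)[OF w]] rep_homD(2)[OF P(1)] monoid_repD(5)[OF U] by simp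
    ultimately show "conjugate \<Phi> U U' r (\<rho>' \<sigma> w, \<mu>) = \<rho>' \<sigma> (conjugate \<Phi> U U' r (w, \<mu>))"
      using c w monoid_repD(5)[OF U'] by simp
  next
    have "r (0, 0) = 0" using r by (simp add: reduced_problems_def)
    then show "conjugate \<Phi> U U' r (0, 0) = 0"
      using c monoid_repD(6)[OF U'] linear_0[OF F(1)] linear_0[OF G(1)] by simp
  next
    define L' where "L' = (\<lambda>w. F (L (G w)))"
    have "((\<lambda>u. r (u, 0)) has_derivative L) (at (G 0) within G ` U')"
      using linear_0[OF G(1)] GU(1) by (auto intro: has_derivative_subset[OF L(1)])
    then have "((\<lambda>w. r (G w, 0)) has_derivative (\<lambda>w. L (G w))) (at 0 within U')"
      by (rule has_derivative_in_compose[OF linear_imp_has_derivative[OF G(1)]])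
    then have "((\<lambda>w. F (r (G w, 0))) has_derivative L') (at 0 within U')"
      unfolding L'_def by (rule bounded_linear.has_derivative[OF linear_conv_bounded_linear[THEN iffD1, OF F(1)]])
    then have "((\<lambda>w. conjugate \<Phi> U U' r (w, 0)) has_derivative L') (at 0 within U')"
      by (rule has_derivative_transform[rotated 2]) (use c monoid_repD(6)[OF U'] in auto)
    moreover have "eigenvalues_on U' L' \<subseteq> S"
    proof
      fix z assume "z \<in> eigenvalues_on U' L'"
      then obtain x y where xy: "x \<in> U'" "y \<in> U'" "(x, y) \<noteq> 0" "complex_shift L' z (x, y) = 0"
        by (auto simp: eigenvalues_on_def)
      \<comment> \<open>Both the real and the imaginary part of the eigenvector equation have this
        form. The vector in question lies in \<open>U\<close>, where \<open>F\<close> is injective,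
        so it may be tested after applying \<open>F\<close>.\<close>
      have sh: "L (G a) - (p *\<^sub>R G b + q *\<^sub>R G d) = 0"
        if "L' a - (p *\<^sub>R b + q *\<^sub>R d) = 0" "a \<in> U'" "b \<in> U'" "d \<in> U'" for a b d p q
      proof -
        let ?v = "L (G a) - (p *\<^sub>R G b + q *\<^sub>R G d)"
        have "?v \<in> U"
          using monoid_repD(1)[OF U] LU GU(1) that by (intro subspace_diff subspace_add subspace_scale) auto
        moreover have "F ?v = L' a - (p *\<^sub>R b + q *\<^sub>R d)"
          using GU(2) that by (simp add: L'_def linear_diff[OF F(1)] linear_add[OF F(1)] linear_scale[OF F(1)])
        ultimately show ?thesis using FU(2)[of ?v] that(1) linear_0[OF G(1)] by simp
      qed
      have "complex_shift L z (G x, G y) = 0"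
        using xy(4) sh[of x "Re z" x "- Im z" y] sh[of y "Im z" x "Re z" y] xy(1,2)
        by (simp add: complex_shift_def zero_prod_def)
      moreover have "(G x, G y) \<noteq> 0"
        using xy(1-3) GU(2)[of x] GU(2)[of y] linear_0[OF F(1)] by (auto simp: zero_prod_def)
      ultimately have "z \<in> eigenvalues_on U L"
        using GU(1) xy(1,2) by (auto simp: eigenvalues_on_def)
      with L(2) show "z \<in> S" by blast
    qed
    ultimately show "\<exists>L. ((\<lambda>u. conjugate \<Phi> U U' r (u, 0)) has_derivative L) (at 0 within U') \<and>
        eigenvalues_on U' L \<subseteq> S" by blast
  qed
qed

lemma conjugate_inverse:
  fixes r :: "'a::real_vector \<times> 'p \<Rightarrow> 'a"
  assumes "rep_iso \<rho> U \<rho>' U' \<Phi>" "monoid_rep \<rho> U" "r \<in> U \<times> UNIV \<rightarrow>\<^sub>E U"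
  shows "conjugate (inv_into U \<Phi>) U' U (conjugate \<Phi> U U' r) = r"
proof (rule extensionalityI[of _ "U \<times> UNIV"])
  note P = rep_isoD[OF assms(1)] and Q = rep_isoD[OF rep_iso_inv[OF assms(1,2)]]
  fix q :: "'a \<times> 'p" assume "q \<in> U \<times> UNIV"
  then obtain u \<mu> where q: "q = (u, \<mu>)" "u \<in> U" by auto
  have "inv_into U' (inv_into U \<Phi>) u = \<Phi> u"
    using q(2) P(5) rep_homD(3)[OF P(1)] by (intro inv_into_f_eq[OF Q(3)]) auto
  moreover have "r (u, \<mu>) \<in> U" using assms(3) q(2) by auto
  ultimately show "conjugate (inv_into U \<Phi>) U' U (conjugate \<Phi> U U' r) q = r q"
    using q P(5) rep_homD(3)[OF P(1)] by (simp add: conjugate_def)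
qed (use assms(3) in \<open>auto simp: conjugate_def PiE_iff\<close>)

lemma rep_iso_equivalent_reduced_problems:
  fixes \<rho> :: "'s::monoid_mult \<Rightarrow> 'a::euclidean_space \<Rightarrow> 'a"
    and \<rho>' :: "'s \<Rightarrow> 'b::euclidean_space \<Rightarrow> 'b"
  assumes \<Phi>: "rep_iso \<rho> U \<rho>' U' \<Phi>" and U: "monoid_rep \<rho> U" and U': "monoid_rep \<rho>' U'"
  shows "equivalent_reduced_problems TYPE('p::euclidean_space) S \<rho> U \<rho>' U'"
proof -
  note I = rep_iso_inv[OF \<Phi> U]
  let ?\<Psi> = "inv_into U \<Phi>"
  \<comment> \<open>Using the previous lemma for \<open>?\<Psi>\<close> would produce
    \<open>inv_into U' ?\<Psi>\<close>, which is tied to \<open>\<Phi>\<close> only on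
    \<open>U\<close>; the composite is therefore computed directly.\<close>
  have inv': "conjugate \<Phi> U U' (conjugate ?\<Psi> U' U r) = r" if "r \<in> U' \<times> UNIV \<rightarrow>\<^sub>E U'" for r :: "'b \<times> 'p \<Rightarrow> 'b"
  proof (rule extensionalityI[of _ "U' \<times> UNIV"])
    note P = rep_isoD[OF \<Phi>] and Q = rep_isoD[OF I]
    fix q :: "'b \<times> 'p" assume "q \<in> U' \<times> UNIV"
    then obtain u \<mu> where q: "q = (u, \<mu>)" "u \<in> U'" by auto
    have "inv_into U' ?\<Psi> (?\<Psi> u) = u" by (rule Q(5)[OF q(2)])
    moreover have "r (u, \<mu>) \<in> U'" using that q(2) by auto
    ultimately show "conjugate \<Phi> U U' (conjugate ?\<Psi> U' U r) q = r q"
      using q P(6,7) by (simp add: conjugate_def)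
  qed (use that in \<open>auto simp: conjugate_def PiE_iff\<close>)
  have "bij_betw (conjugate \<Phi> U U') (reduced_problems S \<rho> U :: ('a \<times> 'p \<Rightarrow> 'a) set) (reduced_problems S \<rho>' U')"
  proof (rule bij_betw_byWitness[where f' = "conjugate ?\<Psi> U' U"])
    show "\<forall>r\<in>reduced_problems S \<rho> U. conjugate ?\<Psi> U' U (conjugate \<Phi> U U' r) = (r :: 'a \<times> 'p \<Rightarrow> 'a)"
      using conjugate_inverse[OF \<Phi> U] by (auto simp: reduced_problems_def)
    show "\<forall>r\<in>reduced_problems S \<rho>' U'. conjugate \<Phi> U U' (conjugate ?\<Psi> U' U r) = (r :: 'b \<times> 'p \<Rightarrow> 'b)"
      using inv' by (auto simp: reduced_problems_def)
    show "conjugate \<Phi> U U' ` reduced_problems S \<rho> U \<subseteq> (reduced_problems S \<rho>' U' :: ('b \<times> 'p \<Rightarrow> 'b) set)"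
      using conjugate_reduced_problems[OF \<Phi> U U'] by (rule image_subsetI)
    show "conjugate ?\<Psi> U' U ` reduced_problems S \<rho>' U' \<subseteq> (reduced_problems S \<rho> U :: ('a \<times> 'p \<Rightarrow> 'a) set)"
      using conjugate_reduced_problems[OF I U' U] by (rule image_subsetI)
  qed
  with \<Phi> show ?thesis unfolding equivalent_reduced_problems_def by blast
qed

section \<open>Admissible fields and their linearizations\<close>

lemma network_field_conv_action: "network_field f (v, \<mu>) = (\<chi> \<sigma>. f (network_action \<sigma> v, \<mu>))"
  by (simp add: network_field_def network_action_def)

lemma network_field_equivariant:
  "network_field f (network_action \<sigma> v, \<mu>) = network_action \<sigma> (network_field f (v, \<mu>))"
  by (simp add: network_field_def network_action_def vec_eq_iff mult.assoc)

lemma linear_network_action: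
  "linear (network_action \<sigma> :: 'v::real_vector^'s::{finite,monoid_mult} \<Rightarrow> 'v^'s::{finite,monoid_mult})"
  by (rule linearI) (auto simp: network_action_def vec_eq_iff)

text \<open>The component at \<open>\<sigma>\<close> is \<open>f\<close> after a linear map, so the
  field is differentiable. Since the action fixes 0, differentiating the equivariance relation there
  by the chain rule yields equivariance of the derivative.\<close>

lemma network_linearization_equivariant:
  fixes f :: "((real^'d)^'s::{finite,monoid_mult}) \<times> (real^'l) \<Rightarrow> real^'d"
  assumes "smooth f"
  shows "linear (network_linearization f)"
    and "network_linearization f (network_action \<sigma> v) = network_action \<sigma> (network_linearization f v)"
proof -
  let ?F = "\<lambda>v. network_field f (v, 0)"
  have "(\<lambda>v. f (network_action \<sigma> v, 0)) differentiable (at 0)" for \<sigma>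
  proof -
    let ?N = "network_action \<sigma> :: (real^'d)^'s::{finite,monoid_mult} \<Rightarrow> _"
    have "linear (\<lambda>v. (?N v, 0 :: real^'l))"
      by (intro linearI)
        (auto simp: linear_add[OF linear_network_action] linear_scale[OF linear_network_action])
    then have "(\<lambda>v. (?N v, 0 :: real^'l)) differentiable (at 0)"
      unfolding differentiable_def using linear_imp_has_derivative by blast
    from differentiable_chain_at[OF this smooth_differentiable[OF assms]] show ?thesis
      by (simp add: o_def)
  qed
  then have "((\<lambda>v. f (network_action \<sigma> v, 0)) has_derivative
      frechet_derivative (\<lambda>v. f (network_action \<sigma> v, 0)) (at 0)) (at 0)" for \<sigma>
    by (simp add: frechet_derivative_works)
  from has_derivative_vec_lambda[OF this] have "?F differentiable (at 0)"
    unfolding network_field_conv_action by (rule differentiableI)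
  then have D: "(?F has_derivative network_linearization f) (at 0)"
    by (simp add: network_linearization_def frechet_derivative_works)
  show "linear (network_linearization f)"
    using D by (rule has_derivative_linear)
  let ?N = "network_action \<sigma> :: (real^'d)^'s::{finite,monoid_mult} \<Rightarrow> _"
  note N = linear_imp_has_derivative[OF linear_network_action]
  have "?N 0 = 0" by (simp add: network_action_def vec_eq_iff)
  then have "(?F has_derivative network_linearization f) (at (?N 0))"
    using D by metis
  from has_derivative_compose[OF N this]
  have "((\<lambda>v. ?F (?N v)) has_derivative (\<lambda>v. network_linearization f (?N v))) (at 0)" .
  moreover from has_derivative_compose[OF D N]
  have "((\<lambda>v. ?F (?N v)) has_derivative (\<lambda>v. ?N (network_linearization f v))) (at 0)"
    by (simp add: network_field_equivariant)
  ultimately have "(\<lambda>v. network_linearization f (?N v)) = (\<lambda>v. ?N (network_linearization f v))"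
    by (rule has_derivative_unique)
  then show "network_linearization f (?N v) = ?N (network_linearization f v)" by metis
qed

text \<open>An equivariant map is determined by its component at the unit: component
  \<open>\<sigma>\<close> of \<open>M v\<close> is the unit component of
  \<open>network_action \<sigma> (M v)\<close>, that is, of
  \<open>M (network_action \<sigma> v)\<close>. So the unit component of \<open>M\<close> serves as
  response function.\<close>

lemma linear_network_field:
  fixes M :: "(real^'k)^'s::{finite,monoid_mult} \<Rightarrow> (real^'k)^'s::{finite,monoid_mult}"
  assumes M: "linear M" and eq: "\<And>\<sigma> v. M (network_action \<sigma> v) = network_action \<sigma> (M v)"
  defines "g \<equiv> \<lambda>q :: _ \<times> (real^'l). M (fst q) $ 1"
  shows "smooth g" "network_field g (v, \<mu>) = M v" "network_linearization g = M"
proof -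
  show "smooth g" unfolding g_def
    by (rule smooth_linear, rule linearI) (auto simp: linear_add[OF M] linear_scale[OF M])
  show F: "network_field g (v, \<mu>) = M v" for v \<mu>
    unfolding network_field_conv_action g_def by (simp add: eq) (simp add: network_action_def)
  show "network_linearization g = M"
    unfolding network_linearization_def F
    using frechet_derivative_at[OF linear_imp_has_derivative[OF M, of "at 0"]] by simp
qed

section \<open>Spectral subspaces and model operators\<close>

text \<open>\<open>map_prod T T\<close> is the complexification of \<open>T\<close>. The
  intertwining relation is assumed on \<open>U\<close> only, so invariance of
  \<open>U \<times> U\<close> accompanies it, ready for iteration.\<close>

lemma complex_shift_intertwine:
  assumes T: "linear_between U V T" and U: "subspace U"
    and inv: "\<And>x. x \<in> U \<Longrightarrow> A x \<in> U" and TA: "\<And>x. x \<in> U \<Longrightarrow> T (A x) = B (T x)" and p: "p \<in> U \<times> U"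
  shows "complex_shift A z p \<in> U \<times> U"
    and "complex_shift B z (map_prod T T p) = map_prod T T (complex_shift A z p)"
proof -
  obtain x y where xy: "p = (x, y)" "x \<in> U" "y \<in> U" using p by auto
  have mem: "A x - (Re z *\<^sub>R x - Im z *\<^sub>R y) \<in> U" "A y - (Im z *\<^sub>R x + Re z *\<^sub>R y) \<in> U"
    "a *\<^sub>R x \<in> U" "a *\<^sub>R y \<in> U" "a *\<^sub>R x - b *\<^sub>R y \<in> U" "a *\<^sub>R x + b *\<^sub>R y \<in> U" for a b
    using xy inv U by (auto intro!: subspace_diff subspace_add subspace_scale)
  then show "complex_shift A z p \<in> U \<times> U" by (simp add: complex_shift_def xy)
  show "complex_shift B z (map_prod T T p) = map_prod T T (complex_shift A z p)"
    using xy mem inv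
    by (simp add: complex_shift_def TA linear_between_diff[OF T U] linear_betweenD(2,3)[OF T])
qed

lemma complex_shift_funpow_intertwine:
  assumes "linear_between U V T" "subspace U"
    "\<And>x. x \<in> U \<Longrightarrow> A x \<in> U" "\<And>x. x \<in> U \<Longrightarrow> T (A x) = B (T x)" "p \<in> U \<times> U"
  shows "(complex_shift A z ^^ k) p \<in> U \<times> U \<and>
    (complex_shift B z ^^ k) (map_prod T T p) = map_prod T T ((complex_shift A z ^^ k) p)"
proof (induction k)
  case (Suc k)
  then show ?case
    using complex_shift_intertwine[where U = U and A = A and B = B and T = T, OF assms(1-4), of "(complex_shift A z ^^ k) p" z]
    by auto
qed (use assms(5) in auto)

lemma generalized_eigenspace_map:
  assumes "linear_between U V T" "subspace U"
    "\<And>x. x \<in> U \<Longrightarrow> A x \<in> U" "\<And>x. x \<in> U \<Longrightarrow> T (A x) = B (T x)" "p \<in> U \<times> U"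
    "p \<in> generalized_eigenspace A z"
  shows "map_prod T T p \<in> generalized_eigenspace B z"
proof -
  obtain k where "(complex_shift A z ^^ k) p = 0" using assms(6) by (auto simp: generalized_eigenspace_def)
  then have "(complex_shift B z ^^ k) (map_prod T T p) = 0"
    using complex_shift_funpow_intertwine[where U = U and A = A and B = B and T = T and p = p, OF assms(1-5)] linear_between_0[OF assms(1) subspace_0[OF assms(2)]]
    by (simp add: zero_prod_def)
  then show ?thesis by (auto simp: generalized_eigenspace_def)
qed

lemma linear_linear_between: "linear T \<Longrightarrow> linear_between UNIV UNIV T"
  by (simp add: linear_between_def linear_add linear_scale)

lemma funpow_intertwine:
  assumes "\<And>p. S' (c p) = c (S p)"
  shows "(S' ^^ k) (c p) = c ((S ^^ k) p)"
  by (induction k) (auto simp: assms)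

text \<open>The pairs \<open>(x, - y)\<close> and \<open>(- y, x)\<close> encode the complex conjugate and the \<open>\<i>\<close>-fold of \<open>x + \<i> y\<close>.\<close>

lemma generalized_eigenspace_conj_rot:
  assumes A: "linear A" and p: "(x, y) \<in> generalized_eigenspace A z"
  shows "(x, - y) \<in> generalized_eigenspace A (cnj z)" "(- y, x) \<in> generalized_eigenspace A z"
proof -
  obtain k where k: "(complex_shift A z ^^ k) (x, y) = 0"
    using p by (auto simp: generalized_eigenspace_def)
  have "(complex_shift A (cnj z) ^^ k) ((\<lambda>(x, y). (x, - y)) (x, y)) = (\<lambda>(x, y). (x, - y)) ((complex_shift A z ^^ k) (x, y))"
    by (rule funpow_intertwine) (auto simp: complex_shift_def linear_neg[OF A])
  with k show "(x, - y) \<in> generalized_eigenspace A (cnj z)"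
    by (auto simp: generalized_eigenspace_def zero_prod_def)
  have "(complex_shift A z ^^ k) ((\<lambda>(x, y). (- y, x)) (x, y)) = (\<lambda>(x, y). (- y, x)) ((complex_shift A z ^^ k) (x, y))"
    by (rule funpow_intertwine) (auto simp: complex_shift_def linear_neg[OF A])
  with k show "(- y, x) \<in> generalized_eigenspace A z"
    by (auto simp: generalized_eigenspace_def zero_prod_def)
qed

text \<open>The imaginary axis is stable under conjugation, so averaging a vector with its conjugate
  puts the real part into the center subspace. The imaginary part is minus the real part of the
  \<open>\<i>\<close>-fold.\<close>

lemma center_subspace_components:
  assumes A: "linear A" and p: "(x, y) \<in> generalized_eigenspace A z" and z: "z \<in> imaginary_axis"
  shows "x \<in> center_subspace A" "y \<in> center_subspace A"
proof -
  let ?S = "span (\<Union>z\<in>imaginary_axis. generalized_eigenspace A z)"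
  have fst: "a \<in> center_subspace A" if ab: "(a, b) \<in> generalized_eigenspace A z" for a b
  proof -
    have "(a, b) \<in> ?S" using ab z by (intro span_base) auto
    moreover have "cnj z \<in> imaginary_axis" using z by (simp add: imaginary_axis_def)
    then have "(a, - b) \<in> ?S" using generalized_eigenspace_conj_rot(1)[OF A ab] by (intro span_base) auto
    ultimately have "(1/2) *\<^sub>R ((a, b) + (a, - b)) \<in> ?S" by (intro span_scale span_add)
    then show ?thesis by (simp add: center_subspace_def scaleR_2[symmetric])
  qed
  show "x \<in> center_subspace A" using fst p .
  have "- y \<in> center_subspace A" using fst generalized_eigenspace_conj_rot(2)[OF A p] .
  then have "- (- y, 0) \<in> ?S" unfolding center_subspace_def by (intro span_neg) simp
  then show "y \<in> center_subspace A" by (simp add: center_subspace_def)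
qed

lemma center_subspace_map:
  assumes T: "linear T" and "\<And>z p. z \<in> imaginary_axis \<Longrightarrow> p \<in> generalized_eigenspace A z \<Longrightarrow>
      map_prod T T p \<in> generalized_eigenspace B z" and v: "v \<in> center_subspace A"
  shows "T v \<in> center_subspace B"
proof -
  have "linear (map_prod T T)"
    by (rule linearI) (auto simp: linear_add[OF T] linear_scale[OF T])
  then have "map_prod T T (v, 0) \<in> span (map_prod T T ` (\<Union>z\<in>imaginary_axis. generalized_eigenspace A z))"
    using v by (subst linear_span_image) (auto simp: center_subspace_def)
  also have "\<dots> \<subseteq> span (\<Union>z\<in>imaginary_axis. generalized_eigenspace B z)"
  proof (intro span_mono image_subsetI)
    fix p assume "p \<in> (\<Union>z\<in>imaginary_axis. generalized_eigenspace A z)"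
    then obtain z where "z \<in> imaginary_axis" "p \<in> generalized_eigenspace A z" by blast
    then show "map_prod T T p \<in> (\<Union>z\<in>imaginary_axis. generalized_eigenspace B z)"
      using assms(2)[of z p] by (intro UN_I)
  qed
  finally show ?thesis using linear_0[OF T] by (simp add: center_subspace_def)
qed

text \<open>Taking for \<open>T\<close> the network action makes the center subspace a
  subrepresentation; taking \<open>A\<close> itself makes it invariant under the
  linearization.\<close>

lemma center_subspace_commute:
  assumes "linear T" "\<And>v. T (A v) = A (T v)" "v \<in> center_subspace A"
  shows "T v \<in> center_subspace A"
  using assms(2) by (intro center_subspace_map[OF assms(1) _ assms(3)]
    generalized_eigenspace_map[OF linear_linear_between[OF assms(1)] subspace_UNIV]) auto

lemma subspace_center_subspace: "subspace (center_subspace A)"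
proof (rule subspaceI)
  let ?S = "span (\<Union>z\<in>imaginary_axis. generalized_eigenspace A z)"
  show "0 \<in> center_subspace A"
    using span_zero[of "\<Union>z\<in>imaginary_axis. generalized_eigenspace A z"]
    by (simp add: center_subspace_def zero_prod_def)
  fix x y c assume x: "x \<in> center_subspace A"
  have "c *\<^sub>R (x, 0) \<in> ?S" using x by (intro span_scale) (simp add: center_subspace_def)
  then show "c *\<^sub>R x \<in> center_subspace A" by (simp add: center_subspace_def)
  assume "y \<in> center_subspace A"
  with x have "(x, 0) + (y, 0) \<in> ?S" by (intro span_add) (simp_all add: center_subspace_def)
  then show "x + y \<in> center_subspace A" by (simp add: center_subspace_def)
qed

lemma subspace_generalized_kernel:
  assumes A: "linear A"
  shows "subspace (generalized_kernel A)"
proof (rule subspaceI)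
  have lin: "linear (A ^^ k)" for k
  proof (induction k)
    case (Suc k)
    show ?case using linear_compose[OF Suc A] by (simp add: comp_def)
  qed (auto intro: linearI)
  have up: "(A ^^ (j + k)) x = 0" if "(A ^^ k) x = 0" for j k x
    using that linear_0[OF lin] by (simp add: funpow_add)
  show "0 \<in> generalized_kernel A" by (auto simp: generalized_kernel_def intro: exI[of _ "0::nat"])
  fix x y c assume x: "x \<in> generalized_kernel A"
  then show "c *\<^sub>R x \<in> generalized_kernel A" by (auto simp: generalized_kernel_def linear_scale[OF lin])
  assume y: "y \<in> generalized_kernel A"
  from x y obtain j k where "(A ^^ j) x = 0" "(A ^^ k) y = 0" by (auto simp: generalized_kernel_def)
  then have "(A ^^ (j + k)) (x + y) = 0"
    using up[of j x k] up[of k y j] by (simp add: linear_add[OF lin] add.commute)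
  then show "x + y \<in> generalized_kernel A" by (auto simp: generalized_kernel_def)
qed

lemma generalized_kernel_commute:
  assumes "linear T" "\<And>v. T (A v) = A (T v)" "v \<in> generalized_kernel A"
  shows "T v \<in> generalized_kernel A"
proof -
  obtain k where "(A ^^ k) v = 0" using assms(3) by (auto simp: generalized_kernel_def)
  then have "(A ^^ k) (T v) = 0"
    using funpow_intertwine[of A T A k v, OF assms(2)[symmetric]] linear_0[OF assms(1)] by simp
  then show ?thesis by (auto simp: generalized_kernel_def)
qed

text \<open>
  The model operator \<open>M\<close> is \<open>A\<close> on a copy \<open>range P\<close> of \<open>U\<close> and the identity on the complement.
\<close>

locale model_operator =
  fixes A :: "'a::euclidean_space \<Rightarrow> 'a" and U :: "'a set" and P M :: "'b::euclidean_space \<Rightarrow> 'b"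
    and \<Phi> :: "'a \<Rightarrow> 'b"
  assumes linear_A: "linear A" and linear_P: "linear P" and linear_M: "linear M"
    and subspace_U: "subspace U" and A_U: "u \<in> U \<Longrightarrow> A u \<in> U"
    and \<Phi>: "linear_between U (range P) \<Phi>" and \<Phi>_bij: "bij_betw \<Phi> U (range P)"
    and M_\<Phi>: "u \<in> U \<Longrightarrow> \<Phi> (A u) = M (\<Phi> u)" and M_compl: "M v - P (M v) = v - P v"
begin

lemma \<Phi>_eq_0: "u \<in> U \<Longrightarrow> \<Phi> u = 0 \<Longrightarrow> u = 0"
  using \<Phi>_bij linear_between_0[OF \<Phi> subspace_0[OF subspace_U]] subspace_0[OF subspace_U]
  by (metis bij_betw_imp_inj_on inj_onD)

lemma in_rangeI: "v - P v = 0 \<Longrightarrow> v \<in> range P"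
  by (metis eq_iff_diff_eq_0 rangeI)

text \<open>Iterates of \<open>M\<close> never change the component \<open>v - P v\<close>, so a
  vector that some iterate kills lies in \<open>range P\<close>. There \<open>\<Phi>\<close>
  intertwines \<open>M\<close> with \<open>A\<close> on its generalized kernel.\<close>

lemma generalized_kernel_model:
  assumes "U = generalized_kernel A"
  shows "generalized_kernel M = range P"
proof (intro equalityI subsetI)
  fix v assume "v \<in> generalized_kernel M"
  then obtain k where k: "(M ^^ k) v = 0" by (auto simp: generalized_kernel_def)
  have "(M ^^ k) v - P ((M ^^ k) v) = v - P v"
    by (induction k) (auto simp: M_compl)
  then show "v \<in> range P" using k linear_0[OF linear_P] by (intro in_rangeI) simp
next
  fix v assume "v \<in> range P"
  then obtain u where u: "u \<in> U" "v = \<Phi> u" using \<Phi>_bij by (auto simp: bij_betw_def)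
  then obtain k where k: "(A ^^ k) u = 0" using assms by (auto simp: generalized_kernel_def)
  have "(A ^^ j) u \<in> U \<and> (M ^^ j) (\<Phi> u) = \<Phi> ((A ^^ j) u)" for j
    by (induction j) (auto simp: u A_U M_\<Phi>)
  then have "(M ^^ k) v = 0"
    using k u linear_between_0[OF \<Phi> subspace_0[OF subspace_U]] by simp
  then show "v \<in> generalized_kernel M" by (auto simp: generalized_kernel_def)
qed

text \<open>The projection \<open>?Q\<close> to the complement intertwines \<open>M\<close> with the
  identity, which has no generalized eigenvectors on the imaginary axis; hence \<open>?Q\<close>
  kills those of \<open>M\<close>.\<close>

lemma center_subspace_model:
  assumes U: "U = center_subspace A"
  shows "center_subspace M = range P"
proof (intro equalityI subsetI)
  fix v assume v: "v \<in> center_subspace M"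
  let ?Q = "\<lambda>v. v - P v"
  have Q: "linear ?Q" by (rule linearI) (auto simp: linear_add[OF linear_P] linear_scale[OF linear_P] algebra_simps)
  have Q0: "map_prod ?Q ?Q p = 0" if z: "z \<in> imaginary_axis" and p: "p \<in> generalized_eigenspace M z" for z p
  proof -
    have "map_prod ?Q ?Q p \<in> generalized_eigenspace (\<lambda>v. v) z"
      using p by (intro generalized_eigenspace_map[OF linear_linear_between[OF Q] subspace_UNIV])
        (auto simp: M_compl)
    then obtain k where k: "(complex_shift (\<lambda>v. v) z ^^ k) (map_prod ?Q ?Q p) = 0"
      by (auto simp: generalized_eigenspace_def)
    have inj: "q = 0" if "complex_shift (\<lambda>v. v) z q = 0" for q :: "'b \<times> 'b"
    proof -
      obtain x y where q: "q = (x, y)" by (cases q)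
      define w where "w = Im z"
      have "Re z = 0" using z by (simp add: imaginary_axis_def)
      then have "complex_shift (\<lambda>v. v) z q = (x + w *\<^sub>R y, y - w *\<^sub>R x)"
        by (simp add: complex_shift_def w_def q)
      with that have "(x + w *\<^sub>R y, y - w *\<^sub>R x) = 0" by simp
      then have e: "x + w *\<^sub>R y = 0" "y = w *\<^sub>R x" unfolding zero_prod_def prod.inject by auto
      \<comment> \<open>The factor is the squared modulus of \<open>1 - \<i> w\<close>, by which the
        shifted identity multiplies.\<close>
      have "(1 + w * w) *\<^sub>R x = x + w *\<^sub>R y" unfolding e(2) by (simp add: scaleR_left_distrib)
      then have "(1 + w * w) *\<^sub>R x = 0" using e(1) by simp
      moreover have "0 < 1 + w * w" by (rule add_pos_nonneg) simp_all
      ultimately have "x = 0" by simp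
      with e(2) show ?thesis by (simp add: q zero_prod_def)
    qed
    have "q = 0" if "(complex_shift (\<lambda>v. v) z ^^ k) q = 0" for q :: "'b \<times> 'b"
      using that inj by (induction k) auto
    with k show ?thesis by blast
  qed
  have "map_prod ?Q ?Q ` (\<Union>z\<in>imaginary_axis. generalized_eigenspace M z) \<subseteq> {0}"
  proof (rule image_subsetI)
    fix p assume "p \<in> (\<Union>z\<in>imaginary_axis. generalized_eigenspace M z)"
    then obtain z where "z \<in> imaginary_axis" "p \<in> generalized_eigenspace M z" by blast
    from Q0[OF this] show "map_prod ?Q ?Q p \<in> {0}" by simp
  qed
  moreover have lin: "linear (map_prod ?Q ?Q)"
    by (rule linearI) (auto simp: linear_add[OF Q] linear_scale[OF Q] simp del: diff_add_eq)
  have "(v, 0) \<in> span (\<Union>z\<in>imaginary_axis. generalized_eigenspace M z)"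
    using v by (simp add: center_subspace_def)
  then have "map_prod ?Q ?Q (v, 0) \<in> span (map_prod ?Q ?Q ` (\<Union>z\<in>imaginary_axis. generalized_eigenspace M z))"
    unfolding linear_span_image[OF lin] by (rule imageI)
  ultimately have "map_prod ?Q ?Q (v, 0) \<in> span {0}" using span_mono by blast
  moreover have "span {0} = ({0} :: ('b \<times> 'b) set)"
    by (simp only: span_eq_iff subspace_single_0)
  ultimately have "map_prod ?Q ?Q (v, 0) = 0" by (simp only: singleton_iff)
  then show "v \<in> range P" by (intro in_rangeI) (simp add: zero_prod_def)
next
  fix v assume "v \<in> range P"
  then obtain u where u: "u \<in> U" "v = \<Phi> u" using \<Phi>_bij by (auto simp: bij_betw_def)
  \<comment> \<open>The center subspace is defined by a span in the full complexification, so a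
    linear map on the whole space is required. It agrees with \<open>\<Phi>\<close> on the vectors
    that matter, since their components lie in \<open>U\<close>.\<close>
  obtain F where F: "linear F" "\<And>x. x \<in> U \<Longrightarrow> F x = \<Phi> x"
    using linear_between_extend[OF \<Phi> subspace_U] by blast
  have "F u \<in> center_subspace M"
  proof (rule center_subspace_map[OF F(1)])
    show "u \<in> center_subspace A" using u U by simp
    fix z p assume z: "z \<in> imaginary_axis" and p: "p \<in> generalized_eigenspace A z"
    have pU: "p \<in> U \<times> U"
      using center_subspace_components[OF linear_A _ z] p unfolding U by (cases p) auto
    have "map_prod \<Phi> \<Phi> p \<in> generalized_eigenspace M z"
      by (rule generalized_eigenspace_map[OF \<Phi> subspace_U A_U M_\<Phi> pU p])
    moreover have "map_prod F F p = map_prod \<Phi> \<Phi> p" using pU F(2) by auto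
    ultimately show "map_prod F F p \<in> generalized_eigenspace M z" by simp
  qed
  then show "v \<in> center_subspace M" using u F(2) by simp
qed

text \<open>Injectivity of \<open>\<Phi>\<close> keeps the transported eigenvector nonzero; this
  preserves the eigenvalue 0 or the nonzero imaginary one that the bifurcation demands.\<close>

lemma eigenvalue_model:
  assumes "p \<in> U \<times> U" "p \<noteq> 0" "complex_shift A z p = 0"
  shows "z \<in> eigenvalues_on UNIV M"
proof -
  have "complex_shift M z (map_prod \<Phi> \<Phi> p) = 0"
    using complex_shift_intertwine(2)[where U = U and A = A and B = M and T = \<Phi>, OF \<Phi> subspace_U A_U M_\<Phi> assms(1)] assms(3)
      linear_between_0[OF \<Phi> subspace_0[OF subspace_U]] by (simp add: zero_prod_def)
  moreover have "map_prod \<Phi> \<Phi> p \<noteq> 0"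
    using assms(1,2) \<Phi>_eq_0 by (auto simp: zero_prod_def)
  ultimately show ?thesis
    unfolding eigenvalues_on_def UNIV_Times_UNIV by (intro CollectI bexI[of _ "map_prod \<Phi> \<Phi> p"] conjI UNIV_I)
qed

end

text \<open>Stated for an arbitrary invariant subrepresentation \<open>U\<close> and an arbitrary
  dimension index \<open>'k\<close>, so that it covers the generalized kernel with \<open>'l\<close>
  and the center subspace with \<open>'l + 'l\<close>.\<close>

lemma exists_model_operator:
  fixes f :: "((real^'d)^'s::{finite,monoid_mult}) \<times> (real^'l) \<Rightarrow> real^'d"
    and U :: "((real^'d)^'s::{finite,monoid_mult}) set"
  assumes f: "smooth f" and MU: "monoid_rep network_action U"
    and AU: "\<And>u. u \<in> U \<Longrightarrow> network_linearization f u \<in> U"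
    and T: "typed_decomposition network_action (UNIV :: ((real^'d)^'s::{finite,monoid_mult}) set) R C H W s"
    and Um: "iso_direct_sum network_action U (R \<union> C \<union> H) W m"
    and mk: "\<And>i. i \<in> R \<union> C \<union> H \<Longrightarrow> m i \<le> CARD('k)"
  obtains g :: "((real^'k)^'s::{finite,monoid_mult}) \<times> (real^'l) \<Rightarrow> real^'k" and P \<Phi> W' s'
  where "smooth g" "network_field g (0, 0) = 0" "monoid_rep network_action (range P)"
    "rep_iso network_action U network_action (range P) \<Phi>"
    "model_operator (network_linearization f) U P (network_linearization g) \<Phi>"
    "typed_decomposition network_action (UNIV :: ((real^'k)^'s::{finite,monoid_mult}) set) R C H W' s'"
    "\<And>i. i \<in> R \<union> C \<union> H \<Longrightarrow> m i \<le> s' i"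
    "iso_direct_sum network_action (range P) (R \<union> C \<union> H) W' m"
proof -
  let ?A = "network_linearization f"
  note A = network_linearization_equivariant[OF f]
  obtain W' :: "nat \<Rightarrow> ((real^'k)^'s::{finite,monoid_mult}) set" and s' P where
    W': "typed_decomposition network_action (UNIV :: ((real^'k)^'s::{finite,monoid_mult}) set) R C H W' s'"
    "\<And>i. i \<in> R \<union> C \<union> H \<Longrightarrow> m i \<le> s' i" and
    P: "rep_hom network_action UNIV network_action UNIV P" "\<And>v. P (P v) = P v"
    "iso_direct_sum network_action (range P) (R \<union> C \<union> H) W' m"
    "isomorphic_reps network_action U network_action (range P)"
    using transfer_typed_decomposition[OF T Um MU mk] by blast
  obtain \<Phi> where \<Phi>: "rep_iso network_action U network_action (range P) \<Phi>"
    using P(4) by (auto simp: isomorphic_reps_def)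
  note I = rep_isoD[OF \<Phi>] and J = rep_isoD[OF rep_iso_inv[OF \<Phi> MU]]
  note V = monoid_rep_network_action
  have MP: "monoid_rep network_action (range P)" by (rule subrep_image[OF V V P(1)])
  define M where "M = (\<lambda>v. \<Phi> (?A (inv_into U \<Phi> (P v))) + (v - P v))"
  have "rep_hom network_action U network_action U ?A"
    using AU A by (intro rep_homI) (auto simp: linear_add linear_scale)
  moreover have "rep_hom network_action UNIV network_action (range P) P"
    by (rule rep_hom_corestrict[OF P(1)]) simp
  ultimately have "rep_hom network_action UNIV network_action (range P) (\<lambda>v. \<Phi> (?A (inv_into U \<Phi> (P v))))"
    by (intro rep_hom_comp[OF rep_hom_comp[OF rep_hom_comp[OF _ J(1)]] I(1)])
  then have "rep_hom network_action UNIV network_action UNIV (\<lambda>v. \<Phi> (?A (inv_into U \<Phi> (P v))))"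
    by (rule rep_hom_corestrict) simp
  then have M: "rep_hom network_action UNIV network_action UNIV M"
    unfolding M_def by (intro rep_hom_add rep_hom_diff V P(1) rep_hom_id)
  have lin: "linear a" if "rep_hom network_action UNIV network_action UNIV a"
    for a :: "(real^'k)^'s::{finite,monoid_mult} \<Rightarrow> (real^'k)^'s::{finite,monoid_mult}"
    using rep_homD(4,5)[OF that] by (intro linearI) auto
  \<comment> \<open>The parameter does not enter \<open>g\<close>: what has to be realized is a
    linearization at the bifurcation point.\<close>
  define g :: "((real^'k)^'s::{finite,monoid_mult}) \<times> (real^'l) \<Rightarrow> real^'k" where "g = (\<lambda>q. M (fst q) $ 1)"
  note G = linear_network_field[OF lin[OF M] rep_homD(2)[OF M UNIV_I], where 'l = 'l, folded g_def]
  have PP: "P (\<Phi> u) = \<Phi> u" if "u \<in> U" for u using rep_homD(3)[OF I(1) that] P(2) by auto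
  have mem: "\<Phi> (?A (inv_into U \<Phi> (P v))) = P (\<Phi> (?A (inv_into U \<Phi> (P v))))" for v
    by (rule PP[symmetric]) (auto intro: AU I(7))
  have "model_operator ?A U P M \<Phi>"
  proof (rule model_operator.intro)
    fix v
    \<comment> \<open>\<open>P\<close> fixes the transported part and kills \<open>v - P v\<close>,
      so subtracting \<open>P (M v)\<close> leaves exactly the component in the complement.\<close>
    have "P (M v) = P (\<Phi> (?A (inv_into U \<Phi> (P v)))) + (P v - P (P v))"
      unfolding M_def by (simp add: linear_add[OF lin[OF P(1)]] linear_diff[OF lin[OF P(1)]])
    then show "M v - P (M v) = v - P v"
      using mem[of v] P(2)[of v] by (simp add: M_def)
  next
    fix u assume u: "u \<in> U"
    then show "\<Phi> (?A u) = M (\<Phi> u)" by (simp add: M_def PP I(5))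
  qed (use A(1) lin P M AU monoid_repD(1)[OF MU] I rep_homD(1)[OF I(1)] in auto)
  moreover have "network_field g (0, 0) = 0" using G(2) linear_0[OF lin[OF M]] by simp
  ultimately show ?thesis using that[of g P \<Phi> W' s'] G W' P(3) MP \<Phi> by simp
qed

section \<open>Generic bifurcations\<close>

lemma monoid_rep_generalized_kernel:
  fixes f :: "((real^'d)^'s::{finite,monoid_mult}) \<times> (real^'l) \<Rightarrow> real^'d"
  assumes "smooth f"
  shows "monoid_rep network_action (generalized_kernel (network_linearization f))"
  using network_linearization_equivariant[OF assms]
  by (intro subrep[OF monoid_rep_network_action] subspace_generalized_kernel)
    (auto intro: generalized_kernel_commute[OF linear_network_action])

lemma monoid_rep_center_subspace:
  fixes f :: "((real^'d)^'s::{finite,monoid_mult}) \<times> (real^'l) \<Rightarrow> real^'d"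
  assumes "smooth f"
  shows "monoid_rep network_action (center_subspace (network_linearization f))"
  using network_linearization_equivariant[OF assms]
  by (intro subrep[OF monoid_rep_network_action] subspace_center_subspace)
    (auto intro: center_subspace_commute[OF linear_network_action])

lemma generic_steady_state_bifurcation_transfer:
  fixes f :: "((real^'d)^'s::{finite,monoid_mult}) \<times> (real^'l) \<Rightarrow> real^'d"
  assumes f: "generic_steady_state_bifurcation f"
  obtains g :: "((real^'l)^'s::{finite,monoid_mult}) \<times> (real^'l) \<Rightarrow> real^'l" and \<Phi>
  where "generic_steady_state_bifurcation g"
    "rep_iso network_action (generalized_kernel (network_linearization f))
       network_action (generalized_kernel (network_linearization g)) \<Phi>"
    "monoid_rep network_action (generalized_kernel (network_linearization g))"
proof -
  let ?A = "network_linearization f"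
  let ?U = "generalized_kernel ?A"
  have sf: "smooth f" and ev: "0 \<in> eigenvalues_on UNIV ?A"
    using f by (simp_all add: generic_steady_state_bifurcation_def)
  note A = network_linearization_equivariant[OF sf]
  obtain R C H W s m where
    T: "typed_decomposition network_action (UNIV :: ((real^'d)^'s::{finite,monoid_mult}) set) R C H W s"
    and Um: "iso_direct_sum network_action ?U (R \<union> C \<union> H) W m"
    and K: "(\<Sum>i\<in>R. m i) + 2 * (\<Sum>i\<in>C. m i) + 4 * (\<Sum>i\<in>H. m i) \<le> CARD('l)"
    using f unfolding generic_steady_state_bifurcation_def generic_kernel_condition_def by blast
  have fin: "finite R" "finite C" "finite H" using T by (simp_all add: typed_decomposition_def)
  \<comment> \<open>Every multiplicity occurs in the sum with weight at least 1, so none exceeds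
    \<open>l\<close>.\<close>
  have ml: "m i \<le> CARD('l)" if "i \<in> R \<union> C \<union> H" for i
    using that K member_le_sum[of i R m] member_le_sum[of i C m] member_le_sum[of i H m] fin by auto
  have AU: "?A u \<in> ?U" if "u \<in> ?U" for u
    by (rule generalized_kernel_commute[OF A(1) refl that])
  obtain g :: "((real^'l)^'s::{finite,monoid_mult}) \<times> (real^'l) \<Rightarrow> real^'l" and P \<Phi> W' s' where
    g: "smooth g" "network_field g (0, 0) = 0" "monoid_rep network_action (range P)"
    "rep_iso network_action ?U network_action (range P) \<Phi>"
    "model_operator ?A ?U P (network_linearization g) \<Phi>"
    "typed_decomposition network_action (UNIV :: ((real^'l)^'s::{finite,monoid_mult}) set) R C H W' s'"
    "\<And>i. i \<in> R \<union> C \<union> H \<Longrightarrow> m i \<le> s' i"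
    "iso_direct_sum network_action (range P) (R \<union> C \<union> H) W' m"
    using exists_model_operator[OF sf monoid_rep_generalized_kernel[OF sf] AU T Um ml] by metis
  interpret model_operator ?A ?U P "network_linearization g" \<Phi> by (rule g(5))
  have U': "generalized_kernel (network_linearization g) = range P"
    by (rule generalized_kernel_model[OF refl])
  \<comment> \<open>For the eigenvalue 0 the real and imaginary parts of an eigenvector are
    separately in the kernel, hence in \<open>?U\<close>.\<close>
  obtain p where p: "p \<noteq> 0" "complex_shift ?A 0 p = 0" using ev by (auto simp: eigenvalues_on_def)
  then have "(?A ^^ 1) (fst p) = 0" "(?A ^^ 1) (snd p) = 0"
    by (simp_all add: complex_shift_def split_beta zero_prod_def)
  then have "fst p \<in> ?U" "snd p \<in> ?U" unfolding generalized_kernel_def by blast+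
  then have "p \<in> ?U \<times> ?U" by (simp add: mem_Times_iff)
  then have "0 \<in> eigenvalues_on UNIV (network_linearization g)" by (rule eigenvalue_model[OF _ p])
  moreover have "generic_kernel_condition network_action (UNIV :: ((real^'l)^'s::{finite,monoid_mult}) set) (range P) CARD('l)"
    unfolding generic_kernel_condition_def
    by (intro exI[of _ R] exI[of _ C] exI[of _ H] exI[of _ W'] exI[of _ s'] exI[of _ m]) (use g(6-8) K in blast)
  ultimately have "generic_steady_state_bifurcation g"
    using g(1,2) by (simp add: generic_steady_state_bifurcation_def U')
  with that[of g \<Phi>] g(3,4) show ?thesis unfolding U' by blast
qed

lemma generic_Hopf_bifurcation_transfer:
  fixes f :: "((real^'d)^'s::{finite,monoid_mult}) \<times> (real^'l) \<Rightarrow> real^'d"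
  assumes f: "generic_Hopf_bifurcation f"
  obtains g :: "((real^('l + 'l))^'s::{finite,monoid_mult}) \<times> (real^'l) \<Rightarrow> real^('l + 'l)" and \<Phi>
  where "generic_Hopf_bifurcation g"
    "rep_iso network_action (center_subspace (network_linearization f))
       network_action (center_subspace (network_linearization g)) \<Phi>"
    "monoid_rep network_action (center_subspace (network_linearization g))"
proof -
  let ?A = "network_linearization f"
  let ?U = "center_subspace ?A"
  obtain \<omega> where sf: "smooth f" and \<omega>: "\<omega> \<noteq> 0" "Complex 0 \<omega> \<in> eigenvalues_on UNIV ?A"
    using f by (auto simp: generic_Hopf_bifurcation_def)
  note A = network_linearization_equivariant[OF sf]
  obtain R C H W s m where
    T: "typed_decomposition network_action (UNIV :: ((real^'d)^'s::{finite,monoid_mult}) set) R C H W s"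
    and Um: "iso_direct_sum network_action ?U (R \<union> C \<union> H) W m"
    and K: "(\<Sum>i\<in>R. nat \<lceil>real (m i) / 2\<rceil>) + (\<Sum>i\<in>C. m i) + (\<Sum>i\<in>H. m i) \<le> CARD('l)"
    using f unfolding generic_Hopf_bifurcation_def generic_center_condition_def by blast
  have fin: "finite R" "finite C" "finite H" using T by (simp_all add: typed_decomposition_def)
  have ml: "m i \<le> CARD('l + 'l)" if i: "i \<in> R \<union> C \<union> H" for i
  proof -
    \<comment> \<open>A real type multiplicity counts only by its half rounded up, which bounds it
      by \<open>2 l\<close>; the others are bounded by \<open>l\<close>. This is the origin of
      \<open>'l + 'l\<close>.\<close>
    have "i \<in> R \<Longrightarrow> nat \<lceil>real (m i) / 2\<rceil> \<le> CARD('l)"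
      using K member_le_sum[of i R "\<lambda>i. nat \<lceil>real (m i) / 2\<rceil>"] fin by linarith
    then have "i \<in> R \<Longrightarrow> m i \<le> 2 * CARD('l)" by linarith
    then show ?thesis
      using i K member_le_sum[of i C m] member_le_sum[of i H m] fin by auto
  qed
  have AU: "?A u \<in> ?U" if "u \<in> ?U" for u
    by (rule center_subspace_commute[OF A(1) refl that])
  obtain g :: "((real^('l + 'l))^'s::{finite,monoid_mult}) \<times> (real^'l) \<Rightarrow> real^('l + 'l)" and P \<Phi> W' s' where
    g: "smooth g" "network_field g (0, 0) = 0" "monoid_rep network_action (range P)"
    "rep_iso network_action ?U network_action (range P) \<Phi>"
    "model_operator ?A ?U P (network_linearization g) \<Phi>"
    "typed_decomposition network_action (UNIV :: ((real^('l + 'l))^'s::{finite,monoid_mult}) set) R C H W' s'"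
    "\<And>i. i \<in> R \<union> C \<union> H \<Longrightarrow> m i \<le> s' i"
    "iso_direct_sum network_action (range P) (R \<union> C \<union> H) W' m"
    using exists_model_operator[OF sf monoid_rep_center_subspace[OF sf] AU T Um ml] by metis
  interpret model_operator ?A ?U P "network_linearization g" \<Phi> by (rule g(5))
  have U': "center_subspace (network_linearization g) = range P"
    by (rule center_subspace_model[OF refl])
  obtain p where p: "p \<noteq> 0" "complex_shift ?A (Complex 0 \<omega>) p = 0"
    using \<omega>(2) by (auto simp: eigenvalues_on_def)
  \<comment> \<open>The eigenvector is viewed as a generalized one for exponent 1, so that its two
    parts lie in the center subspace.\<close>
  then have "(complex_shift ?A (Complex 0 \<omega>) ^^ 1) p = 0" by simp
  then have "p \<in> generalized_eigenspace ?A (Complex 0 \<omega>)"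
    unfolding generalized_eigenspace_def by blast
  moreover have "Complex 0 \<omega> \<in> imaginary_axis" by (simp add: imaginary_axis_def)
  ultimately have "p \<in> ?U \<times> ?U"
    using center_subspace_components[OF A(1), of "fst p" "snd p"] by (simp add: mem_Times_iff)
  then have "Complex 0 \<omega> \<in> eigenvalues_on UNIV (network_linearization g)" by (rule eigenvalue_model[OF _ p])
  moreover have "generic_center_condition network_action (UNIV :: ((real^('l + 'l))^'s::{finite,monoid_mult}) set) (range P) CARD('l)"
    unfolding generic_center_condition_def
    by (intro exI[of _ R] exI[of _ C] exI[of _ H] exI[of _ W'] exI[of _ s'] exI[of _ m]) (use g(6-8) K in blast)
  ultimately have "generic_Hopf_bifurcation g"
    using g(1,2) \<omega>(1) unfolding generic_Hopf_bifurcation_def U' by blast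
  with that[of g \<Phi>] g(3,4) show ?thesis unfolding U' by blast
qed

text \<open>\<open>X\<close> may live in any real vector space and stands for the isomorphism class
  that occurs; the type \<open>'l + 'l\<close> provides the internal dimension
  \<open>2 l\<close>.\<close>

theorem theorem3p8:
  fixes \<rho> :: "'s::{finite,monoid_mult} \<Rightarrow> 'x::real_vector \<Rightarrow> 'x"
    and X :: "'x set"
  assumes "monoid_rep \<rho> X"
  shows
    "(\<forall>f :: ((real^'d)^'s::{finite,monoid_mult}) \<times> (real^'l) \<Rightarrow> real^'d.
        generic_steady_state_bifurcation f \<and>
        isomorphic_reps \<rho> X network_action (generalized_kernel (network_linearization f)) \<longrightarrow>
        (\<exists>g :: ((real^'l)^'s::{finite,monoid_mult}) \<times> (real^'l) \<Rightarrow> real^'l.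
           generic_steady_state_bifurcation g \<and>
           isomorphic_reps \<rho> X network_action (generalized_kernel (network_linearization g)) \<and>
           equivalent_reduced_problems TYPE(real^'l) {0}
             network_action (generalized_kernel (network_linearization f))
             network_action (generalized_kernel (network_linearization g))))
     \<and>
     (\<forall>f :: ((real^'d)^'s::{finite,monoid_mult}) \<times> (real^'l) \<Rightarrow> real^'d.
        generic_Hopf_bifurcation f \<and>
        isomorphic_reps \<rho> X network_action (center_subspace (network_linearization f)) \<longrightarrow>
        (\<exists>g :: ((real^('l + 'l))^'s::{finite,monoid_mult}) \<times> (real^'l) \<Rightarrow> real^('l + 'l).
           generic_Hopf_bifurcation g \<and>
           isomorphic_reps \<rho> X network_action (center_subspace (network_linearization g)) \<and>
           equivalent_reduced_problems TYPE(real^'l) imaginary_axis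
             network_action (center_subspace (network_linearization f))
             network_action (center_subspace (network_linearization g))))"
proof (intro conjI allI impI; elim conjE)
  fix f :: "((real^'d)^'s::{finite,monoid_mult}) \<times> (real^'l) \<Rightarrow> real^'d"
  let ?U = "generalized_kernel (network_linearization f)"
  assume f: "generic_steady_state_bifurcation f" and iso: "isomorphic_reps \<rho> X network_action ?U"
  obtain g :: "((real^'l)^'s::{finite,monoid_mult}) \<times> (real^'l) \<Rightarrow> real^'l" and \<Phi> where
    g: "generic_steady_state_bifurcation g"
    "rep_iso network_action ?U network_action (generalized_kernel (network_linearization g)) \<Phi>"
    "monoid_rep network_action (generalized_kernel (network_linearization g))"
    using generic_steady_state_bifurcation_transfer[OF f] .
  have "smooth f" using f by (simp add: generic_steady_state_bifurcation_def)
  note MU = monoid_rep_generalized_kernel[OF this]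
  have "isomorphic_reps network_action ?U network_action (generalized_kernel (network_linearization g))"
    using g(2) unfolding isomorphic_reps_def by blast
  note isomorphic_reps_trans[OF iso this]
  with g(1) rep_iso_equivalent_reduced_problems[OF g(2) MU g(3)]
  show "\<exists>g :: ((real^'l)^'s::{finite,monoid_mult}) \<times> (real^'l) \<Rightarrow> real^'l.
      generic_steady_state_bifurcation g \<and>
      isomorphic_reps \<rho> X network_action (generalized_kernel (network_linearization g)) \<and>
      equivalent_reduced_problems TYPE(real^'l) {0} network_action ?U
        network_action (generalized_kernel (network_linearization g))"
    by blast
next
  fix f :: "((real^'d)^'s::{finite,monoid_mult}) \<times> (real^'l) \<Rightarrow> real^'d"
  let ?U = "center_subspace (network_linearization f)"
  assume f: "generic_Hopf_bifurcation f" and iso: "isomorphic_reps \<rho> X network_action ?U"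
  obtain g :: "((real^('l + 'l))^'s::{finite,monoid_mult}) \<times> (real^'l) \<Rightarrow> real^('l + 'l)" and \<Phi> where
    g: "generic_Hopf_bifurcation g"
    "rep_iso network_action ?U network_action (center_subspace (network_linearization g)) \<Phi>"
    "monoid_rep network_action (center_subspace (network_linearization g))"
    using generic_Hopf_bifurcation_transfer[OF f] .
  have "smooth f" using f by (simp add: generic_Hopf_bifurcation_def)
  note MU = monoid_rep_center_subspace[OF this]
  have "isomorphic_reps network_action ?U network_action (center_subspace (network_linearization g))"
    using g(2) unfolding isomorphic_reps_def by blast
  note isomorphic_reps_trans[OF iso this]
  with g(1) rep_iso_equivalent_reduced_problems[OF g(2) MU g(3)]
  show "\<exists>g :: ((real^('l + 'l))^'s::{finite,monoid_mult}) \<times> (real^'l) \<Rightarrow> real^('l + 'l).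
      generic_Hopf_bifurcation g \<and>
      isomorphic_reps \<rho> X network_action (center_subspace (network_linearization g)) \<and>
      equivalent_reduced_problems TYPE(real^'l) imaginary_axis network_action ?U
        network_action (center_subspace (network_linearization g))"
    by blast
qed

end
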